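(* There does not exist an $\mathrm{Out}(W_4)$-equivariant piecewise Euclidean $\mathrm{CAT}(0)$ metric on McCullough–Miller space $K_4$, nor an $\mathrm{Out}(W_4)$-equivariant piecewise hyperbolic $\mathrm{CAT}(-1)$ metric on $K_4$.
   Context: $W_n=\langle a_1,\dots,a_n\mid a_i^2=1\rangle$, $[n]=\{1,\dots,n\}$. For $i\in[n]$ and nonempty $D\subseteq[n]\setminus\{i\}$, the partial conjugation $x_{i,D}$ sends $a_j\mapsto a_ia_ja_i$ for $j\in D$ and fixes the other generators. $\mathrm{Out}^0(W_n)=\mathrm{Aut}^0(W_n)/\mathrm{Inn}(W_n)$ where $\mathrm{Aut}^0(W_n)$ consists of automorphisms sending each $a_j$ to a conjugate of itself; $\mathrm{Out}(W_n)=\mathrm{Out}^0(W_n)\rtimes\Sigma_n$, with $\Sigma_n$ acting by permuting the generators $a_i$. Hypertrees: a hypertree on $[n]$ is a set of subsets (hyperedges) of $[n]$ of size $\ge2$ such that any two vertices are joined by a unique simple walk (alternating sequence of distinct vertices and distinct hyperedges, consecutive vertices in the intervening hyperedge); $\mathcal{HT}_n$ is the set of them. $\Theta\le\Lambda$ if $\Theta$ is obtained from $\Lambda$ by finitely many folds (a fold replaces two intersecting distinct hyperedges by their union). $\Theta$ carries $x_{i,D}$ if for every $d\in D$, $j\in[n]\setminus(D\cup\{i\})$ the simple walk from $d$ to $j$ visits $i$; $\alpha\in\mathrm{Out}^0(W_n)$ is carried by $\Theta$ if it is a product of partial conjugations carried by $\Theta$. McCullough–Miller space: on $\mathrm{Out}^0(W_n)\times\mathcal{HT}_n$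 set $(\alpha,\Theta)\sim(\beta,\Lambda)$ iff $\Theta=\Lambda$ and $\alpha^{-1}\beta$ is carried by $\Theta$; write $[\alpha,\Theta]$ for classes. Partially order classes by $[\alpha,\Theta]\le[\beta,\Lambda]$ iff $\Theta\le\Lambda$ and $\alpha^{-1}\beta$ is carried by $\Lambda$. $K_n$ is the simplicial realization (order complex) of this poset. $\mathrm{Out}(W_n)$ acts by simplicial automorphisms via $\varphi\sigma\cdot[\alpha,\Theta]=[\varphi\,\sigma\alpha\sigma^{-1},\sigma\Theta]$ ($\varphi\in\mathrm{Out}^0(W_n)$, $\sigma\in\Sigma_n$, $\sigma\Theta$ the hypertree with relabeled vertices). For $n=4$, $K_4$ is 2-dimensional. A piecewise Euclidean (resp. hyperbolic) metric on $K_n$ means: each simplex is metrized as a geodesic simplex in Euclidean space (resp. hyperbolic space $\mathbb{H}^m$), face inclusions are isometries, and $K_n$ carries the induced length metric. It is $G$-equivariant if $G$ acts by isometries. *)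

theory Defs
  imports Complex_Main "HOL-Combinatorics.Permutations"
begin

fun red :: "nat list \<Rightarrow> nat list" where
  "red [] = []"
| "red (x # xs) = (case red xs of [] \<Rightarrow> [x] | y # ys \<Rightarrow> (if x = y then ys else x # y # ys))"

definition W :: "nat \<Rightarrow> nat list set" where
  "W n = {w. set w \<subseteq> {1..n} \<and> red w = w}"

text \<open>An endomorphism of W_n is given by the images of the generators a_j (j in {1..n});
  by convention it maps j to [j] for j outside {1..n}.\<close>
type_synonym aut = "nat \<Rightarrow> nat list"

definition wapp :: "aut \<Rightarrow> nat list \<Rightarrow> nat list" where
  "wapp f w = red (concat (map f w))"

definition comp_aut :: "aut \<Rightarrow> aut \<Rightarrow> aut" where
  "comp_aut f g = (\<lambda>j. wapp f (g j))"

definition id_aut :: aut where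
  "id_aut = (\<lambda>j. [j])"

definition Aut0 :: "nat \<Rightarrow> aut set" where
  "Aut0 n = {f. (\<forall>j. j \<notin> {1..n} \<longrightarrow> f j = [j])
              \<and> (\<forall>j\<in>{1..n}. \<exists>w\<in>W n. f j = red (w @ [j] @ rev w))
              \<and> bij_betw (wapp f) (W n) (W n)}"

definition Inn :: "nat \<Rightarrow> aut set" where
  "Inn n = {(\<lambda>j. if j \<in> {1..n} then red (w @ [j] @ rev w) else [j]) | w. w \<in> W n}"

definition pconj :: "nat \<Rightarrow> nat set \<Rightarrow> aut" where
  "pconj i D = (\<lambda>j. if j \<in> D then [i, j, i] else [j])"

definition walk :: "nat \<Rightarrow> nat set set \<Rightarrow> nat list \<Rightarrow> nat set list \<Rightarrow> bool" where
  "walk n \<Theta> vs es \<longleftrightarrow> length vs = Suc (length es) \<and> distinct vs \<and> distinct es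
     \<and> set vs \<subseteq> {1..n} \<and> set es \<subseteq> \<Theta>
     \<and> (\<forall>k < length es. vs ! k \<in> es ! k \<and> vs ! Suc k \<in> es ! k)"

definition hypertree :: "nat \<Rightarrow> nat set set \<Rightarrow> bool" where
  "hypertree n \<Theta> \<longleftrightarrow> (\<forall>E\<in>\<Theta>. E \<subseteq> {1..n} \<and> card E \<ge> 2)
     \<and> (\<forall>a\<in>{1..n}. \<forall>b\<in>{1..n}. \<exists>!(vs, es). walk n \<Theta> vs es \<and> hd vs = a \<and> last vs = b)"

definition HT :: "nat \<Rightarrow> nat set set set" where
  "HT n = {\<Theta>. hypertree n \<Theta>}"

definition fold1 :: "nat set set \<Rightarrow> nat set set \<Rightarrow> bool" where
  "fold1 \<Lambda> \<Theta> \<longleftrightarrow> (\<exists>E F. E \<in> \<Lambda> \<and> F \<in> \<Lambda> \<and> E \<noteq> F \<and> E \<inter> F \<noteq> {}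
                      \<and> \<Theta> = (\<Lambda> - {E, F}) \<union> {E \<union> F})"

definition ht_le :: "nat set set \<Rightarrow> nat set set \<Rightarrow> bool" where
  "ht_le \<Theta> \<Lambda> \<longleftrightarrow> (\<Lambda>, \<Theta>) \<in> {(A, B). fold1 A B}\<^sup>*"

definition carries :: "nat \<Rightarrow> nat set set \<Rightarrow> nat \<Rightarrow> nat set \<Rightarrow> bool" where
  "carries n \<Theta> i D \<longleftrightarrow> (\<forall>d\<in>D. \<forall>j\<in>{1..n} - (D \<union> {i}). \<forall>vs es.
      walk n \<Theta> vs es \<and> hd vs = d \<and> last vs = j \<longrightarrow> i \<in> set vs)"

definition carried_pconjs :: "nat \<Rightarrow> nat set set \<Rightarrow> aut set" where
  "carried_pconjs n \<Theta> = {pconj i D | i D. i \<in> {1..n} \<and> D \<subseteq> {1..n} - {i} \<and> D \<noteq> {}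
                                          \<and> carries n \<Theta> i D}"

inductive_set prods :: "aut set \<Rightarrow> aut set" for S where
  prods_id: "id_aut \<in> prods S"
| prods_step: "f \<in> prods S \<Longrightarrow> s \<in> S \<Longrightarrow> comp_aut f s \<in> prods S"

text \<open>c (an element of Aut^0) represents an outer class carried by \<Theta>: the class contains
  a product of partial conjugations carried by \<Theta>.\<close>
definition carried :: "nat \<Rightarrow> nat set set \<Rightarrow> aut \<Rightarrow> bool" where
  "carried n \<Theta> c \<longleftrightarrow> (\<exists>p\<in>prods (carried_pconjs n \<Theta>). \<exists>\<iota>\<in>Inn n. c = comp_aut p \<iota>)"

type_synonym vtx = "(aut \<times> nat set set) set"

definition mm_rel :: "nat \<Rightarrow> aut \<times> nat set set \<Rightarrow> aut \<times> nat set set \<Rightarrow> bool" where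
  "mm_rel n a b \<longleftrightarrow> snd a = snd b \<and> (\<exists>c. carried n (snd a) c \<and> fst b = comp_aut (fst a) c)"

definition mm_class :: "nat \<Rightarrow> aut \<times> nat set set \<Rightarrow> vtx" where
  "mm_class n a = {b \<in> Aut0 n \<times> HT n. mm_rel n a b}"

definition Verts :: "nat \<Rightarrow> vtx set" where
  "Verts n = mm_class n ` (Aut0 n \<times> HT n)"

definition mm_le :: "nat \<Rightarrow> vtx \<Rightarrow> vtx \<Rightarrow> bool" where
  "mm_le n u v \<longleftrightarrow> (\<exists>(\<alpha>, \<Theta>)\<in>u. \<exists>(\<beta>, \<Lambda>)\<in>v. ht_le \<Theta> \<Lambda>
                        \<and> (\<exists>c. carried n \<Lambda> c \<and> \<beta> = comp_aut \<alpha> c))"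

definition simplices :: "nat \<Rightarrow> vtx set set" where
  "simplices n = {\<sigma>. finite \<sigma> \<and> \<sigma> \<noteq> {} \<and> \<sigma> \<subseteq> Verts n
                     \<and> (\<forall>u\<in>\<sigma>. \<forall>v\<in>\<sigma>. mm_le n u v \<or> mm_le n v u)}"

text \<open>Action of Out(W_n) = Out^0(W_n) \<rtimes> \<Sigma>_n, through representatives
  (\<phi>, \<pi>) with \<phi> in Aut^0 and \<pi> a permutation of {1..n}.\<close>
definition conjperm :: "(nat \<Rightarrow> nat) \<Rightarrow> aut \<Rightarrow> aut" where
  "conjperm \<pi> \<beta> = (\<lambda>j. map \<pi> (\<beta> (inv \<pi> j)))"

definition act_pair :: "aut \<times> (nat \<Rightarrow> nat) \<Rightarrow> aut \<times> nat set set \<Rightarrow> aut \<times> nat set set" where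
  "act_pair g a = (comp_aut (fst g) (conjperm (snd g) (fst a)), (\<lambda>E. snd g ` E) ` snd a)"

definition act :: "nat \<Rightarrow> aut \<times> (nat \<Rightarrow> nat) \<Rightarrow> vtx \<Rightarrow> vtx" where
  "act n g v = (if v \<in> Verts n then mm_class n (act_pair g (SOME a. a \<in> v)) else v)"

type_synonym pt = "vtx \<Rightarrow> real"

definition supp :: "pt \<Rightarrow> vtx set" where
  "supp x = {v. x v \<noteq> 0}"

definition Pts :: "nat \<Rightarrow> pt set" where
  "Pts n = {x. (\<forall>v. 0 \<le> x v) \<and> supp x \<in> simplices n \<and> sum x (supp x) = 1}"

definition simplex_pts :: "vtx set \<Rightarrow> pt set" where
  "simplex_pts \<sigma> = {x. (\<forall>v. 0 \<le> x v) \<and> (\<forall>v. v \<notin> \<sigma> \<longrightarrow> x v = 0) \<and> sum x \<sigma> = 1}"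

definition comb :: "vtx set \<Rightarrow> (vtx \<Rightarrow> nat \<Rightarrow> real) \<Rightarrow> pt \<Rightarrow> nat \<Rightarrow> real" where
  "comb \<sigma> p x = (\<lambda>i. \<Sum>v\<in>\<sigma>. x v * p v i)"

definition eucl :: "nat \<Rightarrow> (nat \<Rightarrow> real) \<Rightarrow> (nat \<Rightarrow> real) \<Rightarrow> real" where
  "eucl m a b = sqrt (\<Sum>i<m. (a i - b i)\<^sup>2)"

definition aff_indep :: "nat \<Rightarrow> vtx set \<Rightarrow> (vtx \<Rightarrow> nat \<Rightarrow> real) \<Rightarrow> bool" where
  "aff_indep m \<sigma> p \<longleftrightarrow> (\<forall>z. (\<Sum>v\<in>\<sigma>. z v) = 0 \<and> (\<forall>i<m. (\<Sum>v\<in>\<sigma>. z v * p v i) = 0)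
                            \<longrightarrow> (\<forall>v\<in>\<sigma>. z v = 0))"

text \<open>Hyperbolic space H^m: hyperboloid model in R^{m+1} (coordinates 0..m).\<close>
definition mink :: "nat \<Rightarrow> (nat \<Rightarrow> real) \<Rightarrow> (nat \<Rightarrow> real) \<Rightarrow> real" where
  "mink m a b = - (a 0 * b 0) + (\<Sum>i\<in>{1..m}. a i * b i)"

definition hyp :: "nat \<Rightarrow> (nat \<Rightarrow> real) set" where
  "hyp m = {a. mink m a a = -1 \<and> a 0 > 0}"

definition hdist :: "nat \<Rightarrow> (nat \<Rightarrow> real) \<Rightarrow> (nat \<Rightarrow> real) \<Rightarrow> real" where
  "hdist m a b = arcosh (- mink m a b)"

definition hnormalize :: "nat \<Rightarrow> (nat \<Rightarrow> real) \<Rightarrow> nat \<Rightarrow> real" where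
  "hnormalize m a = (\<lambda>i. a i / sqrt (- mink m a a))"

definition lin_indep :: "nat \<Rightarrow> vtx set \<Rightarrow> (vtx \<Rightarrow> nat \<Rightarrow> real) \<Rightarrow> bool" where
  "lin_indep m \<sigma> p \<longleftrightarrow> (\<forall>z. (\<forall>i\<le>m. (\<Sum>v\<in>\<sigma>. z v * p v i) = 0) \<longrightarrow> (\<forall>v\<in>\<sigma>. z v = 0))"

type_synonym simplex_metrics = "vtx set \<Rightarrow> pt \<Rightarrow> pt \<Rightarrow> real"

definition face_compatible :: "nat \<Rightarrow> simplex_metrics \<Rightarrow> bool" where
  "face_compatible n ds \<longleftrightarrow> (\<forall>\<sigma>\<in>simplices n. \<forall>\<tau>\<in>simplices n. \<tau> \<subseteq> \<sigma> \<longrightarrow>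
      (\<forall>x\<in>simplex_pts \<tau>. \<forall>y\<in>simplex_pts \<tau>. ds \<sigma> x y = ds \<tau> x y))"

definition pe_metric :: "nat \<Rightarrow> simplex_metrics \<Rightarrow> bool" where
  "pe_metric n ds \<longleftrightarrow> (\<forall>\<sigma>\<in>simplices n. \<exists>m p. aff_indep m \<sigma> p \<and>
        (\<forall>x\<in>simplex_pts \<sigma>. \<forall>y\<in>simplex_pts \<sigma>. ds \<sigma> x y = eucl m (comb \<sigma> p x) (comb \<sigma> p y)))
     \<and> face_compatible n ds"

text \<open>Each simplex metrized as a (nondegenerate) geodesic simplex in some H^m
  (points = normalized positive combinations of the vertices in the hyperboloid model).\<close>
definition ph_metric :: "nat \<Rightarrow> simplex_metrics \<Rightarrow> bool" where
  "ph_metric n ds \<longleftrightarrow> (\<forall>\<sigma>\<in>simplices n. \<exists>m p. (\<forall>v\<in>\<sigma>. p v \<in> hyp m) \<and> lin_indep m \<sigma> p \<and>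
        (\<forall>x\<in>simplex_pts \<sigma>. \<forall>y\<in>simplex_pts \<sigma>.
            ds \<sigma> x y = hdist m (hnormalize m (comb \<sigma> p x)) (hnormalize m (comb \<sigma> p y))))
     \<and> face_compatible n ds"

text \<open>Induced length (intrinsic) metric: infimum of lengths of strings (Bridson--Haefliger I.7.4).\<close>
definition is_string :: "nat \<Rightarrow> pt \<Rightarrow> pt \<Rightarrow> pt list \<Rightarrow> bool" where
  "is_string n x y xs \<longleftrightarrow> xs \<noteq> [] \<and> hd xs = x \<and> last xs = y \<and> set xs \<subseteq> Pts n
     \<and> (\<forall>i. Suc i < length xs \<longrightarrow> supp (xs ! i) \<union> supp (xs ! Suc i) \<in> simplices n)"

definition string_len :: "simplex_metrics \<Rightarrow> pt list \<Rightarrow> real" where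
  "string_len ds xs = (\<Sum>i<length xs - 1. ds (supp (xs ! i) \<union> supp (xs ! Suc i)) (xs ! i) (xs ! Suc i))"

definition len_dist :: "nat \<Rightarrow> simplex_metrics \<Rightarrow> pt \<Rightarrow> pt \<Rightarrow> real" where
  "len_dist n ds x y = Inf {string_len ds xs | xs. is_string n x y xs}"

definition equivariant :: "nat \<Rightarrow> simplex_metrics \<Rightarrow> bool" where
  "equivariant n ds \<longleftrightarrow> (\<forall>\<phi>\<in>Aut0 n. \<forall>\<pi>. \<pi> permutes {1..n} \<longrightarrow>
      (\<forall>x\<in>Pts n. \<forall>y\<in>Pts n.
         len_dist n ds (x \<circ> act n (\<phi>, \<pi>)) (y \<circ> act n (\<phi>, \<pi>)) = len_dist n ds x y))"

definition geodesic_seg :: "('a \<Rightarrow> 'a \<Rightarrow> real) \<Rightarrow> 'a set \<Rightarrow> 'a \<Rightarrow> 'a \<Rightarrow> (real \<Rightarrow> 'a) \<Rightarrow> bool" where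
  "geodesic_seg d X x y c \<longleftrightarrow> 0 \<le> d x y \<and> c 0 = x \<and> c (d x y) = y
     \<and> (\<forall>s\<in>{0..d x y}. c s \<in> X) \<and> (\<forall>s\<in>{0..d x y}. \<forall>t\<in>{0..d x y}. d (c s) (c t) = \<bar>s - t\<bar>)"

definition geodesic_space :: "'a set \<Rightarrow> ('a \<Rightarrow> 'a \<Rightarrow> real) \<Rightarrow> bool" where
  "geodesic_space X d \<longleftrightarrow> (\<forall>x\<in>X. \<forall>y\<in>X. \<exists>c. geodesic_seg d X x y c)"

text \<open>p lies on the side c from a to b, and p' is its comparison point on the side [a',b']
  of the comparison triangle in the model space (M, dM).\<close>
definition side_pt :: "('a \<Rightarrow> 'a \<Rightarrow> real) \<Rightarrow> 'b set \<Rightarrow> ('b \<Rightarrow> 'b \<Rightarrow> real)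
     \<Rightarrow> 'a \<Rightarrow> 'a \<Rightarrow> (real \<Rightarrow> 'a) \<Rightarrow> 'b \<Rightarrow> 'b \<Rightarrow> 'a \<Rightarrow> 'b \<Rightarrow> bool" where
  "side_pt d M dM a b c a' b' p p' \<longleftrightarrow> (\<exists>s\<in>{0..d a b}. p = c s \<and> p' \<in> M
      \<and> dM a' p' = s \<and> dM p' b' = d a b - s)"

definition CAT_ineq :: "'b set \<Rightarrow> ('b \<Rightarrow> 'b \<Rightarrow> real) \<Rightarrow> 'a set \<Rightarrow> ('a \<Rightarrow> 'a \<Rightarrow> real) \<Rightarrow> bool" where
  "CAT_ineq M dM X d \<longleftrightarrow> (\<forall>x y z c1 c2 c3 x' y' z'.
      x \<in> X \<and> y \<in> X \<and> z \<in> X \<and> geodesic_seg d X x y c1 \<and> geodesic_seg d X y z c2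
      \<and> geodesic_seg d X z x c3 \<and> x' \<in> M \<and> y' \<in> M \<and> z' \<in> M
      \<and> dM x' y' = d x y \<and> dM y' z' = d y z \<and> dM z' x' = d z x \<longrightarrow>
      (\<forall>p q p' q'.
        (side_pt d M dM x y c1 x' y' p p' \<or> side_pt d M dM y z c2 y' z' p p'
           \<or> side_pt d M dM z x c3 z' x' p p') \<and>
        (side_pt d M dM x y c1 x' y' q q' \<or> side_pt d M dM y z c2 y' z' q q'
           \<or> side_pt d M dM z x c3 z' x' q q') \<longrightarrow> d p q \<le> dM p' q'))"

text \<open>Model spaces: Euclidean plane = complex plane; hyperbolic plane = Poincare disc.\<close>
definition E2_dist :: "complex \<Rightarrow> complex \<Rightarrow> real" where
  "E2_dist z w = cmod (z - w)"

definition H2 :: "complex set" where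
  "H2 = {z. cmod z < 1}"

definition H2_dist :: "complex \<Rightarrow> complex \<Rightarrow> real" where
  "H2_dist z w = arcosh (1 + 2 * (cmod (z - w))\<^sup>2 / ((1 - (cmod z)\<^sup>2) * (1 - (cmod w)\<^sup>2)))"

definition CAT0 :: "'a set \<Rightarrow> ('a \<Rightarrow> 'a \<Rightarrow> real) \<Rightarrow> bool" where
  "CAT0 X d \<longleftrightarrow> geodesic_space X d \<and> CAT_ineq UNIV E2_dist X d"

definition CAT_minus1 :: "'a set \<Rightarrow> ('a \<Rightarrow> 'a \<Rightarrow> real) \<Rightarrow> bool" where
  "CAT_minus1 X d \<longleftrightarrow> geodesic_space X d \<and> CAT_ineq H2 H2_dist X d"

end

theory Submission
  imports Defs "HOL-Analysis.Analysis"
begin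

text \<open>
  Only two features of the metric matter: it is \<open>CAT(0)\<close>, and the group acts by isometries whose
  fixed points are known combinatorially. Let \<open>h\<close>, \<open>p\<close>, \<open>s\<close> be the vertices of the trivial
  automorphism with the one-edge hypertree, the path 1-2-3-4 and the star centred at 2. In the
  geodesic triangle \<open>h p s\<close> the symmetries force comparison angles at least \<open>90\<close> degrees at
  \<open>h\<close>, \<open>arccos (3/4)\<close> at \<open>p\<close> and \<open>arccos (3/5)\<close> at \<open>s\<close>, which sum to more than
  \<open>180\<close> degrees.

  Each bound comes from points at a small distance \<open>t\<close> from the vertex. If a vertex is an isolated
  fixed point of a group that swaps two such points, then it is their midpoint, and the median
  inequality for a third point bounds distances from below. At \<open>s\<close> one needs in addition
  that \<open>s\<close> locally disconnects the fixed set of the transposition (3 4). That small metric balls lie in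
  open stars follows from a first-exit argument along strings, as the three vertices lie in finitely
  many simplices. Hyperbolic metrics are covered because \<open>CAT(-1)\<close> implies the
  \<open>CAT(0)\<close> median inequality.
\<close>

section \<open>Comparison geometry from the median inequality\<close>

text \<open>With Alexandrov angles the same symmetries would give 90, 45 and 60 degrees, a sum of
  195. Here chords replace angles: two points at distance t from a vertex whose squared distance is
  at least k t^2 bound the comparison cosine by 1 - k/2. Halving an arc by the triangle inequality
  for chords loses something and turns 45 and 60 degrees into about 41.4 and 53.1 degrees. The
  excess of 15 degrees pays for this loss, so that neither angles nor spaces of directions have to
  be constructed.

  The obstacle is that an equivariant metric does not reveal in which direction a geodesic leaves a
  vertex: the geodesic from h to s need not run along the edge that joins them. All that is known
  about such a direction is which symmetries fix it. Directions are therefore compared only through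
  isometries that fix or exchange them. At s this still leaves two candidate edges for the geodesic
  toward p, and both are treated.\<close>

lemma midpoint_convex_below_chord:
  fixes f :: "real \<Rightarrow> real"
  assumes cont: "continuous_on {0..L} f" and "0 \<le> L" and "f 0 \<le> 0" and "f L \<le> 0"
    and mid: "\<And>s t. 0 \<le> s \<Longrightarrow> s \<le> t \<Longrightarrow> t \<le> L \<Longrightarrow> f ((s + t) / 2) \<le> (f s + f t) / 2"
    and "0 \<le> t" and "t \<le> L"
  shows "f t \<le> 0"
proof -
  obtain m where m: "m \<in> {0..L}" "\<And>y. y \<in> {0..L} \<Longrightarrow> f y \<le> f m"
    using continuous_attains_sup[of "{0..L}" f] cont \<open>0 \<le> L\<close> by auto
  \<comment> \<open>The symmetric interval of radius \<open>h\<close> about the maximum point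
    reaches an end of \<open>{0..L}\<close>. Midpoint convexity spreads the maximum to both ends of
    that interval, one of which has a nonpositive value. This replaces dyadic approximation.\<close>
  define h where "h = min m (L - m)"
  have h: "0 \<le> h" "0 \<le> m - h" "m + h \<le> L" "m - h = 0 \<or> m + h = L"
    using m(1) by (auto simp: h_def)
  have "f m \<le> (f (m - h) + f (m + h)) / 2"
    using mid[of "m - h" "m + h"] h by simp
  moreover have "f (m - h) \<le> f m" "f (m + h) \<le> f m" using m(2) h by auto
  ultimately have "f m = f (m - h) \<and> f m = f (m + h)" by argo
  then have "f m \<le> 0" using h(4) assms(3,4) by metis
  then show ?thesis using m(2)[of t] assms(6,7) by force
qed

text \<open>Only the triangle inequality has to be supplied. Vanishing on the diagonal, symmetry and
  separation are read off from unit-speed geodesics, along which the distance is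
  \<open>\<bar>s - t\<bar>\<close>.\<close>

locale geodesic_metric =
  fixes X :: "'a set" and d :: "'a \<Rightarrow> 'a \<Rightarrow> real"
  assumes tri: "\<lbrakk>x \<in> X; y \<in> X; z \<in> X\<rbrakk> \<Longrightarrow> d x z \<le> d x y + d y z"
    and geod: "geodesic_space X d"
begin

lemma ex_geod: "x \<in> X \<Longrightarrow> y \<in> X \<Longrightarrow> \<exists>c. geodesic_seg d X x y c"
  using geod unfolding geodesic_space_def by blast

lemma dist_nonneg: "x \<in> X \<Longrightarrow> y \<in> X \<Longrightarrow> 0 \<le> d x y"
  using ex_geod unfolding geodesic_seg_def by blast

lemma dist_refl [simp]: "x \<in> X \<Longrightarrow> d x x = 0"
proof -
  assume "x \<in> X"
  then obtain c where c: "geodesic_seg d X x x c" using ex_geod by blast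
  then have c0: "c 0 = x" "0 \<in> {0..d x x}"
    and "\<forall>s\<in>{0..d x x}. \<forall>t\<in>{0..d x x}. d (c s) (c t) = \<bar>s - t\<bar>"
    unfolding geodesic_seg_def by auto
  then have "d (c 0) (c 0) = \<bar>0 - 0\<bar>" by blast
  then show ?thesis using c0 by simp
qed

lemma dist_sym: "x \<in> X \<Longrightarrow> y \<in> X \<Longrightarrow> d y x = d x y"
proof -
  assume "x \<in> X" "y \<in> X"
  then obtain c where c: "geodesic_seg d X x y c" using ex_geod by blast
  then have "d (c (d x y)) (c 0) = \<bar>d x y - 0\<bar>" unfolding geodesic_seg_def by fastforce
  then show ?thesis using c unfolding geodesic_seg_def by simp
qed

lemma dist_0D: "x \<in> X \<Longrightarrow> y \<in> X \<Longrightarrow> d x y = 0 \<Longrightarrow> x = y"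
proof -
  assume "x \<in> X" "y \<in> X" and 0: "d x y = 0"
  then obtain c where c: "geodesic_seg d X x y c" using ex_geod by blast
  then show ?thesis using 0 unfolding geodesic_seg_def by auto
qed

lemma dist_pos: "x \<in> X \<Longrightarrow> y \<in> X \<Longrightarrow> x \<noteq> y \<Longrightarrow> 0 < d x y"
  using dist_nonneg dist_0D by fastforce

lemma continuous_dist_geod:
  assumes "x \<in> X" "y \<in> X" "z \<in> X" and c: "geodesic_seg d X x y c"
  shows "continuous_on {0..d x y} (\<lambda>t. d z (c t))"
proof -
  have "dist (d z (c s)) (d z (c t)) \<le> dist s t" if "s \<in> {0..d x y}" "t \<in> {0..d x y}" for s t
  proof -
    have X: "c s \<in> X" "c t \<in> X" and st: "d (c s) (c t) = \<bar>s - t\<bar>" "d (c t) (c s) = \<bar>t - s\<bar>"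
      using c that unfolding geodesic_seg_def by blast+
    then show ?thesis using tri[of z "c s" "c t"] tri[of z "c t" "c s"] assms(3)
      by (simp add: dist_real_def)
  qed
  then have "1-lipschitz_on {0..d x y} (\<lambda>t. d z (c t))"
    by (auto simp: lipschitz_on_def)
  then show ?thesis by (rule lipschitz_on_continuous_on)
qed

end

text \<open>The Bruhat-Tits CN inequality. It is the only consequence of the two curvature
  conditions, besides the existence of geodesics, that the later argument uses.\<close>

locale cn_space = geodesic_metric +
  assumes CN: "\<lbrakk>x \<in> X; y \<in> X; z \<in> X; geodesic_seg d X x y c\<rbrakk>
        \<Longrightarrow> (d z (c (d x y / 2)))\<^sup>2 \<le> ((d z x)\<^sup>2 + (d z y)\<^sup>2) / 2 - (d x y)\<^sup>2 / 4"
begin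

text \<open>The difference of the two sides is continuous in t, vanishes at both ends of the
  geodesic, and is midpoint convex: the quadratic term t (L - t) L accounts exactly for the term (u
  - s)^2 / 4 in CN on the subsegment from s to u.\<close>

lemma stewart_geod:
  assumes "x \<in> X" "y \<in> X" "z \<in> X" and c: "geodesic_seg d X x y c" and t: "0 \<le> t" "t \<le> d x y"
  shows "d x y * (d z (c t))\<^sup>2 \<le> (d x y - t) * (d z x)\<^sup>2 + t * (d z y)\<^sup>2 - t * (d x y - t) * d x y"
proof -
  define L where "L = d x y"
  have L: "0 \<le> L" and c0: "c 0 = x" "c L = y"
    and cX: "\<And>s. 0 \<le> s \<Longrightarrow> s \<le> L \<Longrightarrow> c s \<in> X"
    and cd: "\<And>s t. 0 \<le> s \<Longrightarrow> s \<le> L \<Longrightarrow> 0 \<le> t \<Longrightarrow> t \<le> L \<Longrightarrow> d (c s) (c t) = \<bar>s - t\<bar>"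
    using c unfolding geodesic_seg_def L_def by auto
  define f where "f s = L * (d z (c s))\<^sup>2 - ((L - s) * (d z x)\<^sup>2 + s * (d z y)\<^sup>2 - s * (L - s) * L)" for s
  have "f t \<le> 0"
  proof (rule midpoint_convex_below_chord[where f = f and L = L])
    show "continuous_on {0..L} f"
      unfolding f_def using continuous_dist_geod[OF assms(1-4)]
      by (auto intro!: continuous_intros simp: L_def)
    fix s u assume su: "0 \<le> s" "s \<le> u" "u \<le> L"
    define c' where "c' r = c (s + r)" for r
    have dsu: "d (c s) (c u) = u - s" using cd[of s u] su by simp
    have "geodesic_seg d X (c s) (c u) c'"
      unfolding geodesic_seg_def c'_def dsu using su cX cd by auto
    then have "(d z (c ((s + u) / 2)))\<^sup>2 \<le> ((d z (c s))\<^sup>2 + (d z (c u))\<^sup>2) / 2 - (u - s)\<^sup>2 / 4"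
      using CN[of "c s" "c u" z c'] cX su assms(3) unfolding dsu c'_def
      by (simp add: field_simps)
    then have "L * (d z (c ((s + u) / 2)))\<^sup>2 \<le> L * (((d z (c s))\<^sup>2 + (d z (c u))\<^sup>2) / 2 - (u - s)\<^sup>2 / 4)"
      using L by (rule mult_left_mono)
    then show "f ((s + u) / 2) \<le> (f s + f u) / 2"
      unfolding f_def by (simp add: field_simps power2_eq_square)
  qed (use L t c0 in \<open>auto simp: f_def L_def\<close>)
  then show ?thesis by (simp add: f_def L_def)
qed

text \<open>A description of points of a segment by distances alone, so that isometries visibly
  preserve it and no parametrization has to be carried along.\<close>

definition on_seg :: "'a \<Rightarrow> 'a \<Rightarrow> real \<Rightarrow> 'a \<Rightarrow> bool" where
  "on_seg x y t m \<longleftrightarrow> m \<in> X \<and> d x m = t \<and> d m y = d x y - t"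

lemma on_seg_geod:
  assumes "x \<in> X" "y \<in> X" "geodesic_seg d X x y c" "0 \<le> t" "t \<le> d x y"
  shows "on_seg x y t (c t)"
proof -
  have "d (c 0) (c t) = \<bar>0 - t\<bar>" "d (c t) (c (d x y)) = \<bar>t - d x y\<bar>" "c t \<in> X" "c 0 = x" "c (d x y) = y"
    using assms unfolding geodesic_seg_def by fastforce+
  then show ?thesis using assms unfolding on_seg_def by auto
qed

lemma on_seg_eq_geod:
  assumes "x \<in> X" "y \<in> X" "geodesic_seg d X x y c" "0 \<le> t" "t \<le> d x y" "on_seg x y t m"
  shows "m = c t"
proof (cases "d x y = 0")
  case True
  then have "t = 0" using assms by simp
  then have "x = m" "x = c t"
    using assms on_seg_geod[OF assms(1-5)] dist_0D[of x] unfolding on_seg_def by auto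
  then show ?thesis by simp
next
  case False
  then have L: "0 < d x y" using dist_nonneg assms by fastforce
  have m: "m \<in> X" "d m x = t" "d m y = d x y - t" using assms dist_sym unfolding on_seg_def by auto
  \<comment> \<open>Stewart with \<open>m\<close> itself as the apex: inserting the distances t and
    \<open>d x y - t\<close> makes the right side vanish, which is uniqueness of geodesics.\<close>
  have "d x y * (d m (c t))\<^sup>2 \<le> (d x y - t) * t\<^sup>2 + t * (d x y - t)\<^sup>2 - t * (d x y - t) * d x y"
    using stewart_geod[OF assms(1,2) m(1) assms(3-5)] m by simp
  also have "\<dots> = 0" by (simp add: algebra_simps power2_eq_square)
  finally have "d m (c t) = 0" using L by (simp add: mult_le_0_iff)
  then show ?thesis using dist_0D m on_seg_geod[OF assms(1-5)] unfolding on_seg_def by blast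
qed

lemma stewart:
  assumes "x \<in> X" "y \<in> X" "z \<in> X" "on_seg x y t m"  "0 \<le> t" "t \<le> d x y"
  shows "d x y * (d z m)\<^sup>2 \<le> (d x y - t) * (d z x)\<^sup>2 + t * (d z y)\<^sup>2 - t * (d x y - t) * d x y"
proof -
  obtain c where c: "geodesic_seg d X x y c" using assms ex_geod by blast
  show ?thesis using stewart_geod[OF assms(1-3) c assms(5,6)]
      on_seg_eq_geod[OF assms(1,2) c assms(5,6,4)] by simp
qed

text \<open>Well defined for t between 0 and \<open>d x y\<close> by uniqueness of geodesics. Being
  determined by distances, it commutes with isometries.\<close>

definition toward :: "'a \<Rightarrow> 'a \<Rightarrow> real \<Rightarrow> 'a" where
  "toward x y t = (THE m. on_seg x y t m)"

lemma toward_eqI: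
  assumes "x \<in> X" "y \<in> X" "0 \<le> t" "t \<le> d x y" "on_seg x y t m"
  shows "toward x y t = m"
proof -
  obtain c where c: "geodesic_seg d X x y c" using assms ex_geod by blast
  show ?thesis unfolding toward_def
    using assms on_seg_eq_geod[OF assms(1,2) c assms(3,4)] by (intro the_equality) auto
qed

lemma toward_geod:
  assumes "x \<in> X" "y \<in> X" "geodesic_seg d X x y c" "0 \<le> t" "t \<le> d x y"
  shows "toward x y t = c t"
  by (rule toward_eqI[OF assms(1,2,4,5) on_seg_geod[OF assms]])

lemma on_seg_toward:
  assumes "x \<in> X" "y \<in> X" "0 \<le> t" "t \<le> d x y"
  shows "on_seg x y t (toward x y t)"
  by (metis assms ex_geod on_seg_geod toward_geod)

lemma toward_in [simp]: "x \<in> X \<Longrightarrow> y \<in> X \<Longrightarrow> 0 \<le> t \<Longrightarrow> t \<le> d x y \<Longrightarrow> toward x y t \<in> X"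
  using on_seg_toward on_seg_def by blast

lemma dist_toward [simp]: "x \<in> X \<Longrightarrow> y \<in> X \<Longrightarrow> 0 \<le> t \<Longrightarrow> t \<le> d x y \<Longrightarrow> d x (toward x y t) = t"
  using on_seg_toward on_seg_def by blast

lemma dist_toward_toward:
  assumes "x \<in> X" "y \<in> X" "0 \<le> s" "s \<le> d x y" "0 \<le> t" "t \<le> d x y"
  shows "d (toward x y s) (toward x y t) = \<bar>s - t\<bar>"
proof -
  obtain c where c: "geodesic_seg d X x y c" using assms ex_geod by blast
  have "d (c s) (c t) = \<bar>s - t\<bar>" using c assms unfolding geodesic_seg_def by auto
  then show ?thesis using toward_geod[OF assms(1,2) c] assms by simp
qed

section \<open>Isometries, comparison angles and antipodal points\<close>

definition isom :: "('a \<Rightarrow> 'a) \<Rightarrow> bool" where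
  "isom F \<longleftrightarrow> F ` X \<subseteq> X \<and> (\<forall>x\<in>X. \<forall>y\<in>X. d (F x) (F y) = d x y)"

lemma isom_in: "isom F \<Longrightarrow> x \<in> X \<Longrightarrow> F x \<in> X"
  and isom_dist: "isom F \<Longrightarrow> x \<in> X \<Longrightarrow> y \<in> X \<Longrightarrow> d (F x) (F y) = d x y"
  unfolding isom_def by auto

lemma isom_toward:
  assumes "isom F" "x \<in> X" "y \<in> X" "0 \<le> t" "t \<le> d x y"
  shows "F (toward x y t) = toward (F x) (F y) t"
  using assms on_seg_toward[OF assms(2-5)]
  by (intro toward_eqI[symmetric]) (auto simp: on_seg_def isom_def)

text \<open>Comparison angles do not increase when the points on the sides move toward the apex;
  this is Stewart applied along [x,y] and then along [x,z]. A squared chord of at least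
  \<open>k * t^2\<close> at distance t means a cosine of at most 1 - k/2, and twice that is the
  coefficient 2 - k of the law of cosines.\<close>

lemma comparison:
  assumes X: "x \<in> X" "y \<in> X" "z \<in> X" and t: "0 < t" "t \<le> d x y" "t \<le> d x z"
    and k: "k * t\<^sup>2 \<le> (d (toward x y t) (toward x z t))\<^sup>2"
  shows "(d x y)\<^sup>2 + (d x z)\<^sup>2 - (d y z)\<^sup>2 \<le> (2 - k) * d x y * d x z"
proof -
  define a b g where "a = d x y" and "b = d x z" and "g = d y z"
  define u v where "u = toward x y t" and "v = toward x z t"
  have ab: "0 < a" "0 < b" "t \<le> a" "t \<le> b" using t by (auto simp: a_def b_def)
  have u: "on_seg x y t u" and v: "on_seg x z t v"
    using on_seg_toward X t by (auto simp: u_def v_def)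
  then have uv: "u \<in> X" "v \<in> X" "d x u = t" "d v x = t" using dist_sym X by (auto simp: on_seg_def)
  have zu: "a * (d z u)\<^sup>2 \<le> (a - t) * b\<^sup>2 + t * g\<^sup>2 - t * (a - t) * a"
    using stewart[OF X(1,2,3) u] t X dist_sym by (simp add: a_def b_def g_def)
  have "b * (d u v)\<^sup>2 \<le> (b - t) * t\<^sup>2 + t * (d z u)\<^sup>2 - t * (b - t) * b"
    using stewart[OF X(1,3) uv(1) v] t X uv dist_sym by (simp add: b_def)
  then have "a * (b * (d u v)\<^sup>2) \<le> a * ((b - t) * t\<^sup>2 + t * (d z u)\<^sup>2 - t * (b - t) * b)"
    using ab by (intro mult_left_mono) auto
  also have "\<dots> = a * (b - t) * t\<^sup>2 + t * (a * (d z u)\<^sup>2) - a * t * (b - t) * b"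
    by (simp add: algebra_simps)
  also have "\<dots> \<le> a * (b - t) * t\<^sup>2 + t * ((a - t) * b\<^sup>2 + t * g\<^sup>2 - t * (a - t) * a) - a * t * (b - t) * b"
    using zu t by (simp add: mult_left_mono)
  also have "\<dots> = t\<^sup>2 * (2 * a * b + g\<^sup>2 - a\<^sup>2 - b\<^sup>2)"
    by (simp add: algebra_simps power2_eq_square)
  finally have "a * (b * (d u v)\<^sup>2) \<le> t\<^sup>2 * (2 * a * b + g\<^sup>2 - a\<^sup>2 - b\<^sup>2)" .
  moreover have "a * (b * (k * t\<^sup>2)) \<le> a * (b * (d u v)\<^sup>2)"
    using ab k by (intro mult_left_mono) (auto simp: u_def v_def)
  ultimately have "t\<^sup>2 * (k * a * b) \<le> t\<^sup>2 * (2 * a * b + g\<^sup>2 - a\<^sup>2 - b\<^sup>2)"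
    by (simp add: algebra_simps)
  then have "k * a * b \<le> 2 * a * b + g\<^sup>2 - a\<^sup>2 - b\<^sup>2" using t by simp
  then show ?thesis by (simp add: a_def b_def g_def algebra_simps)
qed

lemma median:
  assumes X: "x \<in> X" "y \<in> X" "z \<in> X" "m \<in> X" and "d m x = t" "d m y = t" "d x y = 2 * t" "0 \<le> t"
  shows "4 * t\<^sup>2 + 2 * (d z m)\<^sup>2 \<le> 2 * t\<^sup>2 + (d z x)\<^sup>2 + (d z y)\<^sup>2"
proof (cases "t = 0")
  case True
  then have "m = x" "m = y" using assms dist_0D by auto
  then show ?thesis using True by simp
next
  case False
  have "on_seg x y t m" using assms dist_sym unfolding on_seg_def by auto
  then have "(2 * t) * (d z m)\<^sup>2 \<le> t * (d z x)\<^sup>2 + t * (d z y)\<^sup>2 - t * t * (2 * t)"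
    using stewart[OF X(1-3), of t m] assms by simp
  then have "t * (2 * (d z m)\<^sup>2) \<le> t * ((d z x)\<^sup>2 + (d z y)\<^sup>2 - 2 * t\<^sup>2)"
    by (simp add: algebra_simps power2_eq_square)
  then show ?thesis using False assms by simp
qed

text \<open>Convexity of balls: the last term of Stewart is dropped, and the remaining two are a
  weighted mean of squared radii.\<close>

lemma toward_close:
  assumes X: "x \<in> X" "y \<in> X" "z \<in> X" and t: "0 \<le> t" "t \<le> d x y"
    and r: "d z x \<le> r" "d z y \<le> r"
  shows "d z (toward x y t) \<le> r"
proof (cases "d x y = 0")
  case True
  then have "t = 0" using t by simp
  then have "toward x y t = x" using X t by (intro toward_eqI) (auto simp: on_seg_def)
  then show ?thesis using r by simp
next
  case False
  define L where "L = d x y"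
  have L: "0 < L" using False dist_nonneg X by (force simp: L_def)
  have r0: "0 \<le> r" using r dist_nonneg[of z x] X by simp
  have sq: "(d z x)\<^sup>2 \<le> r\<^sup>2" "(d z y)\<^sup>2 \<le> r\<^sup>2"
    using r dist_nonneg X by (auto intro: power_mono)
  have "L * (d z (toward x y t))\<^sup>2 \<le> (L - t) * (d z x)\<^sup>2 + t * (d z y)\<^sup>2 - t * (L - t) * L"
    unfolding L_def using stewart[OF X on_seg_toward] X t by simp
  also have "\<dots> \<le> (L - t) * r\<^sup>2 + t * r\<^sup>2 - 0"
    using sq t L by (intro diff_mono add_mono mult_left_mono) (auto simp: L_def)
  finally have "(d z (toward x y t))\<^sup>2 \<le> r\<^sup>2" using L by (simp add: algebra_simps)
  then show ?thesis using r0 by (rule power2_le_imp_le)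
qed

text \<open>The midpoint of [x,y] depends only on the unordered pair, so every member of
  \<open>G\<close> fixes it; by convexity it stays in the ball about \<open>z\<close>, where
  \<open>z\<close> is the only common fixed point. So x and y are antipodal about z.\<close>

lemma opposite_of_isolated:
  assumes X: "x \<in> X" "y \<in> X" "z \<in> X" and t: "d z x = t" "d z y = t"
    and G: "\<And>F. F \<in> G \<Longrightarrow> isom F \<and> (F x = x \<and> F y = y \<or> F x = y \<and> F y = x)"
    and iso: "\<And>m. m \<in> X \<Longrightarrow> d z m \<le> t \<Longrightarrow> (\<forall>F\<in>G. F m = m) \<Longrightarrow> m = z"
  shows "d x y = 2 * t"
proof -
  define m where "m = toward x y (d x y / 2)"
  have pos: "0 \<le> d x y" using dist_nonneg X by blast
  have m: "on_seg x y (d x y / 2) m" unfolding m_def using on_seg_toward X pos by simp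
  have "m = z"
  proof (rule iso)
    show "m \<in> X" using m on_seg_def by blast
    show "d z m \<le> t" unfolding m_def using toward_close X pos t by simp
    show "\<forall>F\<in>G. F m = m"
    proof
      fix F assume F: "F \<in> G"
      have mX: "m \<in> X" and xm: "d x m = d x y / 2" "d y m = d x y / 2"
        using m X dist_sym unfolding on_seg_def by auto
      have i: "isom F" using G F by blast
      have "F m \<in> X" using isom_in i mX by blast
      moreover have "d (F x) (F m) = d x y / 2" "d (F y) (F m) = d x y / 2"
        using isom_dist[OF i _ mX] X xm by auto
      then have "d x (F m) = d x y / 2" "d y (F m) = d x y / 2" using G[OF F] by auto
      ultimately have "on_seg x y (d x y / 2) (F m)"
        using dist_sym X unfolding on_seg_def by auto
      then have "toward x y (d x y / 2) = F m" using X pos by (intro toward_eqI) auto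
      then show "F m = m" by (simp add: m_def)
    qed
  qed
  then have "d x z = d x y / 2" using m on_seg_def by blast
  then show ?thesis using dist_sym[OF X(1,3)] t by simp
qed

text \<open>Adding the bounds at y and z gives the projection formula 2g \<le> (3/2) a + (6/5) b for
  the side g opposite x. By Cauchy-Schwarz its right side squared is at most (9/4 + 36/25)(a^2 +
  b^2) = (369/100)(a^2 + b^2), and a^2 + b^2 \<le> g^2 by the bound at x. Since 369/100 is less than
  4, this is impossible.\<close>

lemma triangle_contradiction:
  assumes X: "x \<in> X" "y \<in> X" "z \<in> X" and ne: "y \<noteq> z"
    and x: "(d x y)\<^sup>2 + (d x z)\<^sup>2 - (d y z)\<^sup>2 \<le> 0"
    and y: "(d y x)\<^sup>2 + (d y z)\<^sup>2 - (d x z)\<^sup>2 \<le> 3/2 * d y x * d y z"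
    and z: "(d z x)\<^sup>2 + (d z y)\<^sup>2 - (d x y)\<^sup>2 \<le> 6/5 * d z x * d z y"
  shows False
proof -
  define a b g where "a = d x y" and "b = d x z" and "g = d y z"
  have s: "d y x = a" "d z x = b" "d z y = g" using dist_sym X by (auto simp: a_def b_def g_def)
  have g: "0 < g" using dist_pos X ne by (simp add: g_def)
  have i: "a\<^sup>2 + b\<^sup>2 \<le> g\<^sup>2" using x by (simp add: a_def b_def g_def)
  have "2 * g\<^sup>2 \<le> g * (3/2 * a + 6/5 * b)"
    using y z unfolding s a_def[symmetric] b_def[symmetric] g_def[symmetric]
    by (simp add: algebra_simps power2_eq_square)
  then have "g * (2 * g) \<le> g * (3/2 * a + 6/5 * b)" by (simp add: power2_eq_square)
  then have *: "2 * g \<le> 3/2 * a + 6/5 * b" using g by simp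
  have "(2 * g)\<^sup>2 \<le> (3/2 * a + 6/5 * b)\<^sup>2" using * g by (intro power_mono) auto
  also have "\<dots> \<le> (369/100) * (a\<^sup>2 + b\<^sup>2)"
    using zero_le_power2[of "6/5 * a - 3/2 * b"] by (simp add: power2_eq_square field_simps)
  also have "\<dots> \<le> (369/100) * g\<^sup>2" using i by simp
  finally show False using g by (simp add: power_mult_distrib)
qed

end

section \<open>CAT(0) and CAT(-1) spaces satisfy the median inequality\<close>

text \<open>With \<open>a = u + v\<close>, \<open>b = u - v\<close> the sides at the apex and \<open>2 q\<close> the base, the triangle inequalities
  read \<open>\<bar>v\<bar> \<le> q \<le> u\<close>, and \<open>u\<^sup>2 + v\<^sup>2 - q\<^sup>2\<close> is the squared Euclidean median.\<close>

lemma (in geodesic_metric) cn_space_of_CAT_ineq: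
  assumes CAT: "CAT_ineq M dM X d"
    and model: "\<And>u v q. 0 < q \<Longrightarrow> \<bar>v\<bar> \<le> q \<Longrightarrow> q \<le> u \<Longrightarrow> \<exists>x\<in>M. \<exists>y\<in>M. \<exists>z\<in>M. \<exists>m\<in>M.
        dM x y = 2 * q \<and> dM y z = u - v \<and> dM z x = u + v \<and> dM x m = q \<and> dM m y = q
        \<and> dM z z = 0 \<and> (dM m z)\<^sup>2 \<le> u\<^sup>2 + v\<^sup>2 - q\<^sup>2"
  shows "cn_space X d"
proof unfold_locales
  fix x y z c1
  assume X: "x \<in> X" "y \<in> X" "z \<in> X" and c1: "geodesic_seg d X x y c1"
  show "(d z (c1 (d x y / 2)))\<^sup>2 \<le> ((d z x)\<^sup>2 + (d z y)\<^sup>2) / 2 - (d x y)\<^sup>2 / 4"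
  proof (cases "d x y = 0")
    case True
    then have "x = y" "c1 0 = x" using dist_0D X c1 unfolding geodesic_seg_def by auto
    then show ?thesis using X by simp
  next
    case False
    obtain c2 where c2: "geodesic_seg d X y z c2" using ex_geod X by blast
    obtain c3 where c3: "geodesic_seg d X z x c3" using ex_geod X by blast
    define q u v where "q = d x y / 2" and "u = (d z x + d y z) / 2" and "v = (d z x - d y z) / 2"
    have q: "0 < q" using False dist_nonneg[OF X(1,2)] by (simp add: q_def)
    have uv: "\<bar>v\<bar> \<le> q" "q \<le> u"
      using tri[of x y z] tri[of y z x] tri[of z x y] dist_sym[OF X(1,2)] dist_sym[OF X(2,3)]
        dist_sym[OF X(1,3)] X
      by (auto simp: q_def u_def v_def abs_le_iff)
    obtain x' y' z' m' where M: "x' \<in> M" "y' \<in> M" "z' \<in> M" "m' \<in> M"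
      and e: "dM x' y' = d x y" "dM y' z' = d y z" "dM z' x' = d z x"
        "dM x' m' = q" "dM m' y' = q" "dM z' z' = 0"
      and m: "(dM m' z')\<^sup>2 \<le> u\<^sup>2 + v\<^sup>2 - q\<^sup>2"
      using model[OF q uv] by (auto simp: q_def u_def v_def field_simps)
    have "side_pt d M dM x y c1 x' y' (c1 q) m'"
      unfolding side_pt_def using M e q by (intro bexI[of _ q]) (auto simp: q_def)
    \<comment> \<open>The opposite vertex is treated as the far end of the side from y to z; here
      \<open>dM z' z' = 0\<close> enters.\<close>
    moreover have "side_pt d M dM y z c2 y' z' z z'"
      unfolding side_pt_def using M e c2 dist_nonneg[OF X(2,3)]
      by (intro bexI[of _ "d y z"]) (auto simp: geodesic_seg_def)
    ultimately have "d (c1 q) z \<le> dM m' z'"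
      using CAT[unfolded CAT_ineq_def, rule_format, of x y z c1 c2 c3 x' y' z' "c1 q" m' z z']
        X c1 c2 c3 M e by blast
    moreover have cX: "c1 q \<in> X" using c1 q unfolding geodesic_seg_def by (auto simp: q_def)
    ultimately have "(d z (c1 q))\<^sup>2 \<le> (dM m' z')\<^sup>2"
      using dist_nonneg X dist_sym by (intro power_mono) auto
    also note m
    also have "u\<^sup>2 + v\<^sup>2 - q\<^sup>2 = ((d z x)\<^sup>2 + (d z y)\<^sup>2) / 2 - (d x y)\<^sup>2 / 4"
      using dist_sym[OF X(2,3)] by (simp add: u_def v_def q_def power2_eq_square field_simps)
    finally show ?thesis by (simp add: q_def)
  qed
qed

lemma euclidean_model_triangle:
  fixes u v q :: real
  assumes q: "0 < q" "\<bar>v\<bar> \<le> q" "q \<le> u"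
  shows "\<exists>x\<in>UNIV. \<exists>y\<in>UNIV. \<exists>z\<in>UNIV. \<exists>m\<in>UNIV.
        E2_dist x y = 2 * q \<and> E2_dist y z = u - v \<and> E2_dist z x = u + v \<and> E2_dist x m = q
        \<and> E2_dist m y = q \<and> E2_dist z z = 0 \<and> (E2_dist m z)\<^sup>2 \<le> u\<^sup>2 + v\<^sup>2 - q\<^sup>2"
proof -
  have sq: "v\<^sup>2 \<le> q\<^sup>2" "q\<^sup>2 \<le> u\<^sup>2" using q by (auto simp: abs_le_square_iff[symmetric])
  \<comment> \<open>The base runs from -q to q with midpoint 0, and the apex is (a, b). Then 4 a q =
    (u + v)^2 - (u - v)^2 determines a, and the squared height b^2 factors as (u^2 - q^2)(q^2 - v^2)
    / q^2.\<close>
  define a where "a = u * v / q"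
  have a: "a * q = u * v" using q by (simp add: a_def)
  have "0 \<le> (u\<^sup>2 - q\<^sup>2) * (q\<^sup>2 - v\<^sup>2) / q\<^sup>2" using sq by simp
  also have "\<dots> = u\<^sup>2 + v\<^sup>2 - q\<^sup>2 - a\<^sup>2" using q by (simp add: a_def field_simps power2_eq_square)
  finally have pos: "0 \<le> u\<^sup>2 + v\<^sup>2 - q\<^sup>2 - a\<^sup>2" .
  define b where "b = sqrt (u\<^sup>2 + v\<^sup>2 - q\<^sup>2 - a\<^sup>2)"
  have b: "a\<^sup>2 + b\<^sup>2 = u\<^sup>2 + v\<^sup>2 - q\<^sup>2" using pos by (simp add: b_def)
  define z where "z = Complex a b"
  have "(cmod (z - complex_of_real q))\<^sup>2 = (u - v)\<^sup>2"
    unfolding cmod_power2 using a b by (simp add: z_def power2_eq_square algebra_simps)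
  then have 1: "cmod (z - complex_of_real q) = u - v"
    using q by (subst (asm) power2_eq_iff_nonneg) auto
  have "(cmod (z + complex_of_real q))\<^sup>2 = (u + v)\<^sup>2"
    unfolding cmod_power2 using a b by (simp add: z_def power2_eq_square algebra_simps)
  then have 2: "cmod (z + complex_of_real q) = u + v"
    using q by (subst (asm) power2_eq_iff_nonneg) auto
  have 3: "cmod (- complex_of_real q - complex_of_real q) = 2 * q"
    using q by (simp flip: of_real_minus of_real_diff of_real_add)
  have 4: "(cmod z)\<^sup>2 = u\<^sup>2 + v\<^sup>2 - q\<^sup>2" using b unfolding cmod_power2 by (simp add: z_def)
  show ?thesis
    unfolding E2_dist_def
    by (intro bexI[of _ "- complex_of_real q"] bexI[of _ "complex_of_real q"] bexI[of _ z] bexI[of _ 0])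
       (use q 1 2 3 4 in \<open>auto simp: norm_minus_commute\<close>)
qed

text \<open>The hyperbolic median \<open>m\<close> satisfies \<open>cosh m * cosh q = cosh u * cosh v\<close>; comparing it with the
  Euclidean one amounts to convexity of \<open>x \<mapsto> cosh (sqrt x)\<close>, proved termwise on the power series.\<close>

lemma power_sum_spread:
  fixes a b c e :: real
  assumes "0 \<le> c" "c \<le> b" "b \<le> a" "a \<le> e" "a + b = e + c"
  shows "a ^ k + b ^ k \<le> e ^ k + c ^ k"
proof -
  \<comment> \<open>The two gaps b - c and e - a are equal, so it suffices to compare the difference
    quotients, which is done term by term.\<close>
  have "b ^ k - c ^ k = (b - c) * (\<Sum>i<k. c ^ (k - Suc i) * b ^ i)" by (rule power_diff_sumr2)
  also have "\<dots> \<le> (b - c) * (\<Sum>i<k. a ^ (k - Suc i) * e ^ i)"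
    using assms by (intro mult_left_mono sum_mono mult_mono power_mono) auto
  also have "\<dots> = (e - a) * (\<Sum>i<k. a ^ (k - Suc i) * e ^ i)" using assms by simp
  also have "\<dots> = e ^ k - a ^ k" by (rule power_diff_sumr2[symmetric])
  finally show ?thesis by simp
qed

lemma cosh_sum_spread:
  fixes a b c e :: real
  assumes "c\<^sup>2 \<le> b\<^sup>2" "b\<^sup>2 \<le> a\<^sup>2" "a\<^sup>2 \<le> e\<^sup>2" "a\<^sup>2 + b\<^sup>2 = e\<^sup>2 + c\<^sup>2"
  shows "cosh a + cosh b \<le> cosh e + cosh c"
proof (rule sums_le)
  let ?t = "\<lambda>x n. if even n then x ^ n /\<^sub>R fact n else (0::real)"
  show "(\<lambda>n. ?t a n + ?t b n) sums (cosh a + cosh b)" "(\<lambda>n. ?t e n + ?t c n) sums (cosh e + cosh c)"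
    by (intro sums_add cosh_converges)+
  fix n show "?t a n + ?t b n \<le> ?t e n + ?t c n"
  proof (cases "even n")
    case True
    then obtain k where k: "n = 2 * k" by blast
    have "(a\<^sup>2) ^ k + (b\<^sup>2) ^ k \<le> (e\<^sup>2) ^ k + (c\<^sup>2) ^ k" using assms by (intro power_sum_spread) auto
    then have "inverse (fact n) * (a ^ n + b ^ n) \<le> inverse (fact n) * (e ^ n + c ^ n)"
      by (intro mult_left_mono) (auto simp: k power_mult)
    then show ?thesis using True by (simp add: algebra_simps)
  qed simp
qed

text \<open>The products become sums: 2 cosh u cosh v = cosh (u + v) + cosh (u - v). With w the
  Euclidean median, u^2 + v^2 = w^2 + q^2, so the squares of u + v, u - v and of w + q, w - q have
  equal sums, and the second pair is more spread out because u \<bar>v\<bar> \<le> w q. Passing to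
  \<bar>v\<bar> fixes the order of the squares.\<close>

lemma cosh_mult_spread:
  fixes u v q :: real
  assumes q: "0 < q" "\<bar>v\<bar> \<le> q" "q \<le> u"
  shows "cosh u * cosh v \<le> cosh (sqrt (u\<^sup>2 + v\<^sup>2 - q\<^sup>2)) * cosh q"
proof -
  have sq: "v\<^sup>2 \<le> q\<^sup>2" "q\<^sup>2 \<le> u\<^sup>2" using q by (auto simp: abs_le_square_iff[symmetric])
  define w where "w = sqrt (u\<^sup>2 + v\<^sup>2 - q\<^sup>2)"
  have "0 \<le> u\<^sup>2 + v\<^sup>2 - q\<^sup>2" using sq(2) zero_le_power2[of v] by linarith
  then have w: "w\<^sup>2 = u\<^sup>2 + v\<^sup>2 - q\<^sup>2" "0 \<le> w" by (auto simp: w_def)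
  have "v\<^sup>2 \<le> w\<^sup>2" using w sq by simp
  define v' where "v' = \<bar>v\<bar>"
  have v': "0 \<le> v'" "v'\<^sup>2 = v\<^sup>2" "cosh v' = cosh v" by (auto simp: v'_def abs_if)
  have "(u * v')\<^sup>2 \<le> (w * q)\<^sup>2"
  proof -
    have "0 \<le> (u\<^sup>2 - q\<^sup>2) * (q\<^sup>2 - v\<^sup>2)" using sq by simp
    then show ?thesis unfolding power_mult_distrib v' w by (simp add: algebra_simps)
  qed
  then have uvw: "u * v' \<le> w * q" using w q by (meson mult_nonneg_nonneg order_less_imp_le power2_le_imp_le)
  have "cosh (u + v') + cosh (u - v') \<le> cosh (w + q) + cosh (w - q)"
  proof (rule cosh_sum_spread)
    have "0 \<le> u * v'" using q v' by simp
    show "(w - q)\<^sup>2 \<le> (u - v')\<^sup>2" "(u + v')\<^sup>2 \<le> (w + q)\<^sup>2"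
      using uvw w v' by (simp_all add: power2_sum power2_diff)
    show "(u - v')\<^sup>2 \<le> (u + v')\<^sup>2" using \<open>0 \<le> u * v'\<close> by (simp add: power2_sum power2_diff)
    show "(u + v')\<^sup>2 + (u - v')\<^sup>2 = (w + q)\<^sup>2 + (w - q)\<^sup>2" using w v' by (simp add: power2_sum power2_diff)
  qed
  then show ?thesis unfolding cosh_add cosh_diff by (simp add: v' w_def[symmetric] mult.commute)
qed

text \<open>The point of the Poincare disc with hyperboloid coordinates \<open>(sqrt (1 + a\<^sup>2 + b\<^sup>2), a, b)\<close>.\<close>

definition disc_pt :: "real \<Rightarrow> real \<Rightarrow> complex" where
  "disc_pt a b = Complex (a / (1 + sqrt (1 + a\<^sup>2 + b\<^sup>2))) (b / (1 + sqrt (1 + a\<^sup>2 + b\<^sup>2)))"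

lemma cmod_disc_pt:
  assumes "h\<^sup>2 = 1 + a\<^sup>2 + b\<^sup>2" "0 \<le> h"
  shows "1 - (cmod (disc_pt a b))\<^sup>2 = 2 / (1 + h)"
proof -
  have h: "sqrt (1 + a\<^sup>2 + b\<^sup>2) = h" using assms real_sqrt_unique by metis
  have "(cmod (disc_pt a b))\<^sup>2 = (a\<^sup>2 + b\<^sup>2) / (1 + h)\<^sup>2"
    unfolding cmod_power2 disc_pt_def h by (simp add: power_divide add_divide_distrib)
  also have "a\<^sup>2 + b\<^sup>2 = (h - 1) * (1 + h)" using assms by (simp add: algebra_simps power2_eq_square)
  also have "(h - 1) * (1 + h) / (1 + h)\<^sup>2 = (h - 1) / (1 + h)" using assms by (simp add: power2_eq_square)
  finally show ?thesis using assms by (simp add: field_simps)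
qed

lemma disc_pt_in: "disc_pt a b \<in> H2"
proof -
  let ?h = "sqrt (1 + a\<^sup>2 + b\<^sup>2)"
  have "1 - (cmod (disc_pt a b))\<^sup>2 = 2 / (1 + ?h)" by (rule cmod_disc_pt) auto
  moreover have "0 < 1 + ?h" by (simp add: add_pos_nonneg)
  then have "0 < 2 / (1 + ?h)" by simp
  ultimately have "(cmod (disc_pt a b))\<^sup>2 < 1\<^sup>2" by (simp only: power_one)
  then show ?thesis unfolding H2_def using power_less_imp_less_base by fastforce
qed

text \<open>In hyperboloid coordinates the disc distance is arcosh of minus the Lorentz form, so the
  sides of the model triangle can be read off from the addition formulas for cosh.\<close>

lemma H2_dist_disc_pt:
  assumes h: "h\<^sup>2 = 1 + a\<^sup>2 + b\<^sup>2" "0 \<le> h" and k: "k\<^sup>2 = 1 + c\<^sup>2 + e\<^sup>2" "0 \<le> k"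
  shows "H2_dist (disc_pt a b) (disc_pt c e) = arcosh (h * k - a * c - b * e)"
proof -
  define P Q where "P = 1 + h" and "Q = 1 + k"
  have PQ: "P \<noteq> 0" "Q \<noteq> 0" using h k by (auto simp: P_def Q_def)
  have s: "sqrt (1 + a\<^sup>2 + b\<^sup>2) = h" "sqrt (1 + c\<^sup>2 + e\<^sup>2) = k" using assms real_sqrt_unique by metis+
  have "(cmod (disc_pt a b - disc_pt c e))\<^sup>2 = (a / P - c / Q)\<^sup>2 + (b / P - e / Q)\<^sup>2"
    unfolding cmod_power2 disc_pt_def s by (simp add: P_def Q_def)
  also have "\<dots> = (a\<^sup>2 + b\<^sup>2) / P\<^sup>2 + (c\<^sup>2 + e\<^sup>2) / Q\<^sup>2 - 2 * (a * c + b * e) / (P * Q)"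
    using PQ by (simp add: power2_diff power_divide add_divide_distrib algebra_simps)
  also have "a\<^sup>2 + b\<^sup>2 = (P - 2) * P" using h by (simp add: P_def algebra_simps power2_eq_square)
  also have "c\<^sup>2 + e\<^sup>2 = (Q - 2) * Q" using k by (simp add: Q_def algebra_simps power2_eq_square)
  also have "(P - 2) * P / P\<^sup>2 + (Q - 2) * Q / Q\<^sup>2 - 2 * (a * c + b * e) / (P * Q)
      = ((P - 2) * Q + (Q - 2) * P - 2 * (a * c + b * e)) / (P * Q)"
    using PQ by (simp add: field_simps power2_eq_square)
  finally have "1 + 2 * (cmod (disc_pt a b - disc_pt c e))\<^sup>2 / (2 / P * (2 / Q))
      = 1 + ((P - 2) * Q + (Q - 2) * P - 2 * (a * c + b * e)) / 2"
    using PQ by simp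
  also have "\<dots> = h * k - a * c - b * e" by (simp add: P_def Q_def field_simps)
  finally show ?thesis unfolding H2_dist_def cmod_disc_pt[OF h] cmod_disc_pt[OF k] P_def Q_def by simp
qed

lemma hyperbolic_model_triangle:
  fixes u v q :: real
  assumes q: "0 < q" "\<bar>v\<bar> \<le> q" "q \<le> u"
  shows "\<exists>x\<in>H2. \<exists>y\<in>H2. \<exists>z\<in>H2. \<exists>m\<in>H2.
        H2_dist x y = 2 * q \<and> H2_dist y z = u - v \<and> H2_dist z x = u + v \<and> H2_dist x m = q
        \<and> H2_dist m y = q \<and> H2_dist z z = 0 \<and> (H2_dist m z)\<^sup>2 \<le> u\<^sup>2 + v\<^sup>2 - q\<^sup>2"
proof -
  define C S where "C = cosh q" and "S = sinh q"
  have C: "1 \<le> C" "0 < S" and CS: "C\<^sup>2 = 1 + S\<^sup>2 + 0\<^sup>2" "C\<^sup>2 = 1 + (-S)\<^sup>2 + 0\<^sup>2"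
    using q by (auto simp: C_def S_def cosh_real_ge_1 cosh_square_eq)
  have Cp: "C > 0" using C by linarith
  define U V where "U = cosh u" and "V = cosh v"
  have UV: "V\<^sup>2 \<le> C\<^sup>2" "C\<^sup>2 \<le> U\<^sup>2" "0 < U" "0 < V"
  proof -
    have "cosh \<bar>v\<bar> \<le> cosh q" using q by (subst cosh_real_nonneg_le_iff) auto
    then have "V \<le> C" by (auto simp: V_def C_def abs_if split: if_splits)
    moreover have "C \<le> U" unfolding U_def C_def using q by (subst cosh_real_nonneg_le_iff) auto
    moreover show "0 < U" "0 < V" by (auto simp: U_def V_def)
    ultimately show "V\<^sup>2 \<le> C\<^sup>2" "C\<^sup>2 \<le> U\<^sup>2" using C by (auto intro: power_mono)
  qed
  \<comment> \<open>The base ends have hyperboloid coordinates (C, -S, 0) and (C, S, 0), its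
    midpoint (1, 0, 0), and the apex is (h, a, b). The sides demand h C + a S = cosh (u + v) and h C
    - a S = cosh (u - v), which gives h and a; h is the cosh of the median.\<close>
  define h where "h = U * V / C"
  define a where "a = sinh u * sinh v / S"
  have hp: "0 \<le> h" using UV C by (simp add: h_def)
  have hC: "h * C = U * V" and aS: "a * S = sinh u * sinh v" using C by (auto simp: h_def a_def)
  have s2: "(sinh u)\<^sup>2 = U\<^sup>2 - 1" "(sinh v)\<^sup>2 = V\<^sup>2 - 1" "S\<^sup>2 = C\<^sup>2 - 1"
    by (auto simp: U_def V_def S_def C_def cosh_square_eq)
  \<comment> \<open>The Euclidean factorization of the squared height, with q, u, v replaced by
    their hyperbolic cosines.\<close>
  have pos: "0 \<le> h\<^sup>2 - 1 - a\<^sup>2"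
  proof -
    have "0 \<le> (U\<^sup>2 - C\<^sup>2) * (C\<^sup>2 - V\<^sup>2)" using UV by simp
    also have "\<dots> = U\<^sup>2 * V\<^sup>2 * S\<^sup>2 - C\<^sup>2 * S\<^sup>2 - C\<^sup>2 * ((U\<^sup>2 - 1) * (V\<^sup>2 - 1))"
      unfolding s2 by (simp add: algebra_simps)
    also have "\<dots> = C\<^sup>2 * S\<^sup>2 * (h\<^sup>2 - 1 - a\<^sup>2)"
      unfolding h_def a_def power_divide power_mult_distrib s2(1,2) using Cp C(2)
      by (simp add: field_simps)
    finally have "0 \<le> C\<^sup>2 * S\<^sup>2 * (h\<^sup>2 - 1 - a\<^sup>2)" .
    moreover have "0 < C\<^sup>2 * S\<^sup>2" using Cp C(2) by simp
    ultimately show ?thesis by (metis zero_le_mult_iff not_le)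
  qed
  define b where "b = sqrt (h\<^sup>2 - 1 - a\<^sup>2)"
  have h: "h\<^sup>2 = 1 + a\<^sup>2 + b\<^sup>2" using pos by (simp add: b_def)
  have one: "1\<^sup>2 = 1 + (0::real)\<^sup>2 + 0\<^sup>2" by simp
  let ?x = "disc_pt (-S) 0" and ?y = "disc_pt S 0" and ?z = "disc_pt a b" and ?m = "disc_pt 0 0"
  have "C * C - (-S) * S - 0 * 0 = cosh (q + q)" unfolding cosh_add by (simp add: C_def S_def)
  then have 1: "H2_dist ?x ?y = 2 * q"
    using H2_dist_disc_pt[OF CS(2) _ CS(1)] Cp q by (simp add: arcosh_cosh_real)
  have "C * h - S * a - 0 * b = cosh (u - v)"
    unfolding cosh_diff using hC aS by (simp add: U_def V_def mult.commute)
  then have 2: "H2_dist ?y ?z = u - v"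
    using H2_dist_disc_pt[OF CS(1) _ h] Cp hp q by (simp add: arcosh_cosh_real)
  have "h * C - a * (-S) - b * 0 = cosh (u + v)"
    unfolding cosh_add using hC aS by (simp add: U_def V_def)
  then have 3: "H2_dist ?z ?x = u + v"
    using H2_dist_disc_pt[OF h _ CS(2)] Cp hp q by (simp add: arcosh_cosh_real)
  have 4: "H2_dist ?x ?m = q" "H2_dist ?m ?y = q"
    using H2_dist_disc_pt[OF CS(2) _ one] H2_dist_disc_pt[OF one _ CS(1)] Cp q
    by (auto simp: C_def arcosh_cosh_real)
  have h1: "1 \<le> h" using h hp by (smt (verit) one_power2 power_mono zero_le_power2 power2_le_imp_le)
  have "h * C \<le> cosh (sqrt (u\<^sup>2 + v\<^sup>2 - q\<^sup>2)) * C"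
    using cosh_mult_spread[OF q] hC by (simp add: U_def V_def C_def)
  then have "cosh (arcosh h) \<le> cosh (sqrt (u\<^sup>2 + v\<^sup>2 - q\<^sup>2))" using Cp h1 by simp
  moreover have nn: "0 \<le> u\<^sup>2 + v\<^sup>2 - q\<^sup>2" using q by (simp add: power_mono add_increasing2)
  ultimately have "arcosh h \<le> sqrt (u\<^sup>2 + v\<^sup>2 - q\<^sup>2)"
    using h1 by (subst (asm) cosh_real_nonneg_le_iff) auto
  then have "(arcosh h)\<^sup>2 \<le> (sqrt (u\<^sup>2 + v\<^sup>2 - q\<^sup>2))\<^sup>2" using h1 by (intro power_mono) auto
  then have 5: "(H2_dist ?m ?z)\<^sup>2 \<le> u\<^sup>2 + v\<^sup>2 - q\<^sup>2"
    using H2_dist_disc_pt[OF one _ h] hp nn by simp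
  have 6: "H2_dist ?z ?z = 0" by (simp add: H2_dist_def)
  show ?thesis using 1 2 3 4 5 6 disc_pt_in by blast
qed

lemma (in geodesic_metric) cn_space_of_CAT0: "CAT0 X d \<Longrightarrow> cn_space X d"
  unfolding CAT0_def using cn_space_of_CAT_ineq[OF _ euclidean_model_triangle] by blast

lemma (in geodesic_metric) cn_space_of_CAT_minus1: "CAT_minus1 X d \<Longrightarrow> cn_space X d"
  unfolding CAT_minus1_def using cn_space_of_CAT_ineq[OF _ hyperbolic_model_triangle] by blast

section \<open>Euclidean and hyperbolic simplices\<close>

lemma mink_sym: "mink m a b = mink m b a"
  by (simp add: mink_def mult.commute)

lemma mink_lincomb:
  "mink m (\<lambda>i. s * a i + t * b i) c = s * mink m a c + t * mink m b c"
  by (simp add: mink_def algebra_simps sum.distrib sum_distrib_left)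

lemma mink_lincomb_self:
  "mink m (\<lambda>i. s * a i + t * b i) (\<lambda>i. s * a i + t * b i)
    = s\<^sup>2 * mink m a a + 2 * s * t * mink m a b + t\<^sup>2 * mink m b b"
  unfolding mink_lincomb mink_sym[of m _ "\<lambda>i. s * a i + t * b i"]
  by (simp add: mink_sym[of m b a] algebra_simps power2_eq_square)

lemma mink_comb:
  "mink m (comb \<sigma> p x) b = (\<Sum>v\<in>\<sigma>. x v * mink m (p v) b)"
proof -
  have "(\<Sum>i\<in>{1..m}. (\<Sum>v\<in>\<sigma>. x v * p v i) * b i) = (\<Sum>v\<in>\<sigma>. x v * (\<Sum>i\<in>{1..m}. p v i * b i))"
    unfolding sum_distrib_left sum_distrib_right by (subst sum.swap) (simp add: mult.assoc)
  moreover have "- ((\<Sum>v\<in>\<sigma>. x v * p v 0) * b 0) = (\<Sum>v\<in>\<sigma>. x v * (- (p v 0 * b 0)))"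
    by (simp add: sum_distrib_right sum_negf mult.assoc)
  ultimately show ?thesis
    unfolding mink_def comb_def by (simp add: distrib_left right_diff_distrib sum.distrib sum_negf sum_subtractf)
qed

lemma hyp_coord_sq: "a \<in> hyp m \<Longrightarrow> (\<Sum>i\<in>{1..m}. (a i)\<^sup>2) = (a 0)\<^sup>2 - 1"
  by (auto simp: hyp_def mink_def power2_eq_square)

lemma hyp_coord_ge_1: "a \<in> hyp m \<Longrightarrow> 1 \<le> a 0"
proof -
  assume a: "a \<in> hyp m"
  have "0 \<le> (\<Sum>i\<in>{1..m}. (a i)\<^sup>2)" by (intro sum_nonneg) auto
  then have "1\<^sup>2 \<le> (a 0)\<^sup>2" using hyp_coord_sq[OF a] by simp
  then show ?thesis using a unfolding hyp_def by (auto intro: power2_le_imp_le)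
qed

text \<open>Cauchy-Schwarz for the space coordinates, with (r^2 - 1)(s^2 - 1) rewritten as (r s -
  1)^2 - (r - s)^2 for the time coordinates r, s. The first square yields the reversed
  Cauchy-Schwarz inequality, the second its equality case.\<close>

lemma hyp_space_part_sq:
  assumes "a \<in> hyp m" "b \<in> hyp m"
  shows "(\<Sum>i\<in>{1..m}. a i * b i)\<^sup>2 \<le> (a 0 * b 0 - 1)\<^sup>2 - (a 0 - b 0)\<^sup>2"
proof -
  have "(\<Sum>i\<in>{1..m}. a i * b i)\<^sup>2 \<le> (\<Sum>i\<in>{1..m}. (a i)\<^sup>2) * (\<Sum>i\<in>{1..m}. (b i)\<^sup>2)"
    by (rule Cauchy_Schwarz_ineq_sum)
  then show ?thesis
    unfolding hyp_coord_sq[OF assms(1)] hyp_coord_sq[OF assms(2)]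
    by (simp add: power2_eq_square algebra_simps)
qed

lemma mink_hyp_le: "a \<in> hyp m \<Longrightarrow> b \<in> hyp m \<Longrightarrow> 1 \<le> - mink m a b"
proof -
  assume ab: "a \<in> hyp m" "b \<in> hyp m"
  have "1 * 1 \<le> a 0 * b 0"
    using hyp_coord_ge_1[OF ab(1)] hyp_coord_ge_1[OF ab(2)] by (intro mult_mono) auto
  then have "0 \<le> a 0 * b 0 - 1" by simp
  moreover have "(\<Sum>i\<in>{1..m}. a i * b i)\<^sup>2 \<le> (a 0 * b 0 - 1)\<^sup>2"
    using hyp_space_part_sq[OF ab] zero_le_power2[of "a 0 - b 0"] by linarith
  ultimately have "(\<Sum>i\<in>{1..m}. a i * b i) \<le> a 0 * b 0 - 1" by (rule power2_le_imp_le[rotated])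
  then show ?thesis by (simp add: mink_def)
qed

lemma mink_hyp_eq_imp:
  assumes ab: "a \<in> hyp m" "b \<in> hyp m" and "mink m a b = -1" and "i \<le> m"
  shows "a i = b i"
proof -
  have s: "(\<Sum>i\<in>{1..m}. a i * b i) = a 0 * b 0 - 1" using assms by (simp add: mink_def)
  have "(a 0 - b 0)\<^sup>2 \<le> 0" using hyp_space_part_sq[OF ab] unfolding s by simp
  then have z: "a 0 = b 0" by simp
  have "(\<Sum>i\<in>{1..m}. (a i - b i)\<^sup>2)
      = (\<Sum>i\<in>{1..m}. (a i)\<^sup>2) + (\<Sum>i\<in>{1..m}. (b i)\<^sup>2) - 2 * (\<Sum>i\<in>{1..m}. a i * b i)"
    unfolding power2_diff by (simp add: sum.distrib sum_subtractf sum_distrib_left mult.assoc)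
  also have "\<dots> = 0"
    unfolding hyp_coord_sq[OF ab(1)] hyp_coord_sq[OF ab(2)] s z by (simp add: power2_eq_square)
  finally have "\<forall>i\<in>{1..m}. (a i - b i)\<^sup>2 = 0" by (subst (asm) sum_nonneg_eq_0_iff) auto
  then show ?thesis using z \<open>i \<le> m\<close> by (cases "i = 0") auto
qed

text \<open>The orthogonal complement of a timelike vector is positive semidefinite: orthogonality
  expresses the time part of \<open>v\<close> by its space part, and Cauchy-Schwarz bounds
  it.\<close>

lemma mink_orth_nonneg:
  assumes b: "b \<in> hyp m" and v: "mink m v b = 0"
  shows "0 \<le> mink m v v"
proof -
  have "(v 0 * b 0)\<^sup>2 = (\<Sum>i\<in>{1..m}. v i * b i)\<^sup>2" using v by (simp add: mink_def)
  also have "\<dots> \<le> (\<Sum>i\<in>{1..m}. (v i)\<^sup>2) * (\<Sum>i\<in>{1..m}. (b i)\<^sup>2)"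
    by (rule Cauchy_Schwarz_ineq_sum)
  also have "\<dots> = (\<Sum>i\<in>{1..m}. (v i)\<^sup>2) * ((b 0)\<^sup>2 - 1)" unfolding hyp_coord_sq[OF b] ..
  also have "\<dots> \<le> (\<Sum>i\<in>{1..m}. (v i)\<^sup>2) * (b 0)\<^sup>2"
    by (intro mult_left_mono sum_nonneg) auto
  finally have "(v 0)\<^sup>2 * (b 0)\<^sup>2 \<le> (\<Sum>i\<in>{1..m}. (v i)\<^sup>2) * (b 0)\<^sup>2" by (simp add: power_mult_distrib)
  then have "(v 0)\<^sup>2 \<le> (\<Sum>i\<in>{1..m}. (v i)\<^sup>2)" using hyp_coord_ge_1[OF b] by (simp add: mult_le_cancel_right)
  then show ?thesis by (simp add: mink_def power2_eq_square)
qed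

text \<open>The form may be degenerate, so P R - Q^2 is tested after multiplication by R and by P.
  If both vanish, the vector (1, -Q) gives 0 \<le> -2 Q^2.\<close>

lemma quadratic_form_Cauchy_Schwarz:
  fixes P Q R :: real
  assumes psd: "\<And>s t. 0 \<le> s\<^sup>2 * P + 2 * s * t * Q + t\<^sup>2 * R"
  shows "Q\<^sup>2 \<le> P * R"
proof -
  have PR: "0 \<le> P" "0 \<le> R" using psd[of 1 0] psd[of 0 1] by auto
  have 1: "0 \<le> R * (P * R - Q\<^sup>2)" using psd[of R "-Q"] by (simp add: algebra_simps power2_eq_square)
  have 2: "0 \<le> P * (P * R - Q\<^sup>2)" using psd[of "-Q" P] by (simp add: algebra_simps power2_eq_square)
  show ?thesis
  proof (cases "R = 0 \<and> P = 0")
    case True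
    then show ?thesis using psd[of 1 "-Q"] by (simp add: power2_eq_square)
  next
    case False
    then show ?thesis using 1 2 PR by (auto simp: zero_le_mult_iff)
  qed
qed

text \<open>The components \<open>v\<close> and \<open>w\<close> of a and c orthogonal to b have
  squared lengths sinh^2 of the distances to b. Cauchy-Schwarz in the orthogonal complement of b
  then bounds the cosh of the distance from a to c by the addition formula for cosh.\<close>

lemma hdist_triangle:
  assumes abc: "a \<in> hyp m" "b \<in> hyp m" "c \<in> hyp m"
  shows "hdist m a c \<le> hdist m a b + hdist m b c"
proof -
  define A B where "A = - mink m a b" and "B = - mink m b c"
  have AB: "1 \<le> A" "1 \<le> B" using mink_hyp_le abc by (auto simp: A_def B_def)
  define v w where "v = (\<lambda>i. 1 * a i + (-A) * b i)" and "w = (\<lambda>i. 1 * c i + (-B) * b i)"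
  have self: "mink m a a = -1" "mink m b b = -1" "mink m c c = -1" using abc by (auto simp: hyp_def)
  have vb: "mink m v b = 0" "mink m w b = 0"
    unfolding v_def w_def mink_lincomb self by (auto simp: A_def B_def mink_sym[of m c b])
  have vv: "mink m v v = A\<^sup>2 - 1"
    unfolding v_def mink_lincomb_self self by (simp add: A_def power2_eq_square)
  have ww: "mink m w w = B\<^sup>2 - 1"
    unfolding w_def mink_lincomb_self self by (simp add: B_def mink_sym[of m c b] power2_eq_square)
  have vw: "mink m v w = mink m a c + A * B"
  proof -
    have "mink m v w = mink m a w - A * mink m b w" unfolding v_def mink_lincomb by simp
    also have "mink m b w = 0" using vb mink_sym by metis
    also have "mink m a w = mink m a c + A * B"
      unfolding w_def mink_sym[of m a "\<lambda>i. 1 * c i + (-B) * b i"] mink_lincomb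
      by (simp add: A_def mink_sym[of m c a] mink_sym[of m b a])
    finally show ?thesis by simp
  qed
  have "(mink m v w)\<^sup>2 \<le> mink m v v * mink m w w"
  proof (rule quadratic_form_Cauchy_Schwarz)
    fix s t
    have "mink m (\<lambda>i. s * v i + t * w i) b = 0" unfolding mink_lincomb vb by simp
    from mink_orth_nonneg[OF abc(2) this]
    show "0 \<le> s\<^sup>2 * mink m v v + 2 * s * t * mink m v w + t\<^sup>2 * mink m w w"
      unfolding mink_lincomb_self .
  qed
  then have "\<bar>mink m v w\<bar> \<le> sqrt ((A\<^sup>2 - 1) * (B\<^sup>2 - 1))" unfolding vv ww by (rule real_le_rsqrt[of "\<bar>_\<bar>", simplified])
  then have "- mink m a c \<le> A * B + sqrt (A\<^sup>2 - 1) * sqrt (B\<^sup>2 - 1)"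
    unfolding vw real_sqrt_mult by linarith
  also have "\<dots> = cosh (arcosh A + arcosh B)"
    unfolding cosh_add using AB by (simp add: sinh_arcosh_real)
  finally have "cosh (arcosh (- mink m a c)) \<le> cosh (arcosh A + arcosh B)"
    using mink_hyp_le[OF abc(1,3)] by simp
  then show ?thesis
    using mink_hyp_le[OF abc(1,3)] AB unfolding hdist_def A_def[symmetric] B_def[symmetric]
    by (subst (asm) cosh_real_nonneg_le_iff) auto
qed

lemma eucl_triangle: "eucl m a c \<le> eucl m a b + eucl m b c"
proof -
  have "eucl m x y = L2_set (\<lambda>i. x i - y i) {..<m}" for x y by (simp add: eucl_def L2_set_def)
  then show ?thesis using L2_set_triangle_ineq[of "\<lambda>i. a i - b i" "\<lambda>i. b i - c i" "{..<m}"] by simp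
qed

section \<open>Distance gaps between a point of a simplex and the opposite faces\<close>

lemma continuous_on_coordinate [continuous_intros]: "continuous_on S (\<lambda>x :: pt. x v)"
  using continuous_on_product_coordinates by (rule continuous_on_subset) simp

text \<open>A closed subset of a product of intervals and singletons {0}; Tychonoff disposes of the
  infinitely many coordinates outside \<sigma>.\<close>

lemma compact_simplex_face:
  assumes "finite \<sigma>"
  shows "compact {x \<in> simplex_pts \<sigma>. x w = 0}"
proof -
  define K where "K v = (if v \<in> \<sigma> then {0..1} else {0 :: real})" for v :: vtx
  have "compactin (product_topology (\<lambda>_. euclidean) UNIV) (PiE UNIV K)"
    by (subst compactin_PiE) (auto simp: K_def)
  then have K: "compact (PiE UNIV K)" by (simp add: euclidean_product_topology)
  have "closed {x :: pt. sum x \<sigma> = 1}" "closed {x :: pt. x w = 0}"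
    by (intro closed_Collect_eq continuous_intros)+
  then have "compact (PiE UNIV K \<inter> ({x. sum x \<sigma> = 1} \<inter> {x. x w = 0}))"
    using K by (intro compact_Int_closed closed_Int)
  also have "PiE UNIV K \<inter> ({x. sum x \<sigma> = 1} \<inter> {x. x w = 0}) = {x \<in> simplex_pts \<sigma>. x w = 0}"
  proof -
    have "x v \<le> 1" if "x \<in> simplex_pts \<sigma>" "v \<in> \<sigma>" for x v
      using that assms member_le_sum[of v \<sigma> x] by (auto simp: simplex_pts_def)
    then have "{x \<in> simplex_pts \<sigma>. x w = 0} \<subseteq> PiE UNIV K"
      by (auto simp: K_def simplex_pts_def)
    moreover have "0 \<le> x v \<and> (v \<notin> \<sigma> \<longrightarrow> x v = 0)" if "x \<in> PiE UNIV K" for x v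
      using PiE_mem[OF that, of v] by (auto simp: K_def split: if_splits)
    ultimately show ?thesis unfolding simplex_pts_def by blast
  qed
  finally show ?thesis .
qed

lemma gap_of_continuous:
  assumes "finite \<sigma>" and cont: "continuous_on (simplex_pts \<sigma>) g"
    and nonneg: "\<And>x. x \<in> simplex_pts \<sigma> \<Longrightarrow> (0::real) \<le> g x"
    and zero: "\<And>x. x \<in> simplex_pts \<sigma> \<Longrightarrow> g x = 0 \<Longrightarrow> x w \<noteq> 0"
  shows "\<exists>e>0. \<forall>x\<in>simplex_pts \<sigma>. x w = 0 \<longrightarrow> e \<le> g x"
proof (cases "{x \<in> simplex_pts \<sigma>. x w = 0} = {}")
  case True
  then show ?thesis by (intro exI[of _ 1]) auto
next
  case False
  have "continuous_on {x \<in> simplex_pts \<sigma>. x w = 0} g"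
    using cont by (rule continuous_on_subset) auto
  then obtain m where m: "m \<in> simplex_pts \<sigma>" "m w = 0" "\<And>x. x \<in> simplex_pts \<sigma> \<Longrightarrow> x w = 0 \<Longrightarrow> g m \<le> g x"
    using continuous_attains_inf[OF compact_simplex_face[OF \<open>finite \<sigma>\<close>, of w] False, of g]
    by blast
  then have "0 < g m" using nonneg zero by (metis order_le_less)
  then show ?thesis using m by blast
qed

lemma continuous_on_comb [continuous_intros]: "continuous_on S (\<lambda>x. comb \<sigma> p x i)"
  unfolding comb_def by (intro continuous_intros)

text \<open>What is retained of the Euclidean or hyperbolic shape of simplices, so that both cases
  can be treated together. The last clause, a positive distance from \<open>z\<close> to every face
  that misses a vertex of its support, is what nondegeneracy of the simplices provides.\<close>

definition simplexwise_metric :: "nat \<Rightarrow> simplex_metrics \<Rightarrow> bool" where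
  "simplexwise_metric n ds \<longleftrightarrow> face_compatible n ds \<and> (\<forall>\<sigma>\<in>simplices n.
      (\<forall>x\<in>simplex_pts \<sigma>. ds \<sigma> x x = 0)
    \<and> (\<forall>x\<in>simplex_pts \<sigma>. \<forall>y\<in>simplex_pts \<sigma>. 0 \<le> ds \<sigma> x y)
    \<and> (\<forall>x\<in>simplex_pts \<sigma>. \<forall>y\<in>simplex_pts \<sigma>. \<forall>z\<in>simplex_pts \<sigma>. ds \<sigma> x z \<le> ds \<sigma> x y + ds \<sigma> y z)
    \<and> (\<forall>z\<in>simplex_pts \<sigma>. \<forall>w. z w \<noteq> 0 \<longrightarrow> (\<exists>e>0. \<forall>x\<in>simplex_pts \<sigma>. x w = 0 \<longrightarrow> e \<le> ds \<sigma> z x)))"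

lemma simplexwise_metric_of_pe:
  assumes "pe_metric n ds"
  shows "simplexwise_metric n ds"
  unfolding simplexwise_metric_def
proof (intro conjI ballI)
  show "face_compatible n ds" using assms by (simp add: pe_metric_def)
  fix \<sigma> assume \<sigma>: "\<sigma> \<in> simplices n"
  then have fin: "finite \<sigma>" by (simp add: simplices_def)
  obtain m p where ai: "aff_indep m \<sigma> p" and
    ds: "\<And>x y. x\<in>simplex_pts \<sigma> \<Longrightarrow> y\<in>simplex_pts \<sigma> \<Longrightarrow> ds \<sigma> x y = eucl m (comb \<sigma> p x) (comb \<sigma> p y)"
    using assms \<sigma> unfolding pe_metric_def by meson
  show "ds \<sigma> x x = 0" if "x \<in> simplex_pts \<sigma>" for x using ds that by (simp add: eucl_def)
  show "0 \<le> ds \<sigma> x y" if "x \<in> simplex_pts \<sigma>" "y \<in> simplex_pts \<sigma>" for x y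
    using ds that by (simp add: eucl_def sum_nonneg)
  show "ds \<sigma> x z \<le> ds \<sigma> x y + ds \<sigma> y z"
    if "x \<in> simplex_pts \<sigma>" "y \<in> simplex_pts \<sigma>" "z \<in> simplex_pts \<sigma>" for x y z
    using ds that by (simp add: eucl_triangle)
  show "\<forall>w. z w \<noteq> 0 \<longrightarrow> (\<exists>e>0. \<forall>x\<in>simplex_pts \<sigma>. x w = 0 \<longrightarrow> e \<le> ds \<sigma> z x)"
    if z: "z \<in> simplex_pts \<sigma>" for z
  proof (intro allI impI)
    fix w assume w: "z w \<noteq> 0"
    have "\<exists>e>0. \<forall>x\<in>simplex_pts \<sigma>. x w = 0 \<longrightarrow> e \<le> eucl m (comb \<sigma> p z) (comb \<sigma> p x)"
    proof (rule gap_of_continuous[OF fin])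
      show "continuous_on (simplex_pts \<sigma>) (\<lambda>x. eucl m (comb \<sigma> p z) (comb \<sigma> p x))"
        unfolding eucl_def by (intro continuous_intros)
      show "0 \<le> eucl m (comb \<sigma> p z) (comb \<sigma> p x)" for x by (simp add: eucl_def sum_nonneg)
      fix x assume x: "x \<in> simplex_pts \<sigma>" "eucl m (comb \<sigma> p z) (comb \<sigma> p x) = 0"
      then have "\<forall>i<m. comb \<sigma> p z i - comb \<sigma> p x i = 0"
        by (auto simp: eucl_def sum_nonneg_eq_0_iff)
      then have "\<forall>i<m. (\<Sum>v\<in>\<sigma>. (z v - x v) * p v i) = 0"
        by (simp add: comb_def left_diff_distrib sum_subtractf)
      moreover have "(\<Sum>v\<in>\<sigma>. z v - x v) = 0" using x z by (simp add: simplex_pts_def sum_subtractf)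
      ultimately have "(\<Sum>v\<in>\<sigma>. z v - x v) = 0 \<and> (\<forall>i<m. (\<Sum>v\<in>\<sigma>. (z v - x v) * p v i) = 0)"
        by (rule conjI[rotated])
      then have "\<forall>v\<in>\<sigma>. z v - x v = 0"
        by (rule ai[unfolded aff_indep_def, THEN spec[of _ "\<lambda>v. z v - x v"], THEN mp])
      moreover have "w \<in> \<sigma>" using w z by (auto simp: simplex_pts_def)
      ultimately show "x w \<noteq> 0" using w by auto
    qed
    then show "\<exists>e>0. \<forall>x\<in>simplex_pts \<sigma>. x w = 0 \<longrightarrow> e \<le> ds \<sigma> z x" using ds z by simp
  qed
qed

text \<open>Any two vertices on the hyperboloid pair to at least 1 under minus the form, hence so do
  convex combinations, by linearity in one argument and then in the other. The root in
  \<open>hnormalize\<close> is therefore at least 1.\<close>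

lemma simplex_comb_timelike:
  assumes p: "\<And>v. v \<in> \<sigma> \<Longrightarrow> p v \<in> hyp m" and x: "x \<in> simplex_pts \<sigma>"
  shows "1 \<le> - mink m (comb \<sigma> p x) (comb \<sigma> p x)" and "0 < comb \<sigma> p x 0"
proof -
  have s: "sum x \<sigma> = 1" and x0: "\<And>v. 0 \<le> x v" using x by (auto simp: simplex_pts_def)
  have "1 \<le> - mink m (p v) (comb \<sigma> p x)" if v: "v \<in> \<sigma>" for v
  proof -
    have "1 = (\<Sum>w\<in>\<sigma>. x w * 1)" using s by simp
    also have "\<dots> \<le> (\<Sum>w\<in>\<sigma>. x w * (- mink m (p w) (p v)))"
      using mink_hyp_le p v x0 by (intro sum_mono mult_left_mono) auto
    also have "\<dots> = - mink m (comb \<sigma> p x) (p v)" unfolding mink_comb by (simp add: sum_negf)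
    finally show ?thesis by (simp add: mink_sym)
  qed note 1 = this
  have "1 = (\<Sum>w\<in>\<sigma>. x w * 1)" using s by simp
  also have "\<dots> \<le> (\<Sum>w\<in>\<sigma>. x w * (- mink m (p w) (comb \<sigma> p x)))"
    using 1 x0 by (intro sum_mono mult_left_mono) auto
  also have "\<dots> = - mink m (comb \<sigma> p x) (comb \<sigma> p x)"
    unfolding mink_comb[where b = "comb \<sigma> p x"] by (simp add: sum_negf)
  finally show "1 \<le> - mink m (comb \<sigma> p x) (comb \<sigma> p x)" .
  have "1 = (\<Sum>w\<in>\<sigma>. x w * 1)" using s by simp
  also have "\<dots> \<le> comb \<sigma> p x 0"
    unfolding comb_def using p hyp_coord_ge_1 x0 by (intro sum_mono mult_left_mono) auto
  finally show "0 < comb \<sigma> p x 0" by simp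
qed

lemma hnormalize_in_hyp:
  assumes "1 \<le> - mink m a a" "0 < a 0"
  shows "hnormalize m a \<in> hyp m"
proof -
  let ?N = "sqrt (- mink m a a)"
  have N: "0 < ?N" using assms by simp
  have "mink m (hnormalize m a) (hnormalize m a) = mink m a a / (?N)\<^sup>2"
    unfolding hnormalize_def mink_def
    by (simp add: power2_eq_square add_divide_distrib diff_divide_distrib sum_divide_distrib)
  also have "\<dots> = -1" using assms by (simp add: divide_eq_minus_1_iff)
  finally show ?thesis using N assms by (simp add: hyp_def hnormalize_def)
qed

lemma simplexwise_metric_of_ph:
  assumes "ph_metric n ds"
  shows "simplexwise_metric n ds"
  unfolding simplexwise_metric_def
proof (intro conjI ballI)
  show "face_compatible n ds" using assms by (simp add: ph_metric_def)
  fix \<sigma> assume \<sigma>: "\<sigma> \<in> simplices n"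
  then have fin: "finite \<sigma>" by (simp add: simplices_def)
  obtain m p where p: "\<forall>v\<in>\<sigma>. p v \<in> hyp m" and li: "lin_indep m \<sigma> p" and
    ds: "\<And>x y. x\<in>simplex_pts \<sigma> \<Longrightarrow> y\<in>simplex_pts \<sigma> \<Longrightarrow>
      ds \<sigma> x y = hdist m (hnormalize m (comb \<sigma> p x)) (hnormalize m (comb \<sigma> p y))"
    using assms \<sigma> unfolding ph_metric_def by meson
  define N where "N x = sqrt (- mink m (comb \<sigma> p x) (comb \<sigma> p x))" for x
  define u where "u x = hnormalize m (comb \<sigma> p x)" for x
  have u: "u x \<in> hyp m" if "x \<in> simplex_pts \<sigma>" for x
    unfolding u_def using that simplex_comb_timelike[of \<sigma> p m x] p by (intro hnormalize_in_hyp) auto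
  have N: "0 < N x" if "x \<in> simplex_pts \<sigma>" for x
    unfolding N_def using that simplex_comb_timelike(1)[of \<sigma> p m x] p by simp
  have uN: "u x i = comb \<sigma> p x i / N x" for x i by (simp add: u_def N_def hnormalize_def)
  have ds': "ds \<sigma> x y = hdist m (u x) (u y)" if "x\<in>simplex_pts \<sigma>" "y\<in>simplex_pts \<sigma>" for x y
    using ds that by (simp add: u_def)
  show "ds \<sigma> x x = 0" if "x \<in> simplex_pts \<sigma>" for x
    using ds'[OF that that] u[OF that] by (simp add: hdist_def hyp_def)
  show "0 \<le> ds \<sigma> x y" if "x \<in> simplex_pts \<sigma>" "y \<in> simplex_pts \<sigma>" for x y
    using ds' that mink_hyp_le[OF u u] by (simp add: hdist_def)
  show "ds \<sigma> x z \<le> ds \<sigma> x y + ds \<sigma> y z"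
    if "x \<in> simplex_pts \<sigma>" "y \<in> simplex_pts \<sigma>" "z \<in> simplex_pts \<sigma>" for x y z
    using ds' that by (simp add: hdist_triangle u)
  show "\<forall>w. z w \<noteq> 0 \<longrightarrow> (\<exists>e>0. \<forall>x\<in>simplex_pts \<sigma>. x w = 0 \<longrightarrow> e \<le> ds \<sigma> z x)"
    if z: "z \<in> simplex_pts \<sigma>" for z
  proof (intro allI impI)
    fix w assume w: "z w \<noteq> 0"
    have "\<exists>e>0. \<forall>x\<in>simplex_pts \<sigma>. x w = 0 \<longrightarrow> e \<le> hdist m (u z) (u x)"
    proof (rule gap_of_continuous[OF fin])
      have cN: "continuous_on (simplex_pts \<sigma>) N"
        unfolding N_def mink_def by (intro continuous_intros)
      have "continuous_on (simplex_pts \<sigma>) (\<lambda>x. u x i)" for i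
        unfolding uN using N by (intro continuous_intros cN) force
      then show "continuous_on (simplex_pts \<sigma>) (\<lambda>x. hdist m (u z) (u x))"
        unfolding hdist_def using mink_hyp_le[OF u u] z
        by (intro continuous_on_compose2[OF continuous_on_arcosh[of "{1..}"]])
           (auto simp: mink_def intro!: continuous_intros)
      show "0 \<le> hdist m (u z) (u x)" if "x \<in> simplex_pts \<sigma>" for x
        using mink_hyp_le[OF u u] that z by (simp add: hdist_def)
      fix x assume x: "x \<in> simplex_pts \<sigma>" "hdist m (u z) (u x) = 0"
      then have "mink m (u z) (u x) = -1"
        unfolding hdist_def using mink_hyp_le[OF u u] z by (subst (asm) arcosh_eq_0_iff_real) auto
      then have e: "u z i = u x i" if "i \<le> m" for i using mink_hyp_eq_imp[OF u u] z x that by blast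
      \<comment> \<open>Equal normalized points have proportional, not equal, barycentric
        coordinates. That is enough to carry the nonvanishing of the coordinate \<open>w\<close>
        from z to x.\<close>
      have "\<forall>i\<le>m. (\<Sum>v\<in>\<sigma>. (z v / N z - x v / N x) * p v i) = 0"
      proof (intro allI impI)
        fix i assume "i \<le> m"
        then have "(\<Sum>v\<in>\<sigma>. z v * p v i) / N z = (\<Sum>v\<in>\<sigma>. x v * p v i) / N x"
          using e[of i] by (simp add: uN comb_def)
        then show "(\<Sum>v\<in>\<sigma>. (z v / N z - x v / N x) * p v i) = 0"
          by (simp add: left_diff_distrib sum_subtractf sum_divide_distrib)
      qed
      then have c: "\<forall>v\<in>\<sigma>. z v / N z - x v / N x = 0"
        by (rule li[unfolded lin_indep_def, THEN spec, THEN mp])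
      moreover have "w \<in> \<sigma>" using w z by (auto simp: simplex_pts_def)
      ultimately have "z w / N z = x w / N x" by simp
      then show "x w \<noteq> 0" using w N[OF z] by auto
    qed
    then show "\<exists>e>0. \<forall>x\<in>simplex_pts \<sigma>. x w = 0 \<longrightarrow> e \<le> ds \<sigma> z x" using ds' z by simp
  qed
qed

section \<open>The length metric\<close>

lemma Pts_in_simplex_pts: "x \<in> Pts n \<Longrightarrow> finite \<sigma> \<Longrightarrow> supp x \<subseteq> \<sigma> \<Longrightarrow> x \<in> simplex_pts \<sigma>"
proof -
  assume x: "x \<in> Pts n" "finite \<sigma>" "supp x \<subseteq> \<sigma>"
  have "sum x (supp x) = sum x \<sigma>"
    using x by (intro sum.mono_neutral_left) (auto simp: supp_def)
  then show ?thesis using x by (auto simp: Pts_def simplex_pts_def supp_def)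
qed

lemma supp_Pts_simplex: "x \<in> Pts n \<Longrightarrow> supp x \<in> simplices n"
  by (simp add: Pts_def)

lemma simplices_finite: "\<sigma> \<in> simplices n \<Longrightarrow> finite \<sigma>"
  by (simp add: simplices_def)

lemma is_string_Nil [simp]: "\<not> is_string n x y []"
  by (simp add: is_string_def)

lemma is_string_single [simp]: "is_string n x y [a] \<longleftrightarrow> a = x \<and> a = y \<and> a \<in> Pts n"
  by (auto simp: is_string_def)

lemma is_string_Cons2 [simp]:
  "is_string n x y (a # b # zs) \<longleftrightarrow>
    a = x \<and> a \<in> Pts n \<and> supp a \<union> supp b \<in> simplices n \<and> is_string n b y (b # zs)"
proof -
  have all_split: "(\<forall>i. Q i) \<longleftrightarrow> Q 0 \<and> (\<forall>i. Q (Suc i))" for Q :: "nat \<Rightarrow> bool"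
    by (metis not0_implies_Suc)
  have "(\<forall>i. Suc i < length (a # b # zs) \<longrightarrow>
          supp ((a # b # zs) ! i) \<union> supp ((a # b # zs) ! Suc i) \<in> simplices n)
      \<longleftrightarrow> supp a \<union> supp b \<in> simplices n \<and>
        (\<forall>i. Suc i < length (b # zs) \<longrightarrow> supp ((b # zs) ! i) \<union> supp ((b # zs) ! Suc i) \<in> simplices n)"
    by (subst all_split) simp
  then show ?thesis unfolding is_string_def by auto
qed

lemma string_len_single [simp]: "string_len ds [a] = 0"
  by (simp add: string_len_def)

lemma string_len_Cons2 [simp]:
  "string_len ds (a # b # zs) = ds (supp a \<union> supp b) a b + string_len ds (b # zs)"
  by (simp add: string_len_def sum.lessThan_Suc_shift del: sum.lessThan_Suc)

text \<open>\<open>tl ys\<close> drops the second copy of the junction \<open>y\<close>.\<close>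

lemma is_string_append:
  assumes "is_string n x y xs" "is_string n y z ys"
  shows "is_string n x z (xs @ tl ys) \<and> string_len ds (xs @ tl ys) = string_len ds xs + string_len ds ys"
  using assms(1)
proof (induction xs arbitrary: x)
  case (Cons a xs)
  show ?case
  proof (cases xs)
    case Nil
    then have "a = x" "a = y" using Cons.prems by auto
    moreover obtain b zs where ys: "ys = b # zs" using assms(2) by (cases ys) auto
    ultimately show ?thesis using assms(2) Nil by (cases zs) auto
  next
    case [simp]: (Cons b zs)
    have "is_string n b y (b # zs)" using Cons.prems by simp
    then show ?thesis using Cons.IH[of b] Cons.prems by auto
  qed
qed simp

locale simplexwise =
  fixes n :: nat and ds :: simplex_metrics
  assumes sm: "simplexwise_metric n ds"
begin

lemma ds_nonneg: "\<sigma> \<in> simplices n \<Longrightarrow> x \<in> simplex_pts \<sigma> \<Longrightarrow> y \<in> simplex_pts \<sigma> \<Longrightarrow> 0 \<le> ds \<sigma> x y"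
  and ds_refl: "\<sigma> \<in> simplices n \<Longrightarrow> x \<in> simplex_pts \<sigma> \<Longrightarrow> ds \<sigma> x x = 0"
  and ds_tri: "\<sigma> \<in> simplices n \<Longrightarrow> x \<in> simplex_pts \<sigma> \<Longrightarrow> y \<in> simplex_pts \<sigma> \<Longrightarrow> z \<in> simplex_pts \<sigma>
      \<Longrightarrow> ds \<sigma> x z \<le> ds \<sigma> x y + ds \<sigma> y z"
  and ds_gap: "\<sigma> \<in> simplices n \<Longrightarrow> z \<in> simplex_pts \<sigma> \<Longrightarrow> z w \<noteq> 0
      \<Longrightarrow> \<exists>e>0. \<forall>x\<in>simplex_pts \<sigma>. x w = 0 \<longrightarrow> e \<le> ds \<sigma> z x"
  using sm unfolding simplexwise_metric_def by blast+

lemma ds_face: "\<sigma> \<in> simplices n \<Longrightarrow> \<tau> \<in> simplices n \<Longrightarrow> \<tau> \<subseteq> \<sigma> \<Longrightarrow> x \<in> simplex_pts \<tau>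
    \<Longrightarrow> y \<in> simplex_pts \<tau> \<Longrightarrow> ds \<sigma> x y = ds \<tau> x y"
  using sm unfolding simplexwise_metric_def face_compatible_def by blast

lemma is_string_hd_in_Pts: "is_string n x y (b # zs) \<Longrightarrow> b \<in> Pts n \<and> b = x"
  by (cases zs) auto

lemma string_len_nonneg: "is_string n x y xs \<Longrightarrow> 0 \<le> string_len ds xs"
proof (induction xs arbitrary: x)
  case (Cons a xs)
  show ?case
  proof (cases xs)
    case [simp]: (Cons b zs)
    have s: "is_string n b y (b # zs)" and \<tau>: "supp a \<union> supp b \<in> simplices n" and "a \<in> Pts n" "b \<in> Pts n"
      using Cons.prems is_string_hd_in_Pts by auto
    then have "a \<in> simplex_pts (supp a \<union> supp b)" "b \<in> simplex_pts (supp a \<union> supp b)"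
      using Pts_in_simplex_pts[OF _ simplices_finite[OF \<tau>]] by auto
    then show ?thesis using Cons.IH[of b] s ds_nonneg[OF \<tau>] by simp
  qed simp
qed simp

lemma len_dist_le: "is_string n x y xs \<Longrightarrow> len_dist n ds x y \<le> string_len ds xs"
  unfolding len_dist_def by (intro cInf_lower bdd_belowI[of _ 0]) (auto simp: string_len_nonneg)

lemma len_dist_ge:
  assumes "is_string n x y xs0" and "\<And>xs. is_string n x y xs \<Longrightarrow> e \<le> string_len ds xs"
  shows "e \<le> len_dist n ds x y"
  unfolding len_dist_def using assms by (intro cInf_greatest) auto

text \<open>Without strings the infimum is taken over the empty set, an unspecified real
  \<open>?c\<close>, so disconnection does not show in the distance as such. But then the geodesic
  from x to y has a midpoint at distance \<open>?c / 2\<close> from either end; as this differs from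
  \<open>?c\<close>, both halves are joined by strings, and these concatenate.\<close>

lemma ex_string:
  assumes geod: "geodesic_space (Pts n) (len_dist n ds)" and X: "x \<in> Pts n" "y \<in> Pts n"
  shows "\<exists>xs. is_string n x y xs"
proof (rule ccontr)
  let ?d = "len_dist n ds"
  let ?c = "Inf ({} :: real set)"
  assume no: "\<nexists>xs. is_string n x y xs"
  have empty: "?d x y = ?c" if "\<nexists>xs. is_string n x y xs" for x y
    using that unfolding len_dist_def by simp
  obtain c where c: "geodesic_seg ?d (Pts n) x y c" using geod X unfolding geodesic_space_def by blast
  have "x \<noteq> y"
  proof
    assume "x = y"
    then have "is_string n x y [x]" using X by simp
    then show False using no by blast
  qed
  then have pos: "0 < ?d x y" using c unfolding geodesic_seg_def by (metis order_le_less)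
  define m where "m = c (?d x y / 2)"
  have cd: "?d (c s) (c t) = \<bar>s - t\<bar>" if "s \<in> {0..?d x y}" "t \<in> {0..?d x y}" for s t
    using c that unfolding geodesic_seg_def by blast
  have ends: "c 0 = x" "c (?d x y) = y" using c unfolding geodesic_seg_def by auto
  have "?d x m = ?d x y / 2" "?d m y = ?d x y / 2"
    using cd[of 0 "?d x y / 2"] cd[of "?d x y / 2" "?d x y"] pos unfolding ends m_def by auto
  then have "?d x m \<noteq> ?c" "?d m y \<noteq> ?c" using pos empty[OF no] by linarith+
  then obtain xs ys where "is_string n x m xs" "is_string n m y ys" using empty by metis
  then show False using is_string_append no by blast
qed

lemma geodesic_metric_len_dist:
  assumes geod: "geodesic_space (Pts n) (len_dist n ds)"
  shows "geodesic_metric (Pts n) (len_dist n ds)"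
proof
  let ?d = "len_dist n ds"
  fix x y z assume X: "x \<in> Pts n" "y \<in> Pts n" "z \<in> Pts n"
  obtain xs0 ys0 where s0: "is_string n x y xs0" "is_string n y z ys0" using ex_string[OF geod] X by blast
  have "?d x z - ?d y z \<le> string_len ds xs" if xs: "is_string n x y xs" for xs
  proof -
    have "?d x z - string_len ds xs \<le> ?d y z"
    proof (rule len_dist_ge[OF s0(2)])
      fix ys assume "is_string n y z ys"
      then show "?d x z - string_len ds xs \<le> string_len ds ys"
        using is_string_append[OF xs] len_dist_le by (metis diff_le_eq add.commute)
    qed
    then show ?thesis by simp
  qed
  then have "?d x z - ?d y z \<le> ?d x y" by (rule len_dist_ge[OF s0(1)])
  then show "?d x z \<le> ?d x y + ?d y z" by simp
qed (rule geod)

text \<open>A string leaving the open star of the support of \<open>z\<close> first passes through a simplex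
  containing that support, where it reaches an opposite face.\<close>

lemma open_star_nbhd:
  assumes geod: "geodesic_space (Pts n) (len_dist n ds)" and z: "z \<in> Pts n"
    and fin: "finite {\<tau> \<in> simplices n. supp z \<subseteq> \<tau>}"
  shows "\<exists>e>0. \<forall>y\<in>Pts n. len_dist n ds z y < e \<longrightarrow> supp z \<subseteq> supp y"
proof -
  define F where "F = {\<tau> \<in> simplices n. supp z \<subseteq> \<tau>}"
  have zs: "z \<in> simplex_pts \<tau>" if "\<tau> \<in> F" for \<tau>
    using that z by (auto simp: F_def simplices_finite intro!: Pts_in_simplex_pts)
  have "\<forall>q\<in>F \<times> supp z. \<exists>e>0. \<forall>x\<in>simplex_pts (fst q). x (snd q) = 0 \<longrightarrow> e \<le> ds (fst q) z x"
    using ds_gap zs by (auto simp: F_def supp_def)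
  then have "\<exists>g. \<forall>q\<in>F \<times> supp z. g q > 0 \<and> (\<forall>x\<in>simplex_pts (fst q). x (snd q) = 0 \<longrightarrow> g q \<le> ds (fst q) z x)"
    by (rule bchoice)
  then obtain g where gg: "\<forall>q\<in>F \<times> supp z. g q > 0 \<and> (\<forall>x\<in>simplex_pts (fst q). x (snd q) = 0 \<longrightarrow> g q \<le> ds (fst q) z x)" ..
  have g1: "0 < g q" if "q \<in> F \<times> supp z" for q
    using bspec[OF gg that] by (rule conjunct1)
  have g2: "g q \<le> ds (fst q) z x"
    if "q \<in> F \<times> supp z" "x \<in> simplex_pts (fst q)" "x (snd q) = 0" for q x
    using bspec[OF gg that(1)] that(2,3) by (elim conjE) blast
  have finq: "finite (F \<times> supp z)" using fin simplices_finite[OF supp_Pts_simplex[OF z]] by (simp add: F_def)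
  have neq: "F \<times> supp z \<noteq> {}"
  proof -
    have "supp z \<in> F" using supp_Pts_simplex[OF z] by (simp add: F_def)
    moreover have "supp z \<noteq> {}" using supp_Pts_simplex[OF z] by (simp add: simplices_def)
    ultimately have "F \<noteq> {} \<and> supp z \<noteq> {}" by blast
    then show ?thesis by simp
  qed
  define e where "e = Min (g ` (F \<times> supp z))"
  have e: "0 < e" "\<And>\<tau> w x. \<tau> \<in> F \<Longrightarrow> w \<in> supp z \<Longrightarrow> x \<in> simplex_pts \<tau> \<Longrightarrow> x w = 0 \<Longrightarrow> e \<le> ds \<tau> z x"
  proof -
    show "0 < e"
    proof -
      have "e \<in> g ` (F \<times> supp z)" unfolding e_def using finq neq by (intro Min_in) simp_all
      then obtain q where "q \<in> F \<times> supp z" "e = g q" by (rule imageE)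
      then show ?thesis using g1 by simp
    qed
    fix \<tau> w x assume a: "\<tau> \<in> F" "w \<in> supp z" "x \<in> simplex_pts \<tau>" "x w = 0"
    then have "e \<le> g (\<tau>, w)" unfolding e_def using finq by (intro Min_le finite_imageI imageI) simp_all
    then show "e \<le> ds \<tau> z x" using g2[of "(\<tau>, w)" x] a by simp
  qed
  \<comment> \<open>Induction along the string. The distance from z to the current point, measured
    inside a simplex, is the length already accounted for; one step costs the triangle inequality in
    the simplex \<tau> spanned by two consecutive points, and the gap \<open>e\<close> applies when
    the string leaves the star.\<close>
  have main: "e \<le> ds (supp x) z x + string_len ds xs"
    if "is_string n x y xs" "supp z \<subseteq> supp x" "\<not> supp z \<subseteq> supp y" for x y xs
    using that
  proof (induction xs arbitrary: x)
    case (Cons a xs)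
    show ?case
    proof (cases xs)
      case Nil
      then show ?thesis using Cons.prems by auto
    next
      case [simp]: (Cons b bs)
      define \<tau> where "\<tau> = supp a \<union> supp b"
      have ax: "a = x" and s: "is_string n b y (b # bs)" and \<tau>: "\<tau> \<in> simplices n" and ab: "a \<in> Pts n" "b \<in> Pts n"
        using Cons.prems is_string_hd_in_Pts by (auto simp: \<tau>_def)
      have pts: "a \<in> simplex_pts \<tau>" "b \<in> simplex_pts \<tau>"
        using ab Pts_in_simplex_pts[OF _ simplices_finite[OF \<tau>]] by (auto simp: \<tau>_def)
      have \<tau>F: "\<tau> \<in> F" using \<tau> Cons.prems ax by (auto simp: F_def \<tau>_def)
      have za: "ds (supp a) z a = ds \<tau> z a"
        using \<tau> ab Cons.prems ax z supp_Pts_simplex[OF ab(1)]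
        by (intro ds_face[symmetric] Pts_in_simplex_pts) (auto simp: \<tau>_def simplices_finite)
      have tri: "ds \<tau> z b \<le> ds \<tau> z a + ds \<tau> a b" using ds_tri[OF \<tau> zs[OF \<tau>F] pts] .
      have "e \<le> ds \<tau> z b + string_len ds (b # bs)"
      proof (cases "supp z \<subseteq> supp b")
        case True
        have "ds (supp b) z b = ds \<tau> z b"
          using \<tau> ab True z supp_Pts_simplex[OF ab(2)]
          by (intro ds_face[symmetric] Pts_in_simplex_pts) (auto simp: \<tau>_def simplices_finite)
        then show ?thesis using Cons.IH[of b] s True Cons.prems by simp
      next
        case False
        then obtain w where "w \<in> supp z" "b w = 0" by (auto simp: supp_def)
        then have "e \<le> ds \<tau> z b" using e(2) \<tau>F pts by blast
        then show ?thesis using string_len_nonneg[OF s] by simp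
      qed
      then show ?thesis using tri za ax by (simp add: \<tau>_def)
    qed
  qed simp
  have "e \<le> len_dist n ds z y" if y: "y \<in> Pts n" "\<not> supp z \<subseteq> supp y" for y
  proof -
    obtain xs0 where s0: "is_string n z y xs0" using ex_string[OF geod z y(1)] by blast
    have "z \<in> simplex_pts (supp z)"
      using z supp_Pts_simplex[OF z] by (intro Pts_in_simplex_pts) (auto simp: simplices_finite)
    then have "ds (supp z) z z = 0" using ds_refl supp_Pts_simplex[OF z] by blast
    then have "e \<le> string_len ds xs" if "is_string n z y xs" for xs
      using main[OF that _ y(2)] by simp
    then show ?thesis by (rule len_dist_ge[OF s0])
  qed
  then show ?thesis using e(1) by (meson not_le)
qed

end

section \<open>Automorphisms of the universal Coxeter group\<close>

text \<open>Van der Waerden's device: letters act on reduced words, each as an involution, and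
  \<open>red\<close> is the resulting fold. Cancellation follows from this action without a
  confluence argument.\<close>

definition red_step :: "nat \<Rightarrow> nat list \<Rightarrow> nat list" where
  "red_step x r = (case r of [] \<Rightarrow> [x] | y # ys \<Rightarrow> (if x = y then ys else x # y # ys))"

lemma red_Cons: "red (x # w) = red_step x (red w)"
  by (simp add: red_step_def)

lemma distinct_adj_red_step: "distinct_adj r \<Longrightarrow> distinct_adj (red_step x r)"
  by (cases r) (auto simp: red_step_def distinct_adj_Cons)

lemma distinct_adj_red: "distinct_adj (red w)"
  by (induction w) (auto simp: red_Cons distinct_adj_red_step simp del: red.simps(2))

lemma red_of_distinct_adj: "distinct_adj r \<Longrightarrow> red r = r"
  by (induction r) (auto simp: distinct_adj_Cons split: list.splits)

lemma red_red [simp]: "red (red w) = red w"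
  by (simp add: red_of_distinct_adj distinct_adj_red)

lemma red_step_red_step: "distinct_adj r \<Longrightarrow> red_step x (red_step x r) = r"
  by (cases r; cases "tl r") (auto simp: red_step_def distinct_adj_Cons)

lemma red_append: "red (u @ v) = foldr red_step u (red v)"
  by (induction u) (auto simp: red_Cons simp del: red.simps(2))

lemma red_append_red_right [simp]: "red (u @ red v) = red (u @ v)"
  by (simp add: red_append)

lemma red_append_red_left [simp]: "red (red u @ v) = red (u @ v)"
proof (induction u)
  case (Cons x u)
  show ?case
  proof (cases "red u")
    case Nil
    then show ?thesis using Cons by (simp add: red_Cons red_step_def)
  next
    case (Cons y ys)
    show ?thesis
    proof (cases "x = y")
      case True
      have "red ((x # u) @ v) = red_step x (red (red u @ v))" using Cons.IH by (simp add: red_Cons del: red.simps(2))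
      also have "\<dots> = red_step x (red_step x (red (ys @ v)))" using Cons True by (simp add: red_Cons del: red.simps(2))
      also have "\<dots> = red (ys @ v)" by (simp add: red_step_red_step distinct_adj_red)
      finally show ?thesis using Cons True by simp
    next
      case False
      then have "red (x # u) = x # red u" using Cons by simp
      then show ?thesis using Cons.IH by (simp add: red_Cons del: red.simps(2))
    qed
  qed
qed simp

lemma red_append_cong: "red u = red u' \<Longrightarrow> red v = red v' \<Longrightarrow> red (u @ v) = red (u' @ v')"
  by (metis red_append_red_left red_append_red_right)

lemma red_rev_cancel: "red (rev w @ w @ v) = red v"
proof (induction w arbitrary: v)
  case (Cons x w)
  have *: "red_step x (red_step x (red (w @ v))) = red (w @ v)"
    by (simp add: red_step_red_step distinct_adj_red)
  have "red (rev (x # w) @ (x # w) @ v) = foldr red_step (rev w) (red_step x (red_step x (red (w @ v))))"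
    by (simp add: red_append[of "rev w"] red_Cons del: red.simps(2))
  also have "\<dots> = red (rev w @ w @ v)"
    unfolding * by (simp add: red_append[of "rev w"])
  finally show ?case using Cons by simp
qed simp

lemma red_cancel_rev: "red (w @ rev w @ v) = red v"
  using red_rev_cancel[of "rev w"] by simp

lemma set_red: "set (red w) \<subseteq> set w"
  by (induction w) (auto split: list.splits)

lemma red_map_inj: "inj \<pi> \<Longrightarrow> red (map \<pi> w) = map \<pi> (red w)"
  by (induction w) (auto split: list.splits simp: inj_eq)

section \<open>Conjugation of words, and endomorphisms that conjugate each generator\<close>

definition conj_word :: "nat list \<Rightarrow> nat list \<Rightarrow> nat list" where
  "conj_word w u = red (w @ u @ rev w)"

lemma red_conj_word [simp]: "red (conj_word w u) = conj_word w u"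
  by (simp add: conj_word_def)

lemma conj_word_red [simp]: "conj_word w (red u) = conj_word w u"
proof -
  have "red ((w @ red u) @ rev w) = red ((w @ u) @ rev w)" by (intro red_append_cong) simp_all
  then show ?thesis by (simp add: conj_word_def)
qed

lemma conj_word_red_left: "conj_word (red w) u = conj_word w u"
proof -
  have "red (rev (red w)) = red (rev (red w) @ (w @ rev w @ []))"
    using red_append_cong[of "rev (red w)" "rev (red w)" "[]" "w @ rev w @ []"] red_cancel_rev[of w "[]"] by simp
  also have "\<dots> = red (rev (red w) @ (red w @ rev w))" by (intro red_append_cong refl) simp_all
  also have "\<dots> = red (rev w)" by (rule red_rev_cancel)
  finally show ?thesis unfolding conj_word_def by (intro red_append_cong) simp_all
qed

lemma conj_word_append: "red (conj_word w u @ conj_word w v) = conj_word w (u @ v)"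
proof -
  have "red (conj_word w u @ conj_word w v) = red ((w @ u @ rev w) @ (w @ v @ rev w))"
    unfolding conj_word_def red_append_red_left red_append_red_right ..
  also have "\<dots> = red ((w @ u) @ (rev w @ w @ (v @ rev w)))" by simp
  also have "\<dots> = red ((w @ u) @ (v @ rev w))" by (intro red_append_cong red_rev_cancel refl)
  finally show ?thesis by (simp add: conj_word_def)
qed

lemma conj_word_conj_word: "conj_word v (conj_word w u) = conj_word (v @ w) u"
  unfolding conj_word_def[of w] conj_word_red by (simp add: conj_word_def)

lemma conj_word_Nil: "conj_word w [] = []"
  using red_cancel_rev[of w "[]"] by (simp add: conj_word_def)

lemma conj_word_empty: "conj_word [] u = red u"
  by (simp add: conj_word_def)

text \<open>\<open>Aut0\<close> without bijectivity. It is closed under composition, so products can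
  be computed before they are known to be automorphisms. The conjugating word may be unreduced, and
  it exists also for letters outside {1..n}, where the empty word serves.\<close>

definition conj_end :: "nat \<Rightarrow> aut \<Rightarrow> bool" where
  "conj_end n f \<longleftrightarrow> (\<forall>j. j \<notin> {1..n} \<longrightarrow> f j = [j])
      \<and> (\<forall>j. \<exists>w. set w \<subseteq> {1..n} \<and> f j = conj_word w [j])"

lemma conj_endD: "conj_end n f \<Longrightarrow> \<exists>w. set w \<subseteq> {1..n} \<and> f j = conj_word w [j]"
  and conj_end_outside: "conj_end n f \<Longrightarrow> j \<notin> {1..n} \<Longrightarrow> f j = [j]"
  unfolding conj_end_def by blast+

lemma conj_endI:
  assumes "\<And>j. j \<notin> {1..n} \<Longrightarrow> f j = [j]"
    and "\<And>j. j \<in> {1..n} \<Longrightarrow> \<exists>w. set w \<subseteq> {1..n} \<and> f j = conj_word w [j]"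
  shows "conj_end n f"
  unfolding conj_end_def
proof (intro conjI allI impI)
  fix j show "\<exists>w. set w \<subseteq> {1..n} \<and> f j = conj_word w [j]"
    by (cases "j \<in> {1..n}") (use assms in \<open>auto simp: conj_word_empty intro!: exI[of _ "[]"]\<close>)
qed (use assms in auto)

lemma conj_end_red: "conj_end n f \<Longrightarrow> red (f j) = f j"
  using conj_endD by (metis red_conj_word)

lemma conj_end_square: "conj_end n f \<Longrightarrow> red (f j @ f j) = []"
proof -
  assume "conj_end n f"
  then obtain w where w: "f j = conj_word w [j]" using conj_endD by blast
  have "conj_word w (red ([j] @ [j])) = []" by (simp add: conj_word_Nil)
  then show ?thesis unfolding w conj_word_append by (simp only: conj_word_red)
qed

lemma wapp_Cons: "wapp f (x # w) = red (f x @ wapp f w)"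
  by (simp add: wapp_def)

lemma wapp_append: "wapp f (u @ v) = red (wapp f u @ wapp f v)"
  by (simp add: wapp_def)

lemma wapp_Nil [simp]: "wapp f [] = []"
  by (simp add: wapp_def)

lemma red_wapp [simp]: "red (wapp f w) = wapp f w"
  by (simp add: wapp_def)

text \<open>Substitution respects reduction as soon as the images of letters square to the empty
  word. In this generality it also covers letter maps, which need not send a letter to a conjugate
  of itself.\<close>

lemma wapp_red_of_involutions:
  assumes f: "\<And>j. red (f j @ f j) = []"
  shows "wapp f (red w) = wapp f w"
proof (induction w)
  case (Cons x w)
  have *: "wapp f (x # w) = red (f x @ wapp f (red w))" using Cons by (simp add: wapp_Cons)
  show ?case
  proof (cases "red w")
    case Nil
    then show ?thesis using * by (simp add: wapp_Cons)
  next
    case (Cons y ys)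
    show ?thesis
    proof (cases "x = y")
      case True
      have "wapp f (x # w) = red ((f x @ f x) @ wapp f ys)" using * Cons True by (simp add: wapp_Cons)
      also have "\<dots> = red ([] @ wapp f ys)"
        by (rule red_append_cong) (simp_all add: f)
      finally show ?thesis using Cons True by simp
    next
      case False
      then have "red (x # w) = x # red w" using Cons by simp
      then show ?thesis using * by (simp only: wapp_Cons)
    qed
  qed
qed simp

lemma wapp_red: "conj_end n f \<Longrightarrow> wapp f (red w) = wapp f w"
  using wapp_red_of_involutions conj_end_square by blast

text \<open>A letter map induces a homomorphism even if it is not injective. Identifying two letters
  later serves as the invariant that detects automorphisms which are not carried.\<close>

lemma red_map_red: "red (map \<theta> (red w)) = red (map \<theta> w)"
proof -
  have "wapp (\<lambda>j. [\<theta> j]) u = red (map \<theta> u)" for u by (simp add: wapp_def)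
  then show ?thesis using wapp_red_of_involutions[of "\<lambda>j. [\<theta> j]" w] by simp
qed

lemma wapp_rev: "conj_end n f \<Longrightarrow> red (wapp f (rev w) @ v) = red (rev (wapp f w) @ v)"
proof -
  assume f: "conj_end n f"
  let ?a = "wapp f w" and ?b = "wapp f (rev w)"
  have "red (?a @ ?b) = wapp f (red (w @ rev w))" by (simp add: wapp_red[OF f] wapp_append)
  then have ab: "red (?a @ ?b) = []" using red_cancel_rev[of w "[]"] by simp
  have "red (?b @ v) = red (rev ?a @ ?a @ (?b @ v))" by (rule red_rev_cancel[symmetric])
  also have "\<dots> = red (rev ?a @ ((?a @ ?b) @ v))" by simp
  also have "\<dots> = red (rev ?a @ ([] @ v))" by (intro red_append_cong refl) (simp add: ab)
  finally show ?thesis by simp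
qed

lemma wapp_conj_word:
  assumes f: "conj_end n f"
  shows "wapp f (conj_word w u) = conj_word (wapp f w) (wapp f u)"
proof -
  have "wapp f (conj_word w u) = wapp f (w @ u @ rev w)"
    unfolding conj_word_def by (rule wapp_red[OF f])
  also have "\<dots> = red (wapp f w @ (wapp f u @ wapp f (rev w)))" by (simp add: wapp_append)
  also have "\<dots> = red (wapp f w @ (wapp f u @ rev (wapp f w)))"
    by (intro red_append_cong refl) (use wapp_rev[OF f, of w "[]"] in \<open>simp add: red_append_cong\<close>)
  finally show ?thesis by (simp add: conj_word_def)
qed

lemma wapp_single: "conj_end n f \<Longrightarrow> wapp f [j] = f j"
  by (simp add: wapp_def conj_end_red)

lemma set_conj_word: "set (conj_word w u) \<subseteq> set w \<union> set u"
  using set_red[of "w @ u @ rev w"] by (auto simp: conj_word_def)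

lemma set_conj_end: "conj_end n f \<Longrightarrow> j \<in> {1..n} \<Longrightarrow> set (f j) \<subseteq> {1..n}"
proof -
  assume "conj_end n f" and j: "j \<in> {1..n}"
  then obtain w where "set w \<subseteq> {1..n}" "f j = conj_word w [j]" using conj_endD by blast
  then show ?thesis using set_conj_word[of w "[j]"] j by auto
qed

lemma set_wapp: "conj_end n f \<Longrightarrow> set w \<subseteq> {1..n} \<Longrightarrow> set (wapp f w) \<subseteq> {1..n}"
proof -
  assume f: "conj_end n f" and w: "set w \<subseteq> {1..n}"
  have "set (concat (map f w)) \<subseteq> {1..n}" unfolding set_concat set_map using w set_conj_end[OF f] by blast
  then show ?thesis using set_red unfolding wapp_def by blast
qed

lemma conj_end_comp: "conj_end n f \<Longrightarrow> conj_end n g \<Longrightarrow> conj_end n (comp_aut f g)"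
proof (rule conj_endI)
  assume f: "conj_end n f" and g: "conj_end n g"
  fix j
  { assume "j \<notin> {1..n}"
    then show "comp_aut f g j = [j]"
      using conj_end_outside[OF f] conj_end_outside[OF g] wapp_single[OF f] by (metis comp_aut_def) }
  obtain v where v: "set v \<subseteq> {1..n}" "g j = conj_word v [j]" using conj_endD[OF g] by blast
  obtain w where w: "set w \<subseteq> {1..n}" "f j = conj_word w [j]" using conj_endD[OF f] by blast
  have "comp_aut f g j = conj_word (wapp f v @ w) [j]"
    by (simp add: comp_aut_def v w wapp_conj_word[OF f] wapp_single[OF f] conj_word_conj_word)
  then show "\<exists>w. set w \<subseteq> {1..n} \<and> comp_aut f g j = conj_word w [j]"
    using set_wapp[OF f v(1)] w by (intro exI[of _ "wapp f v @ w"]) simp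
qed

lemma conj_end_id: "conj_end n id_aut"
  by (rule conj_endI) (auto simp: id_aut_def conj_word_empty intro!: exI[of _ "[]"])

lemma red_concat_map_red: "red (concat (map (\<lambda>x. red (h x)) w)) = red (concat (map h w))"
  by (induction w) (auto intro: red_append_cong)

lemma wapp_comp: "conj_end n f \<Longrightarrow> wapp (comp_aut f g) w = wapp f (wapp g w)"
proof -
  assume f: "conj_end n f"
  have "wapp f (wapp g w) = wapp f (concat (map g w))" unfolding wapp_def[of g] by (rule wapp_red[OF f])
  also have "\<dots> = red (concat (map (\<lambda>j. concat (map f (g j))) w))"
    unfolding wapp_def by (rule arg_cong[where f = red]) (induction w, auto)
  also have "\<dots> = wapp (comp_aut f g) w"
    by (simp add: wapp_def comp_aut_def red_concat_map_red)
  finally show ?thesis ..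
qed

lemma comp_aut_apply: "comp_aut f g j = wapp f (g j)"
  by (simp add: comp_aut_def)

lemma comp_aut_assoc: "conj_end n f \<Longrightarrow> comp_aut (comp_aut f g) h = comp_aut f (comp_aut g h)"
  by (rule ext) (simp add: comp_aut_apply wapp_comp)

lemma comp_aut_id_right: "conj_end n f \<Longrightarrow> comp_aut f id_aut = f"
  by (rule ext) (simp add: comp_aut_def id_aut_def wapp_single)

lemma wapp_id: "wapp id_aut w = red w"
  by (simp add: wapp_def id_aut_def)

lemma comp_aut_id_left: "conj_end n f \<Longrightarrow> comp_aut id_aut f = f"
  by (rule ext) (simp add: comp_aut_def wapp_id conj_end_red)

lemma Aut0_conj_end: "f \<in> Aut0 n \<Longrightarrow> conj_end n f"
proof (rule conj_endI)
  fix j assume f: "f \<in> Aut0 n"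
  show "j \<notin> {1..n} \<Longrightarrow> f j = [j]" using f unfolding Aut0_def by blast
  assume "j \<in> {1..n}"
  then have "\<exists>w\<in>W n. f j = red (w @ [j] @ rev w)" using f unfolding Aut0_def by blast
  then show "\<exists>w. set w \<subseteq> {1..n} \<and> f j = conj_word w [j]" unfolding W_def conj_word_def by blast
qed

lemma Aut0I:
  assumes f: "conj_end n f" and bij: "bij_betw (wapp f) (W n) (W n)"
  shows "f \<in> Aut0 n"
proof -
  have "\<exists>w\<in>W n. f j = red (w @ [j] @ rev w)" for j
  proof -
    obtain w where w: "set w \<subseteq> {1..n}" "f j = conj_word w [j]" using conj_endD[OF f] by blast
    define r where "r = red w"
    have r: "r \<in> W n" unfolding r_def W_def using w(1) set_red[of w] by auto
    have "f j = conj_word r [j]" by (simp add: r_def w(2) conj_word_red_left)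
    then show ?thesis using r unfolding conj_word_def by blast
  qed
  then show ?thesis using f bij unfolding Aut0_def conj_end_def by blast
qed

lemma wapp_in_W: "conj_end n f \<Longrightarrow> w \<in> W n \<Longrightarrow> wapp f w \<in> W n"
  using set_wapp[of n f w] unfolding W_def by auto

lemma Aut0_of_inverse:
  assumes f: "conj_end n f" and g: "conj_end n g" and fg: "comp_aut f g = id_aut" "comp_aut g f = id_aut"
  shows "f \<in> Aut0 n"
proof (rule Aut0I[OF f])
  have "wapp f (wapp g w) = w" "wapp g (wapp f w) = w" if "w \<in> W n" for w
    using wapp_comp[OF f, of g w] wapp_comp[OF g, of f w] that by (simp_all add: fg wapp_id W_def)
  then show "bij_betw (wapp f) (W n) (W n)"
    by (intro bij_betw_byWitness[of _ "wapp g"]) (auto intro: wapp_in_W f g)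
qed

lemma Aut0_comp: "f \<in> Aut0 n \<Longrightarrow> g \<in> Aut0 n \<Longrightarrow> comp_aut f g \<in> Aut0 n"
proof (rule Aut0I)
  assume fg: "f \<in> Aut0 n" "g \<in> Aut0 n"
  then show "conj_end n (comp_aut f g)" by (simp add: conj_end_comp Aut0_conj_end)
  have "bij_betw (wapp f \<circ> wapp g) (W n) (W n)"
    using fg unfolding Aut0_def by (auto intro: bij_betw_trans)
  moreover have "wapp (comp_aut f g) = wapp f \<circ> wapp g"
    using wapp_comp[OF Aut0_conj_end[OF fg(1)]] by auto
  ultimately show "bij_betw (wapp (comp_aut f g)) (W n) (W n)" by simp
qed

lemma Aut0_id: "id_aut \<in> Aut0 n"
  by (rule Aut0_of_inverse[where g = id_aut]) (simp_all add: conj_end_id comp_aut_id_left[OF conj_end_id])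

section \<open>Inner automorphisms and partial conjugations\<close>

definition inner_aut :: "nat \<Rightarrow> nat list \<Rightarrow> aut" where
  "inner_aut n w = (\<lambda>j. if j \<in> {1..n} then conj_word w [j] else [j])"

lemma Inn_eq: "Inn n = inner_aut n ` W n"
  unfolding Inn_def inner_aut_def conj_word_def by auto

lemma conj_end_inner: "set w \<subseteq> {1..n} \<Longrightarrow> conj_end n (inner_aut n w)"
  by (rule conj_endI) (auto simp: inner_aut_def)

lemma conj_end_pconj: "i \<in> {1..n} \<Longrightarrow> D \<subseteq> {1..n} - {i} \<Longrightarrow> conj_end n (pconj i D)"
proof (rule conj_endI)
  fix j assume a: "i \<in> {1..n}" "D \<subseteq> {1..n} - {i}"
  show "j \<notin> {1..n} \<Longrightarrow> pconj i D j = [j]" using a by (auto simp: pconj_def)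
  show "\<exists>w. set w \<subseteq> {1..n} \<and> pconj i D j = conj_word w [j]"
    by (intro exI[of _ "if j \<in> D then [i] else []"]) (use a in \<open>auto simp: pconj_def conj_word_def\<close>)
qed

lemma wapp_inner: "set w \<subseteq> {1..n} \<Longrightarrow> set u \<subseteq> {1..n} \<Longrightarrow> wapp (inner_aut n w) u = conj_word w u"
proof (induction u)
  case Nil
  then show ?case by (simp add: conj_word_Nil)
next
  case (Cons x u)
  then have "wapp (inner_aut n w) (x # u) = red (conj_word w [x] @ conj_word w u)"
    by (simp add: wapp_Cons inner_aut_def)
  then show ?case using conj_word_append[of w "[x]" u] by simp
qed

lemma comp_inner: "set v \<subseteq> {1..n} \<Longrightarrow> set w \<subseteq> {1..n} \<Longrightarrow> comp_aut (inner_aut n v) (inner_aut n w) = inner_aut n (v @ w)"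
proof (rule ext)
  fix j assume vw: "set v \<subseteq> {1..n}" "set w \<subseteq> {1..n}"
  show "comp_aut (inner_aut n v) (inner_aut n w) j = inner_aut n (v @ w) j"
  proof (cases "j \<in> {1..n}")
    case True
    then have "set (conj_word w [j]) \<subseteq> {1..n}" using set_conj_word[of w "[j]"] vw by auto
    then have "comp_aut (inner_aut n v) (inner_aut n w) j = conj_word v (conj_word w [j])"
      using True vw wapp_inner by (simp add: comp_aut_def inner_aut_def[of n w])
    then show ?thesis using True by (simp add: conj_word_conj_word inner_aut_def)
  next
    case False
    then have "inner_aut n u j = [j]" for u by (auto simp: inner_aut_def)
    then show ?thesis using wapp_single[OF conj_end_inner[OF vw(1)]] by (metis comp_aut_def)
  qed
qed

text \<open>Normality of the inner automorphisms, used to move them past other factors.\<close>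

lemma comp_inner_swap:
  assumes f: "conj_end n f" and w: "set w \<subseteq> {1..n}"
  shows "comp_aut f (inner_aut n w) = comp_aut (inner_aut n (wapp f w)) f"
proof (rule ext)
  fix j
  show "comp_aut f (inner_aut n w) j = comp_aut (inner_aut n (wapp f w)) f j"
  proof (cases "j \<in> {1..n}")
    case True
    then show ?thesis
      using wapp_inner[OF set_wapp[OF f w] set_conj_end[OF f True]]
      by (simp add: comp_aut_def inner_aut_def[of n w] wapp_conj_word[OF f] wapp_single[OF f])
  next
    case False
    then have "inner_aut n u j = [j]" for u by (auto simp: inner_aut_def)
    then show ?thesis
      using conj_end_outside[OF f False] wapp_single[OF f] wapp_single[OF conj_end_inner[OF set_wapp[OF f w]]]
      by (metis comp_aut_def)
  qed
qed

lemma inner_red: "inner_aut n (red w) = inner_aut n w"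
  by (rule ext) (simp add: inner_aut_def conj_word_red_left)

lemma inner_single: "i \<in> {1..n} \<Longrightarrow> inner_aut n [i] = pconj i ({1..n} - {i})"
  by (rule ext) (auto simp: inner_aut_def pconj_def conj_word_def)

section \<open>Carried automorphisms and hypertrees\<close>

text \<open>The condition on walks becomes local. A walk with a single hyperedge gives one
  direction; conversely, induction along a walk that avoids \<open>i\<close> shows that it never
  leaves \<open>D\<close>.\<close>

lemma carries_iff:
  assumes i: "i \<in> {1..n}" and D: "D \<subseteq> {1..n} - {i}"
  shows "carries n \<Theta> i D \<longleftrightarrow> (\<forall>E\<in>\<Theta>. \<forall>x\<in>E \<inter> D. \<forall>y\<in>E \<inter> {1..n}. y \<in> insert i D)"
proof
  assume c: "carries n \<Theta> i D"
  show "\<forall>E\<in>\<Theta>. \<forall>x\<in>E \<inter> D. \<forall>y\<in>E \<inter> {1..n}. y \<in> insert i D"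
  proof (intro ballI, rule ccontr)
    fix E x y assume E: "E \<in> \<Theta>" "x \<in> E \<inter> D" "y \<in> E \<inter> {1..n}" "y \<notin> insert i D"
    then have "walk n \<Theta> [x, y] [E]" using D by (auto simp: walk_def)
    moreover have "y \<in> {1..n} - (D \<union> {i})" "x \<in> D" using E by auto
    ultimately have "i \<in> set [x, y]" using c unfolding carries_def by fastforce
    then show False using E D by auto
  qed
next
  assume r: "\<forall>E\<in>\<Theta>. \<forall>x\<in>E \<inter> D. \<forall>y\<in>E \<inter> {1..n}. y \<in> insert i D"
  show "carries n \<Theta> i D"
    unfolding carries_def
  proof (intro ballI allI impI, rule ccontr)
    fix x j vs es
    assume x: "x \<in> D" and j: "j \<in> {1..n} - (D \<union> {i})"
      and w: "walk n \<Theta> vs es \<and> hd vs = x \<and> last vs = j" and i: "i \<notin> set vs"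
    have len: "length vs = Suc (length es)" and sub: "set vs \<subseteq> {1..n}" "set es \<subseteq> \<Theta>"
      and adj: "\<And>k. k < length es \<Longrightarrow> vs ! k \<in> es ! k \<and> vs ! Suc k \<in> es ! k"
      using w unfolding walk_def by auto
    have "k < length vs \<Longrightarrow> vs ! k \<in> D" for k
    proof (induction k)
      case 0
      have "vs \<noteq> []" using len by auto
      then show ?case using w x by (simp add: hd_conv_nth)
    next
      case (Suc k)
      then have k: "k < length es" using len by simp
      then have "es ! k \<in> \<Theta>" "vs ! Suc k \<in> {1..n}" "vs ! Suc k \<in> set vs"
        using sub Suc.prems by (auto simp: subset_iff)
      moreover have "vs ! k \<in> es ! k \<inter> D" using adj[OF k] Suc.IH k len by simp
      ultimately have "vs ! Suc k \<in> insert i D" using r adj[OF k] by blast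
      then show ?case using i \<open>vs ! Suc k \<in> set vs\<close> by auto
    qed
    moreover have "vs \<noteq> []" using len by auto
    ultimately have "last vs \<in> D" by (simp add: last_conv_nth)
    then show False using w j by auto
  qed
qed

section \<open>The group generated by the partial conjugations that a hypertree carries\<close>

lemma prods_mono: "S \<subseteq> T \<Longrightarrow> prods S \<subseteq> prods T"
proof
  fix f assume "S \<subseteq> T" "f \<in> prods S"
  from this(2,1) show "f \<in> prods T" by induction (auto intro: prods.intros)
qed

lemma conj_end_prods:
  assumes S: "\<And>s. s \<in> S \<Longrightarrow> conj_end n s" and f: "f \<in> prods S"
  shows "conj_end n f"
  using f by induction (simp_all add: conj_end_id conj_end_comp S)

lemma prods_comp:
  assumes S: "\<And>s. s \<in> S \<Longrightarrow> conj_end n s" and f: "f \<in> prods S" and g: "g \<in> prods S"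
  shows "comp_aut f g \<in> prods S"
  using g
proof induction
  case prods_id
  then show ?case using f comp_aut_id_right[OF conj_end_prods[OF S f]] by simp
next
  case (prods_step g s)
  then show ?case
    using comp_aut_assoc[OF conj_end_prods[OF S f], of g s] prods.prods_step by metis
qed

lemma prods_inverse:
  assumes S: "\<And>s. s \<in> S \<Longrightarrow> conj_end n s" "\<And>s. s \<in> S \<Longrightarrow> comp_aut s s = id_aut" and f: "f \<in> prods S"
  shows "\<exists>g\<in>prods S. comp_aut f g = id_aut \<and> comp_aut g f = id_aut"
  using f
proof induction
  case prods_id
  have "comp_aut id_aut id_aut = id_aut" by (rule comp_aut_id_left[OF conj_end_id])
  then show ?case using prods.prods_id by blast
next
  case (prods_step f s)
  then obtain g where g: "g \<in> prods S" "comp_aut f g = id_aut" "comp_aut g f = id_aut" by blast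
  have ce: "conj_end n f" "conj_end n g" "conj_end n s"
    using conj_end_prods[OF S(1)] prods_step g S by blast+
  have s: "s \<in> prods S"
    using prods.prods_step[OF prods.prods_id \<open>s \<in> S\<close>] comp_aut_id_left[OF ce(3)] by simp
  have "comp_aut (comp_aut f s) (comp_aut s g) = comp_aut f (comp_aut (comp_aut s s) g)"
    by (simp only: comp_aut_assoc[OF ce(1)] comp_aut_assoc[OF ce(3)])
  then have 1: "comp_aut (comp_aut f s) (comp_aut s g) = id_aut"
    using S(2)[OF \<open>s \<in> S\<close>] g comp_aut_id_left[OF ce(2)] by simp
  have "comp_aut (comp_aut s g) (comp_aut f s) = comp_aut s (comp_aut (comp_aut g f) s)"
    by (simp only: comp_aut_assoc[OF ce(2)] comp_aut_assoc[OF ce(3)])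
  then have 2: "comp_aut (comp_aut s g) (comp_aut f s) = id_aut"
    using S(2)[OF \<open>s \<in> S\<close>] g comp_aut_id_left[OF ce(3)] by simp
  show ?case using 1 2 prods_comp[OF S(1) s g(1)] by blast
qed

text \<open>For fixed \<open>i\<close> the partial conjugations form an elementary abelian 2-group:
  both factors fix the letter \<open>i\<close>, and conjugating twice by it cancels.\<close>

lemma pconj_comp_pconj:
  assumes "i \<notin> D" "i \<notin> D'"
  shows "comp_aut (pconj i D) (pconj i D') = pconj i (sym_diff D D')"
  using assms by (intro ext) (auto simp: comp_aut_def pconj_def wapp_def)

lemma pconj_empty: "pconj i {} = id_aut"
  by (simp add: pconj_def id_aut_def)

lemma conj_end_carried_pconjs: "s \<in> carried_pconjs n \<Theta> \<Longrightarrow> conj_end n s"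
  unfolding carried_pconjs_def by (auto intro!: conj_end_pconj)

lemma carried_pconjs_involution: "s \<in> carried_pconjs n \<Theta> \<Longrightarrow> comp_aut s s = id_aut"
proof -
  assume "s \<in> carried_pconjs n \<Theta>"
  then obtain i D where "s = pconj i D" "i \<notin> D" unfolding carried_pconjs_def by blast
  then show ?thesis by (simp add: pconj_comp_pconj pconj_empty)
qed

definition Car :: "nat \<Rightarrow> nat set set \<Rightarrow> aut set" where
  "Car n \<Theta> = prods (carried_pconjs n \<Theta>)"

lemma Car_conj_end: "c \<in> Car n \<Theta> \<Longrightarrow> conj_end n c"
  unfolding Car_def by (rule conj_end_prods[OF conj_end_carried_pconjs])

lemma Car_id: "id_aut \<in> Car n \<Theta>"
  unfolding Car_def by (rule prods.prods_id)

lemma Car_comp: "c \<in> Car n \<Theta> \<Longrightarrow> c' \<in> Car n \<Theta> \<Longrightarrow> comp_aut c c' \<in> Car n \<Theta>"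
  unfolding Car_def by (rule prods_comp[OF conj_end_carried_pconjs])

lemma Car_inverse: "c \<in> Car n \<Theta> \<Longrightarrow> \<exists>c'\<in>Car n \<Theta>. comp_aut c c' = id_aut \<and> comp_aut c' c = id_aut"
  unfolding Car_def by (rule prods_inverse[OF conj_end_carried_pconjs carried_pconjs_involution])

lemma Car_Aut0: "c \<in> Car n \<Theta> \<Longrightarrow> c \<in> Aut0 n"
proof -
  assume c: "c \<in> Car n \<Theta>"
  then obtain c' where "c' \<in> Car n \<Theta>" "comp_aut c c' = id_aut" "comp_aut c' c = id_aut"
    using Car_inverse[OF c] by blast
  then show ?thesis using Aut0_of_inverse[of n c c'] Car_conj_end[OF c] Car_conj_end[of c' n \<Theta>] by simp
qed

lemma carried_pconjs_Car: "s \<in> carried_pconjs n \<Theta> \<Longrightarrow> s \<in> Car n \<Theta>"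
  unfolding Car_def
  using prods.prods_step[OF prods.prods_id, of s "carried_pconjs n \<Theta>"]
  by (simp add: comp_aut_id_left[OF conj_end_carried_pconjs])

text \<open>Every hyperedge before the fold lies in one after it, and the local criterion passes
  from a set to its subsets.\<close>

lemma fold1_carried_pconjs: "fold1 \<Lambda> \<Theta> \<Longrightarrow> carried_pconjs n \<Theta> \<subseteq> carried_pconjs n \<Lambda>"
proof
  fix s assume f: "fold1 \<Lambda> \<Theta>" and "s \<in> carried_pconjs n \<Theta>"
  then obtain i D where s: "s = pconj i D" and i: "i \<in> {1..n}" "D \<subseteq> {1..n} - {i}" "D \<noteq> {}"
    and c: "carries n \<Theta> i D" unfolding carried_pconjs_def by blast
  obtain E F where EF: "\<Theta> = (\<Lambda> - {E, F}) \<union> {E \<union> F}" using f unfolding fold1_def by blast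
  have "\<exists>G'\<in>\<Theta>. G \<subseteq> G'" if "G \<in> \<Lambda>" for G
    using that EF by (cases "G = E \<or> G = F") auto
  then have "carries n \<Lambda> i D"
    using c unfolding carries_iff[OF i(1,2)] by (meson IntE IntI subsetD)
  then show "s \<in> carried_pconjs n \<Lambda>" using s i unfolding carried_pconjs_def by blast
qed

lemma Car_mono: "ht_le \<Theta> \<Lambda> \<Longrightarrow> Car n \<Theta> \<subseteq> Car n \<Lambda>"
  unfolding ht_le_def
proof (induction rule: converse_rtrancl_induct)
  case (step \<Lambda> \<Lambda>')
  then show ?case unfolding Car_def using prods_mono[OF fold1_carried_pconjs, of \<Lambda> \<Lambda>' n] by auto
qed simp

section \<open>Relabelling generators and hypertrees\<close>

lemma conjperm_apply: "conjperm \<pi> f j = map \<pi> (f (inv \<pi> j))"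
  by (simp add: conjperm_def)

lemma map_conj_word: "inj \<pi> \<Longrightarrow> map \<pi> (conj_word w u) = conj_word (map \<pi> w) (map \<pi> u)"
  unfolding conj_word_def by (simp add: red_map_inj[symmetric] rev_map)

lemma conj_end_conjperm:
  assumes \<pi>: "\<pi> permutes {1..n}" and f: "conj_end n f"
  shows "conj_end n (conjperm \<pi> f)"
proof (rule conj_endI)
  fix j
  { assume j: "j \<notin> {1..n}"
    then have "inv \<pi> j = j" "\<pi> j = j" using \<pi> permutes_inv permutes_not_in by metis+
    then show "conjperm \<pi> f j = [j]" using conj_end_outside[OF f j] by (simp add: conjperm_apply) }
  obtain w where w: "set w \<subseteq> {1..n}" "f (inv \<pi> j) = conj_word w [inv \<pi> j]" using conj_endD[OF f] by blast
  have "conjperm \<pi> f j = conj_word (map \<pi> w) [j]"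
    unfolding conjperm_apply w(2) using permutes_inj[OF \<pi>] permutes_inverses(1)[OF \<pi>] by (simp add: map_conj_word)
  moreover have "set (map \<pi> w) \<subseteq> {1..n}" using w(1) permutes_in_image[OF \<pi>] by auto
  ultimately show "\<exists>w. set w \<subseteq> {1..n} \<and> conjperm \<pi> f j = conj_word w [j]" by blast
qed

lemma wapp_conjperm:
  assumes \<pi>: "\<pi> permutes S"
  shows "wapp (conjperm \<pi> f) (map \<pi> w) = map \<pi> (wapp f w)"
proof -
  have "concat (map (conjperm \<pi> f) (map \<pi> w)) = map \<pi> (concat (map f w))"
    using permutes_inverses(2)[OF \<pi>] by (induction w) (auto simp: conjperm_apply)
  then show ?thesis unfolding wapp_def using red_map_inj[OF permutes_inj[OF \<pi>]] by simp
qed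

lemma conjperm_comp:
  assumes \<pi>: "\<pi> permutes S"
  shows "conjperm \<pi> (comp_aut f g) = comp_aut (conjperm \<pi> f) (conjperm \<pi> g)"
  by (rule ext) (simp add: conjperm_apply comp_aut_apply wapp_conjperm[OF \<pi>])

lemma conjperm_id: "\<pi> permutes S \<Longrightarrow> conjperm \<pi> id_aut = id_aut"
  by (rule ext) (simp add: conjperm_apply id_aut_def permutes_inverses)

lemma conjperm_pconj:
  assumes \<pi>: "\<pi> permutes S"
  shows "conjperm \<pi> (pconj i D) = pconj (\<pi> i) (\<pi> ` D)"
proof (rule ext)
  fix j
  have "inv \<pi> j \<in> D \<longleftrightarrow> j \<in> \<pi> ` D" using permutes_inverses[OF \<pi>] by (metis imageE imageI)
  then show "conjperm \<pi> (pconj i D) j = pconj (\<pi> i) (\<pi> ` D) j"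
    by (simp add: conjperm_apply pconj_def permutes_inverses[OF \<pi>])
qed

lemma conjperm_Aut0:
  assumes \<pi>: "\<pi> permutes {1..n}" and f: "f \<in> Aut0 n"
  shows "conjperm \<pi> f \<in> Aut0 n"
proof (rule Aut0I)
  show "conj_end n (conjperm \<pi> f)" using \<pi> f conj_end_conjperm Aut0_conj_end by blast
  have inW: "map \<rho> w \<in> W n" if "\<rho> permutes {1..n}" "w \<in> W n" for \<rho> w
    using that red_map_inj[OF permutes_inj, of \<rho> _ w] permutes_in_image[of \<rho> "{1..n}"] unfolding W_def by auto
  have bij: "bij_betw (map \<rho>) (W n) (W n)" if \<rho>: "\<rho> permutes {1..n}" for \<rho>
    by (rule bij_betw_byWitness[of _ "map (inv \<rho>)"])
       (use inW \<rho> permutes_inv[OF \<rho>] permutes_inverses[OF \<rho>] in \<open>auto simp: map_idI\<close>)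
  have "wapp (conjperm \<pi> f) w = (map \<pi> \<circ> (wapp f \<circ> map (inv \<pi>))) w" for w
    using wapp_conjperm[OF \<pi>, of f "map (inv \<pi>) w"] permutes_inverses(1)[OF \<pi>] by (simp add: map_idI)
  moreover have "bij_betw (map \<pi> \<circ> (wapp f \<circ> map (inv \<pi>))) (W n) (W n)"
    using bij[OF \<pi>] bij[OF permutes_inv[OF \<pi>]] f unfolding Aut0_def by (auto intro: bij_betw_trans)
  ultimately show "bij_betw (wapp (conjperm \<pi> f)) (W n) (W n)" by (metis ext)
qed

lemma conjperm_Car:
  assumes \<pi>: "\<pi> permutes {1..n}" and c: "c \<in> Car n \<Theta>"
  shows "conjperm \<pi> c \<in> Car n ((`) \<pi> ` \<Theta>)"
  using c unfolding Car_def
proof induction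
  case prods_id
  then show ?case using prods.prods_id by (simp add: conjperm_id[OF \<pi>])
next
  case (prods_step f s)
  obtain i D where s: "s = pconj i D" and i: "i \<in> {1..n}" "D \<subseteq> {1..n} - {i}" "D \<noteq> {}"
    and c: "carries n \<Theta> i D" using prods_step(2) unfolding carried_pconjs_def by blast
  have \<pi>i: "\<pi> i \<in> {1..n}" "\<pi> ` D \<subseteq> {1..n} - {\<pi> i}" "\<pi> ` D \<noteq> {}"
    using i permutes_in_image[OF \<pi>] permutes_inj[OF \<pi>] by (auto simp: inj_eq)
  have "carries n ((`) \<pi> ` \<Theta>) (\<pi> i) (\<pi> ` D)"
    unfolding carries_iff[OF \<pi>i(1,2)]
  proof (intro ballI)
    fix E x y assume "E \<in> (`) \<pi> ` \<Theta>" "x \<in> E \<inter> \<pi> ` D" "y \<in> E \<inter> {1..n}"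
    then obtain E' x' y' where E: "E' \<in> \<Theta>" "x' \<in> E'" "x' \<in> D" "y' \<in> E'" "y = \<pi> y'"
      using permutes_inj[OF \<pi>] by (auto simp: inj_eq)
    then have "y' \<in> {1..n}" using \<open>y \<in> E \<inter> {1..n}\<close> permutes_in_image[OF \<pi>] by auto
    then have "y' \<in> insert i D" using c E unfolding carries_iff[OF i(1,2)] by blast
    then show "y \<in> insert (\<pi> i) (\<pi> ` D)" using E by auto
  qed
  then have "conjperm \<pi> s \<in> carried_pconjs n ((`) \<pi> ` \<Theta>)"
    using \<pi>i unfolding carried_pconjs_def s conjperm_pconj[OF \<pi>] by blast
  then show ?case using prods_step(3) prods.prods_step by (simp add: conjperm_comp[OF \<pi>])
qed

lemma walk_image:
  assumes \<pi>: "\<pi> permutes {1..n}" and w: "walk n \<Theta> vs es"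
  shows "walk n ((`) \<pi> ` \<Theta>) (map \<pi> vs) (map ((`) \<pi>) es)"
proof -
  have inj: "inj \<pi>" using permutes_inj[OF \<pi>] .
  then have "inj ((`) \<pi>)" by (simp add: inj_image_eq_iff inj_def)
  then have "distinct (map \<pi> vs)" "distinct (map ((`) \<pi>) es)"
    using w inj unfolding walk_def by (auto simp: distinct_map intro: inj_on_subset)
  then show ?thesis using w permutes_in_image[OF \<pi>] unfolding walk_def by auto
qed

lemma hypertree_image:
  assumes \<pi>: "\<pi> permutes {1..n}" and h: "hypertree n \<Theta>"
  shows "hypertree n ((`) \<pi> ` \<Theta>)"
  unfolding hypertree_def
proof (intro conjI ballI)
  fix E assume "E \<in> (`) \<pi> ` \<Theta>"
  then obtain E' where E': "E' \<in> \<Theta>" "E = \<pi> ` E'" by blast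
  show "E \<subseteq> {1..n}" using h E' permutes_in_image[OF \<pi>] unfolding hypertree_def by blast
  have "inj_on \<pi> E'" using permutes_inj[OF \<pi>] by (rule inj_on_subset) simp
  then show "2 \<le> card E" using h E' unfolding hypertree_def by (auto simp: card_image)
next
  fix a b assume ab: "a \<in> {1..n}" "b \<in> {1..n}"
  let ?i = "inv \<pi>"
  have i: "?i permutes {1..n}" using \<pi> by (rule permutes_inv)
  have inv: "?i (\<pi> x) = x" "\<pi> (?i x) = x" for x using permutes_inverses[OF \<pi>] by auto
  have invI: "?i ` \<pi> ` E = E" "\<pi> ` ?i ` E = E" for E by (auto simp: image_image inv)
  have iab: "?i a \<in> {1..n}" "?i b \<in> {1..n}" using ab permutes_in_image[OF i] by auto
  let ?Q = "\<lambda>(vs, es). walk n \<Theta> vs es \<and> hd vs = ?i a \<and> last vs = ?i b"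
  have ex1: "\<exists>!q. ?Q q" using h iab unfolding hypertree_def by blast
  let ?R = "\<lambda>(vs, es). walk n ((`) \<pi> ` \<Theta>) vs es \<and> hd vs = a \<and> last vs = b"
  have ne: "vs \<noteq> []" if "walk n \<Lambda> vs es" for \<Lambda> vs es using that unfolding walk_def by auto
  have QR: "?R (map \<pi> vs, map ((`) \<pi>) es)" if "?Q (vs, es)" for vs es
    using that walk_image[OF \<pi>, of \<Theta> vs es] ne[of \<Theta> vs es] by (auto simp: hd_map last_map inv)
  have RQ: "?Q (map ?i vs, map ((`) ?i) es)" if "?R (vs, es)" for vs es
  proof -
    have "(`) ?i ` (`) \<pi> ` \<Theta> = \<Theta>" by (simp add: image_image invI inv)
    then show ?thesis
      using that walk_image[OF i, of "(`) \<pi> ` \<Theta>" vs es] ne[of "(`) \<pi> ` \<Theta>" vs es] by (auto simp: hd_map last_map)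
  qed
  show "\<exists>!q. ?R q"
  proof (rule ex_ex1I)
    obtain q where "?Q q" using ex1 by blast
    then show "\<exists>q. ?R q" using QR by (cases q) blast
    fix q q' assume q: "?R q" "?R q'"
    obtain vs es vs' es' where e: "q = (vs, es)" "q' = (vs', es')" by (cases q, cases q')
    have "(map ?i vs, map ((`) ?i) es) = (map ?i vs', map ((`) ?i) es')"
      using ex1 RQ q unfolding e by blast
    then have "map \<pi> (map ?i vs) = map \<pi> (map ?i vs')"
      "map ((`) \<pi>) (map ((`) ?i) es) = map ((`) \<pi>) (map ((`) ?i) es')" by simp_all
    then show "q = q'" unfolding e map_map by (simp add: comp_def inv invI)
  qed
qed

lemma HT_image: "\<pi> permutes {1..n} \<Longrightarrow> \<Theta> \<in> HT n \<Longrightarrow> (`) \<pi> ` \<Theta> \<in> HT n"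
  unfolding HT_def using hypertree_image by blast

lemma HT_finite: "\<Theta> \<in> HT n \<Longrightarrow> finite \<Theta>"
proof -
  assume "\<Theta> \<in> HT n"
  then have "\<Theta> \<subseteq> Pow {1..n}" unfolding HT_def hypertree_def by blast
  then show ?thesis by (rule finite_subset) simp
qed

lemma finite_HT: "finite (HT n)"
proof -
  have "HT n \<subseteq> Pow (Pow {1..n})" unfolding HT_def hypertree_def by blast
  then show ?thesis by (rule finite_subset) simp
qed

lemma ht_le_image: "inj \<pi> \<Longrightarrow> ht_le \<Theta> \<Lambda> \<Longrightarrow> ht_le ((`) \<pi> ` \<Theta>) ((`) \<pi> ` \<Lambda>)"
  unfolding ht_le_def
proof (rotate_tac 1, induction rule: rtrancl_induct)
  case (step \<Theta> \<Theta>')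
  obtain E F where EF: "E \<in> \<Theta>" "F \<in> \<Theta>" "E \<noteq> F" "E \<inter> F \<noteq> {}" "\<Theta>' = (\<Theta> - {E, F}) \<union> {E \<union> F}"
    using step(2) unfolding fold1_def by auto
  have inj: "inj ((`) \<pi>)" using \<open>inj \<pi>\<close> by (simp add: inj_image_eq_iff inj_def)
  have "(`) \<pi> ` \<Theta>' = ((`) \<pi> ` \<Theta> - {\<pi> ` E, \<pi> ` F}) \<union> {\<pi> ` E \<union> \<pi> ` F}"
    unfolding EF(5) by (simp add: image_Un image_set_diff[OF inj])
  moreover have "\<pi> ` E \<noteq> \<pi> ` F" using EF(3) inj by (simp add: inj_eq)
  moreover have "\<pi> ` E \<inter> \<pi> ` F \<noteq> {}" using EF(4) by blast
  ultimately have "fold1 ((`) \<pi> ` \<Theta>) ((`) \<pi> ` \<Theta>')"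
    unfolding fold1_def using EF(1,2) by (intro exI[of _ "\<pi> ` E"] exI[of _ "\<pi> ` F"]) auto
  then show ?case using step by (auto intro: rtrancl_into_rtrancl)
qed simp

lemma fold1_card: "finite \<Lambda> \<Longrightarrow> fold1 \<Lambda> \<Theta> \<Longrightarrow> finite \<Theta> \<and> card \<Theta> < card \<Lambda>"
proof -
  assume fin: "finite \<Lambda>" and "fold1 \<Lambda> \<Theta>"
  then obtain E F where EF: "E \<in> \<Lambda>" "F \<in> \<Lambda>" "E \<noteq> F" "\<Theta> = insert (E \<union> F) (\<Lambda> - {E, F})"
    unfolding fold1_def by auto
  have "card (\<Lambda> - {E, F}) = card \<Lambda> - 2" using fin EF by (subst card_Diff_subset) auto
  moreover have "card {E, F} \<le> card \<Lambda>" using fin EF by (intro card_mono) auto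
  moreover have "card \<Theta> \<le> Suc (card (\<Lambda> - {E, F}))" unfolding EF(4) using fin by (intro card_insert_le_m1) auto
  ultimately show ?thesis using EF fin by auto
qed

text \<open>The number of hyperedges grades the order. Later it shows that comparable vertices with
  equally many hyperedges coincide.\<close>

lemma ht_le_card: "ht_le \<Theta> \<Lambda> \<Longrightarrow> finite \<Lambda> \<Longrightarrow> \<Theta> = \<Lambda> \<or> card \<Theta> < card \<Lambda>"
  unfolding ht_le_def
proof (induction rule: converse_rtrancl_induct)
  case (step \<Lambda> \<Lambda>')
  then show ?case using fold1_card[of \<Lambda> \<Lambda>'] by auto
qed simp

section \<open>Vertices and symmetries of McCullough-Miller space\<close>

locale mm_space =
  fixes n :: nat
  assumes n2: "2 \<le> n"
begin

lemma inner_Car: "set w \<subseteq> {1..n} \<Longrightarrow> inner_aut n w \<in> Car n \<Theta>"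
proof (induction w)
  case Nil
  have "inner_aut n [] = id_aut" by (rule ext) (simp add: inner_aut_def id_aut_def conj_word_empty)
  then show ?case by (simp add: Car_id)
next
  case (Cons i w)
  let ?D = "{1..n} - {i}"
  have i: "i \<in> {1..n}" using Cons by simp
  \<comment> \<open>Carried partial conjugations have a nonempty \<open>D\<close>, so the complement
    of \<open>i\<close> must contain a letter.\<close>
  have "(if i = 1 then 2 else 1) \<in> ?D" using n2 by auto
  then have ne: "?D \<noteq> {}" by blast
  have "carries n \<Theta> i ?D" using i by (subst carries_iff) auto
  then have "pconj i ?D \<in> carried_pconjs n \<Theta>" using i ne unfolding carried_pconjs_def by blast
  then have "inner_aut n [i] \<in> Car n \<Theta>" using carried_pconjs_Car by (simp add: inner_single[OF i])
  moreover have "inner_aut n (i # w) = comp_aut (inner_aut n [i]) (inner_aut n w)" using Cons by (subst comp_inner) auto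
  ultimately show ?case using Cons Car_comp by simp
qed

text \<open>Since \<open>x\<^bsub>i,D\<^esub>\<close> with \<open>D\<close> the complement of \<open>i\<close> is carried by every hypertree, inner automorphisms
  need no separate treatment.\<close>

lemma carried_iff: "carried n \<Theta> c \<longleftrightarrow> c \<in> Car n \<Theta>"
proof
  assume "carried n \<Theta> c"
  then obtain p \<iota> where p: "p \<in> Car n \<Theta>" "\<iota> \<in> Inn n" "c = comp_aut p \<iota>" unfolding carried_def Car_def by blast
  then obtain w where "\<iota> = inner_aut n w" "w \<in> W n" unfolding Inn_eq by blast
  then have "\<iota> \<in> Car n \<Theta>" using inner_Car by (simp add: W_def)
  then show "c \<in> Car n \<Theta>" using p Car_comp by blast
next
  assume c: "c \<in> Car n \<Theta>"
  have "inner_aut n [] = id_aut" by (rule ext) (simp add: inner_aut_def id_aut_def conj_word_empty)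
  moreover have "[] \<in> W n" by (simp add: W_def)
  ultimately have "id_aut \<in> Inn n" unfolding Inn_eq by force
  moreover have "c = comp_aut c id_aut" using comp_aut_id_right[OF Car_conj_end[OF c]] by simp
  ultimately show "carried n \<Theta> c" using c unfolding carried_def Car_def by blast
qed

section \<open>Vertices, order and action expressed through representatives\<close>

definition V :: "aut \<Rightarrow> nat set set \<Rightarrow> vtx" where
  "V \<alpha> \<Theta> = mm_class n (\<alpha>, \<Theta>)"

lemma V_in_Verts [simp]: "\<alpha> \<in> Aut0 n \<Longrightarrow> \<Theta> \<in> HT n \<Longrightarrow> V \<alpha> \<Theta> \<in> Verts n"
  unfolding Verts_def V_def by blast

lemma VertsE: "v \<in> Verts n \<Longrightarrow> (\<And>\<alpha> \<Theta>. v = V \<alpha> \<Theta> \<Longrightarrow> \<alpha> \<in> Aut0 n \<Longrightarrow> \<Theta> \<in> HT n \<Longrightarrow> thesis) \<Longrightarrow> thesis"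
  unfolding Verts_def V_def by blast

lemma mem_V: "\<alpha> \<in> Aut0 n \<Longrightarrow> \<Theta> \<in> HT n \<Longrightarrow>
    (\<beta>, \<Lambda>) \<in> V \<alpha> \<Theta> \<longleftrightarrow> \<Lambda> = \<Theta> \<and> (\<exists>c\<in>Car n \<Theta>. \<beta> = comp_aut \<alpha> c)"
  unfolding V_def mm_class_def mm_rel_def carried_iff
  using Aut0_comp Car_Aut0 by auto

lemma V_self: "\<alpha> \<in> Aut0 n \<Longrightarrow> \<Theta> \<in> HT n \<Longrightarrow> (\<alpha>, \<Theta>) \<in> V \<alpha> \<Theta>"
  unfolding mem_V by (intro conjI refl bexI[OF _ Car_id]) (erule comp_aut_id_right[OF Aut0_conj_end, symmetric])

lemma V_eq_iff:
  assumes a: "\<alpha> \<in> Aut0 n" "\<Theta> \<in> HT n" and b: "\<beta> \<in> Aut0 n" "\<Lambda> \<in> HT n"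
  shows "V \<alpha> \<Theta> = V \<beta> \<Lambda> \<longleftrightarrow> \<Theta> = \<Lambda> \<and> (\<exists>c\<in>Car n \<Theta>. \<beta> = comp_aut \<alpha> c)"
proof
  assume e: "V \<alpha> \<Theta> = V \<beta> \<Lambda>"
  have "(\<beta>, \<Lambda>) \<in> V \<beta> \<Lambda>" using b by (rule V_self)
  then show "\<Theta> = \<Lambda> \<and> (\<exists>c\<in>Car n \<Theta>. \<beta> = comp_aut \<alpha> c)" using mem_V[OF a] e by auto
next
  assume "\<Theta> = \<Lambda> \<and> (\<exists>c\<in>Car n \<Theta>. \<beta> = comp_aut \<alpha> c)"
  then obtain c where e: "\<Theta> = \<Lambda>" and c: "c \<in> Car n \<Theta>" "\<beta> = comp_aut \<alpha> c" by blast
  obtain c' where c': "c' \<in> Car n \<Theta>" "comp_aut c c' = id_aut" using Car_inverse[OF c(1)] by blast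
  have ce: "conj_end n \<alpha>" using Aut0_conj_end[OF a(1)] .
  have \<alpha>: "comp_aut \<beta> c' = \<alpha>" using c(2) c'(2) comp_aut_assoc[OF ce] comp_aut_id_right[OF ce] by simp
  have "(\<exists>d\<in>Car n \<Theta>. \<gamma> = comp_aut \<alpha> d) \<longleftrightarrow> (\<exists>d\<in>Car n \<Theta>. \<gamma> = comp_aut \<beta> d)" for \<gamma>
  proof
    assume "\<exists>d\<in>Car n \<Theta>. \<gamma> = comp_aut \<alpha> d"
    then obtain d where "d \<in> Car n \<Theta>" "\<gamma> = comp_aut \<alpha> d" by blast
    then have "\<gamma> = comp_aut \<beta> (comp_aut c' d)" "comp_aut c' d \<in> Car n \<Theta>"
      using \<alpha> comp_aut_assoc[OF Aut0_conj_end[OF b(1)], of c' d] Car_comp c'(1) by auto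
    then show "\<exists>d\<in>Car n \<Theta>. \<gamma> = comp_aut \<beta> d" by blast
  next
    assume "\<exists>d\<in>Car n \<Theta>. \<gamma> = comp_aut \<beta> d"
    then obtain d where "d \<in> Car n \<Theta>" "\<gamma> = comp_aut \<beta> d" by blast
    then have "\<gamma> = comp_aut \<alpha> (comp_aut c d)" "comp_aut c d \<in> Car n \<Theta>"
      using c comp_aut_assoc[OF ce, of c d] Car_comp by auto
    then show "\<exists>d\<in>Car n \<Theta>. \<gamma> = comp_aut \<alpha> d" by blast
  qed
  then have "(\<gamma>, \<Xi>) \<in> V \<alpha> \<Theta> \<longleftrightarrow> (\<gamma>, \<Xi>) \<in> V \<beta> \<Lambda>" for \<gamma> \<Xi>
    unfolding mem_V[OF a] mem_V[OF b] using e by simp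
  then show "V \<alpha> \<Theta> = V \<beta> \<Lambda>" by (intro set_eqI) (metis surj_pair)
qed

lemma mm_le_iff: "mm_le n u v \<longleftrightarrow> (\<exists>\<alpha> \<Theta> \<beta> \<Lambda> c. (\<alpha>, \<Theta>) \<in> u \<and> (\<beta>, \<Lambda>) \<in> v \<and> ht_le \<Theta> \<Lambda>
    \<and> c \<in> Car n \<Lambda> \<and> \<beta> = comp_aut \<alpha> c)"
  by (simp add: mm_le_def carried_iff Bex_def)

lemma mm_leI:
  "(\<alpha>, \<Theta>) \<in> u \<Longrightarrow> (\<beta>, \<Lambda>) \<in> v \<Longrightarrow> ht_le \<Theta> \<Lambda> \<Longrightarrow> c \<in> Car n \<Lambda> \<Longrightarrow> \<beta> = comp_aut \<alpha> c \<Longrightarrow> mm_le n u v"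
  unfolding mm_le_iff by (intro exI conjI)

lemma mm_le_V:
  assumes a: "\<alpha> \<in> Aut0 n" "\<Theta> \<in> HT n" and b: "\<beta> \<in> Aut0 n" "\<Lambda> \<in> HT n"
  shows "mm_le n (V \<alpha> \<Theta>) (V \<beta> \<Lambda>) \<longleftrightarrow> ht_le \<Theta> \<Lambda> \<and> (\<exists>c\<in>Car n \<Lambda>. \<beta> = comp_aut \<alpha> c)"
proof
  assume "mm_le n (V \<alpha> \<Theta>) (V \<beta> \<Lambda>)"
  then obtain \<alpha>' \<Theta>' \<beta>' \<Lambda>' c where m: "(\<alpha>', \<Theta>') \<in> V \<alpha> \<Theta>" "(\<beta>', \<Lambda>') \<in> V \<beta> \<Lambda>" "ht_le \<Theta>' \<Lambda>'"
    and c: "c \<in> Car n \<Lambda>'" "\<beta>' = comp_aut \<alpha>' c"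
    unfolding mm_le_iff by (elim exE conjE) (rule that)
  obtain c1 where c1: "\<Theta>' = \<Theta>" "c1 \<in> Car n \<Theta>" "\<alpha>' = comp_aut \<alpha> c1" using m(1) unfolding mem_V[OF a] by blast
  obtain c2 where c2: "\<Lambda>' = \<Lambda>" "c2 \<in> Car n \<Lambda>" "\<beta>' = comp_aut \<beta> c2" using m(2) unfolding mem_V[OF b] by blast
  have le: "ht_le \<Theta> \<Lambda>" using m c1 c2 by simp
  obtain d where d: "d \<in> Car n \<Lambda>" "comp_aut c2 d = id_aut" using Car_inverse[OF c2(2)] by blast
  have ce: "conj_end n \<alpha>" "conj_end n \<beta>" using Aut0_conj_end a b by auto
  have "comp_aut (comp_aut \<beta> c2) d = \<beta>" using d comp_aut_assoc[OF ce(2)] comp_aut_id_right[OF ce(2)] by simp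
  then have "\<beta> = comp_aut (comp_aut (comp_aut \<alpha> c1) c) d" using c c1 c2 by simp
  also have "\<dots> = comp_aut \<alpha> (comp_aut c1 (comp_aut c d))"
    unfolding comp_aut_assoc[OF ce(1)] comp_aut_assoc[OF Car_conj_end[OF c1(2)]] ..
  finally have "\<beta> = comp_aut \<alpha> (comp_aut c1 (comp_aut c d))" .
  \<comment> \<open>What the coarser hypertree carries is carried by the finer one, so a change of
    representative of the lower vertex is absorbed into \<open>Car n \<Lambda>\<close>.\<close>
  moreover have "c1 \<in> Car n \<Lambda>" using Car_mono[OF le] c1(2) by blast
  then have "comp_aut c1 (comp_aut c d) \<in> Car n \<Lambda>" using Car_comp c(1) c2(1) d(1) by simp
  ultimately show "ht_le \<Theta> \<Lambda> \<and> (\<exists>c\<in>Car n \<Lambda>. \<beta> = comp_aut \<alpha> c)" using le by blast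
next
  assume r: "ht_le \<Theta> \<Lambda> \<and> (\<exists>c\<in>Car n \<Lambda>. \<beta> = comp_aut \<alpha> c)"
  have "(\<alpha>, \<Theta>) \<in> V \<alpha> \<Theta>" "(\<beta>, \<Lambda>) \<in> V \<beta> \<Lambda>" using V_self a b by auto
  moreover obtain c where "c \<in> Car n \<Lambda>" "\<beta> = comp_aut \<alpha> c" using r by blast
  ultimately show "mm_le n (V \<alpha> \<Theta>) (V \<beta> \<Lambda>)" using r mm_leI by metis
qed

lemma mm_le_same_card:
  assumes a: "\<alpha> \<in> Aut0 n" "\<Theta> \<in> HT n" and b: "\<beta> \<in> Aut0 n" "\<Lambda> \<in> HT n"
    and le: "mm_le n (V \<alpha> \<Theta>) (V \<beta> \<Lambda>)" and card: "card \<Theta> = card \<Lambda>"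
  shows "V \<alpha> \<Theta> = V \<beta> \<Lambda>"
proof -
  have "ht_le \<Theta> \<Lambda>" and c: "\<exists>c\<in>Car n \<Lambda>. \<beta> = comp_aut \<alpha> c" using le unfolding mm_le_V[OF a b] by auto
  then have "\<Theta> = \<Lambda>" using ht_le_card[of \<Theta> \<Lambda>] HT_finite[OF b(2)] card by simp
  then show ?thesis using c unfolding V_eq_iff[OF a b] by simp
qed

text \<open>Another choice of representative by \<open>SOME\<close> multiplies the marking by some
  \<open>c\<close> in \<open>Car n \<Theta>\<close>; relabelled, \<open>c\<close> is carried by the
  relabelled hypertree, so the class stays the same.\<close>

lemma act_V:
  assumes \<phi>: "\<phi> \<in> Aut0 n" and \<pi>: "\<pi> permutes {1..n}" and a: "\<alpha> \<in> Aut0 n" "\<Theta> \<in> HT n"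
  shows "act n (\<phi>, \<pi>) (V \<alpha> \<Theta>) = V (comp_aut \<phi> (conjperm \<pi> \<alpha>)) ((`) \<pi> ` \<Theta>)"
proof -
  have "(SOME q. q \<in> V \<alpha> \<Theta>) \<in> V \<alpha> \<Theta>" using V_self[OF a] by (rule someI)
  then obtain \<alpha>' where s: "(SOME q. q \<in> V \<alpha> \<Theta>) = (\<alpha>', \<Theta>)" and "(\<alpha>', \<Theta>) \<in> V \<alpha> \<Theta>"
    using mem_V[OF a] by (metis surj_pair)
  then obtain c where c: "c \<in> Car n \<Theta>" "\<alpha>' = comp_aut \<alpha> c" using mem_V[OF a] by blast
  have \<phi>\<alpha>: "comp_aut \<phi> (conjperm \<pi> \<alpha>) \<in> Aut0 n" using Aut0_comp \<phi> conjperm_Aut0[OF \<pi> a(1)] by blast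
  have e: "comp_aut \<phi> (conjperm \<pi> \<alpha>') = comp_aut (comp_aut \<phi> (conjperm \<pi> \<alpha>)) (conjperm \<pi> c)"
    unfolding c(2) conjperm_comp[OF \<pi>] using comp_aut_assoc[OF Aut0_conj_end[OF \<phi>]] by simp
  have "V (comp_aut \<phi> (conjperm \<pi> \<alpha>)) ((`) \<pi> ` \<Theta>) = V (comp_aut \<phi> (conjperm \<pi> \<alpha>')) ((`) \<pi> ` \<Theta>)"
  proof (subst V_eq_iff)
    show "comp_aut \<phi> (conjperm \<pi> \<alpha>') \<in> Aut0 n"
      unfolding e using Aut0_comp \<phi>\<alpha> Car_Aut0 conjperm_Car[OF \<pi> c(1)] by blast
  qed (use \<phi>\<alpha> HT_image[OF \<pi> a(2)] e conjperm_Car[OF \<pi> c(1)] in auto)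
  then show ?thesis using a by (simp add: act_def s act_pair_def V_def[of "comp_aut \<phi> (conjperm \<pi> \<alpha>')"])
qed

text \<open>All symmetries used below are involutions; restricting to these avoids proving that
  \<open>act\<close> is a group action.\<close>

definition involutive :: "aut \<times> (nat \<Rightarrow> nat) \<Rightarrow> bool" where
  "involutive g \<longleftrightarrow> fst g \<in> Aut0 n \<and> snd g permutes {1..n} \<and> snd g \<circ> snd g = id
      \<and> comp_aut (fst g) (conjperm (snd g) (fst g)) = id_aut"

lemma act_in_Verts:
  assumes g: "involutive g" and v: "v \<in> Verts n"
  shows "act n g v \<in> Verts n"
proof -
  obtain \<phi> \<pi> where e: "g = (\<phi>, \<pi>)" by (cases g)
  have g': "\<phi> \<in> Aut0 n" "\<pi> permutes {1..n}" using g e by (auto simp: involutive_def)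
  obtain \<alpha> \<Theta> where V: "v = V \<alpha> \<Theta>" and a: "\<alpha> \<in> Aut0 n" "\<Theta> \<in> HT n" using VertsE[OF v] by blast
  show ?thesis unfolding e V act_V[OF g' a]
    using g' a by (intro V_in_Verts Aut0_comp conjperm_Aut0 HT_image)
qed

lemma act_act:
  assumes g: "involutive g"
  shows "act n g (act n g v) = v"
proof (cases "v \<in> Verts n")
  case True
  obtain \<phi> \<pi> where e: "g = (\<phi>, \<pi>)" by (cases g)
  have g': "\<phi> \<in> Aut0 n" "\<pi> permutes {1..n}" and \<pi>\<pi>: "\<And>x. \<pi> (\<pi> x) = x"
    and \<phi>\<phi>: "comp_aut \<phi> (conjperm \<pi> \<phi>) = id_aut"
    using g e by (auto simp: involutive_def fun_eq_iff)
  obtain \<alpha> \<Theta> where V: "v = V \<alpha> \<Theta>" and a: "\<alpha> \<in> Aut0 n" "\<Theta> \<in> HT n" using VertsE[OF True] by blast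
  have b: "comp_aut \<phi> (conjperm \<pi> \<alpha>) \<in> Aut0 n" "(`) \<pi> ` \<Theta> \<in> HT n"
    using g' a Aut0_comp conjperm_Aut0 HT_image by auto
  have inv: "inv \<pi> = \<pi>" using \<pi>\<pi> by (intro inv_equality) auto
  have cc: "conjperm \<pi> (conjperm \<pi> \<alpha>) = \<alpha>"
    by (rule ext) (simp add: conjperm_apply inv \<pi>\<pi> comp_def)
  have "comp_aut \<phi> (conjperm \<pi> (comp_aut \<phi> (conjperm \<pi> \<alpha>))) = comp_aut (comp_aut \<phi> (conjperm \<pi> \<phi>)) \<alpha>"
    unfolding conjperm_comp[OF g'(2)] cc using comp_aut_assoc[OF Aut0_conj_end[OF g'(1)]] by simp
  also have "\<dots> = \<alpha>" unfolding \<phi>\<phi> by (rule comp_aut_id_left[OF Aut0_conj_end[OF a(1)]])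
  finally show ?thesis
    unfolding e V act_V[OF g' a] act_V[OF g' b] by (simp add: image_image \<pi>\<pi>)
qed (simp add: act_def)

lemma act_mm_le:
  assumes g: "involutive g" and uv: "u \<in> Verts n" "v \<in> Verts n" and le: "mm_le n u v"
  shows "mm_le n (act n g u) (act n g v)"
proof -
  obtain \<phi> \<pi> where e: "g = (\<phi>, \<pi>)" by (cases g)
  have g': "\<phi> \<in> Aut0 n" "\<pi> permutes {1..n}" using g e by (auto simp: involutive_def)
  obtain \<alpha> \<Theta> where u: "u = V \<alpha> \<Theta>" and a: "\<alpha> \<in> Aut0 n" "\<Theta> \<in> HT n" using VertsE[OF uv(1)] by blast
  obtain \<beta> \<Lambda> where v: "v = V \<beta> \<Lambda>" and b: "\<beta> \<in> Aut0 n" "\<Lambda> \<in> HT n" using VertsE[OF uv(2)] by blast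
  have A: "comp_aut \<phi> (conjperm \<pi> \<alpha>) \<in> Aut0 n" "(`) \<pi> ` \<Theta> \<in> HT n"
    and B: "comp_aut \<phi> (conjperm \<pi> \<beta>) \<in> Aut0 n" "(`) \<pi> ` \<Lambda> \<in> HT n"
    using g' a b Aut0_comp conjperm_Aut0 HT_image by auto
  obtain c where c: "ht_le \<Theta> \<Lambda>" "c \<in> Car n \<Lambda>" "\<beta> = comp_aut \<alpha> c"
    using le unfolding u v mm_le_V[OF a b] by blast
  have "comp_aut \<phi> (conjperm \<pi> \<beta>) = comp_aut (comp_aut \<phi> (conjperm \<pi> \<alpha>)) (conjperm \<pi> c)"
    unfolding c(3) conjperm_comp[OF g'(2)] using comp_aut_assoc[OF Aut0_conj_end[OF g'(1)]] by simp
  then show ?thesis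
    unfolding u v e act_V[OF g' a] act_V[OF g' b] mm_le_V[OF A B]
    using ht_le_image[OF permutes_inj[OF g'(2)] c(1)] conjperm_Car[OF g'(2) c(2)] by blast
qed

lemma act_bij: "involutive g \<Longrightarrow> bij (act n g)"
  using act_act by (intro bij_betw_byWitness[of _ "act n g"]) auto

lemma act_simplex:
  assumes g: "involutive g" and s: "\<sigma> \<in> simplices n"
  shows "act n g ` \<sigma> \<in> simplices n"
proof -
  have \<sigma>: "finite \<sigma>" "\<sigma> \<noteq> {}" "\<sigma> \<subseteq> Verts n" "\<And>u v. u \<in> \<sigma> \<Longrightarrow> v \<in> \<sigma> \<Longrightarrow> mm_le n u v \<or> mm_le n v u"
    using s unfolding simplices_def by auto
  have "mm_le n (act n g u) (act n g v) \<or> mm_le n (act n g v) (act n g u)" if "u \<in> \<sigma>" "v \<in> \<sigma>" for u v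
    using \<sigma>(4)[OF that] act_mm_le[OF g, of u v] act_mm_le[OF g, of v u] \<sigma>(3) that by blast
  then show ?thesis using \<sigma>(1-3) act_in_Verts[OF g] unfolding simplices_def by blast
qed

text \<open>Precomposition is the action of the inverse on barycentric coordinates. For an
  involution this is the action itself, so vertices move by \<open>act n g\<close>.\<close>

definition T :: "aut \<times> (nat \<Rightarrow> nat) \<Rightarrow> pt \<Rightarrow> pt" where
  "T g x = x \<circ> act n g"

lemma supp_T: "involutive g \<Longrightarrow> supp (T g x) = act n g ` supp x"
proof -
  assume g: "involutive g"
  have "v \<in> act n g ` supp x" if "act n g v \<in> supp x" for v
    using imageI[OF that, of "act n g"] by (simp add: act_act[OF g])
  then show ?thesis by (auto simp: supp_def T_def act_act[OF g])
qed

lemma T_Pts: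
  assumes g: "involutive g" and x: "x \<in> Pts n"
  shows "T g x \<in> Pts n"
proof -
  have "sum (T g x) (supp (T g x)) = sum x (supp x)"
    unfolding supp_T[OF g] using act_bij[OF g]
    by (subst sum.reindex) (auto simp: T_def act_act[OF g] bij_def intro: inj_on_subset)
  then show ?thesis using x act_simplex[OF g] supp_T[OF g] unfolding Pts_def by (auto simp: T_def)
qed

lemma T_T: "involutive g \<Longrightarrow> T g (T g x) = x"
  unfolding T_def by (rule ext) (simp add: act_act)

lemma T_dist:
  assumes "equivariant n ds" "involutive g" "x \<in> Pts n" "y \<in> Pts n"
  shows "len_dist n ds (T g x) (T g y) = len_dist n ds x y"
proof -
  obtain \<phi> \<pi> where e: "g = (\<phi>, \<pi>)" by (cases g)
  then have g': "\<phi> \<in> Aut0 n" "\<pi> permutes {1..n}" using assms by (auto simp: involutive_def)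
  show ?thesis using assms(1,3,4) g' unfolding equivariant_def T_def e by blast
qed

text \<open>The action preserves the number of hyperedges, which distinguishes the vertices of a
  simplex. A simplex mapped to itself is therefore fixed vertex by vertex, and fixed points can be
  found by inspecting vertices alone.\<close>

lemma T_fixed_vertex:
  assumes g: "involutive g" and x: "x \<in> Pts n" "T g x = x" and v: "v \<in> supp x"
  shows "act n g v = v"
proof -
  obtain \<phi> \<pi> where e: "g = (\<phi>, \<pi>)" by (cases g)
  have g': "\<phi> \<in> Aut0 n" "\<pi> permutes {1..n}" using g e by (auto simp: involutive_def)
  have s: "supp x \<in> simplices n" using x by (simp add: Pts_def)
  then have vV: "v \<in> Verts n" using v by (auto simp: simplices_def)
  have w: "act n g v \<in> supp x" using supp_T[OF g, of x] x v by auto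
  obtain \<alpha> \<Theta> where V: "v = V \<alpha> \<Theta>" and a: "\<alpha> \<in> Aut0 n" "\<Theta> \<in> HT n" using VertsE[OF vV] by blast
  have b: "comp_aut \<phi> (conjperm \<pi> \<alpha>) \<in> Aut0 n" "(`) \<pi> ` \<Theta> \<in> HT n"
    using g' a Aut0_comp conjperm_Aut0 HT_image by auto
  have gv: "act n g v = V (comp_aut \<phi> (conjperm \<pi> \<alpha>)) ((`) \<pi> ` \<Theta>)" unfolding V e by (rule act_V[OF g' a])
  have "inj ((`) \<pi>)" using permutes_inj[OF g'(2)] by (simp add: inj_image_eq_iff inj_def)
  then have card: "card ((`) \<pi> ` \<Theta>) = card \<Theta>" by (intro card_image) (auto intro: inj_on_subset)
  have "mm_le n v (act n g v) \<or> mm_le n (act n g v) v" using s v w unfolding simplices_def by blast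
  then show ?thesis
    using mm_le_same_card[OF a b] mm_le_same_card[OF b a] card unfolding V[symmetric] gv[symmetric] by metis
qed

definition pnt :: "vtx \<Rightarrow> pt" where
  "pnt v = (\<lambda>u. if u = v then 1 else 0)"

lemma supp_pnt [simp]: "supp (pnt v) = {v}"
  by (auto simp: supp_def pnt_def)

lemma ht_le_refl: "ht_le \<Theta> \<Theta>"
  by (simp add: ht_le_def)

lemma mm_le_refl: "v \<in> Verts n \<Longrightarrow> mm_le n v v"
proof (erule VertsE)
  fix \<alpha> \<Theta> assume v: "v = V \<alpha> \<Theta>" and a: "\<alpha> \<in> Aut0 n" "\<Theta> \<in> HT n"
  have "\<alpha> = comp_aut \<alpha> id_aut" using comp_aut_id_right[OF Aut0_conj_end[OF a(1)]] by simp
  then show ?thesis unfolding v mm_le_V[OF a a] using ht_le_refl Car_id by blast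
qed

lemma pnt_Pts: "v \<in> Verts n \<Longrightarrow> pnt v \<in> Pts n"
  using mm_le_refl[of v] by (simp add: Pts_def simplices_def) (simp add: pnt_def)

lemma T_pnt: "involutive g \<Longrightarrow> T g (pnt v) = pnt (act n g v)"
proof (rule ext)
  fix u assume g: "involutive g"
  have "act n g u = v \<longleftrightarrow> u = act n g v" using act_act[OF g] by metis
  then show "T g (pnt v) u = pnt (act n g v) u" by (simp add: T_def pnt_def)
qed

lemma supp_single_eq_pnt: "x \<in> Pts n \<Longrightarrow> supp x \<subseteq> {v} \<Longrightarrow> x = pnt v"
proof -
  assume x: "x \<in> Pts n" "supp x \<subseteq> {v}"
  then have s: "supp x = {v}" unfolding Pts_def simplices_def by auto
  then have "x v = 1" using x unfolding Pts_def by auto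
  show ?thesis
  proof (rule ext)
    fix u
    have "x u \<noteq> 0 \<longleftrightarrow> u = v" using s by (auto simp: supp_def)
    then show "x u = pnt v u" using \<open>x v = 1\<close> by (auto simp: pnt_def)
  qed
qed

end

section \<open>Hypertrees on four vertices\<close>

lemma walk_single: "walk n \<Theta> [a] es \<longleftrightarrow> es = [] \<and> a \<in> {1..n}"
  by (auto simp: walk_def)

lemma all_less_Suc_split: "(\<forall>k<Suc m. P k) \<longleftrightarrow> P 0 \<and> (\<forall>k<m. P (Suc k))"
  by (auto simp: less_Suc_eq_0_disj)

lemma walk_Cons2:
  "walk n \<Theta> (a # b # vs) es \<longleftrightarrow> (\<exists>e es'. es = e # es' \<and> a \<in> {1..n} \<and> a \<notin> set (b # vs) \<and> e \<in> \<Theta> \<and> e \<notin> set es'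
     \<and> a \<in> e \<and> b \<in> e \<and> walk n \<Theta> (b # vs) es')"
proof (cases es)
  case (Cons e es')
  show ?thesis unfolding walk_def Cons by (auto simp: all_less_Suc_split)
qed (auto simp: walk_def)

lemma walk_length: "walk n \<Theta> vs es \<Longrightarrow> length vs \<le> n"
proof -
  assume "walk n \<Theta> vs es"
  then have "distinct vs" "set vs \<subseteq> {1..n}" by (auto simp: walk_def)
  then show ?thesis using card_mono[of "{1..n}" "set vs"] by (simp add: distinct_card)
qed

lemma vertices4: "{1..4::nat} = {1, 2, 3, 4}"
  by auto

text \<open>\<open>F a b\<close> tabulates the walk from a to b. Uniqueness is phrased for an
  arbitrary walk and its own endpoints, so that it can be checked by running through the possible
  shapes of walks.\<close>

lemma hypertreeI:
  fixes F :: "nat \<Rightarrow> nat \<Rightarrow> nat list \<times> nat set list"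
  assumes edges: "\<And>E. E \<in> \<Theta> \<Longrightarrow> E \<subseteq> {1..n} \<and> 2 \<le> card E"
    and ex: "\<And>a b. a \<in> {1..n} \<Longrightarrow> b \<in> {1..n} \<Longrightarrow>
        walk n \<Theta> (fst (F a b)) (snd (F a b)) \<and> hd (fst (F a b)) = a \<and> last (fst (F a b)) = b"
    and uniq: "\<And>vs es. walk n \<Theta> vs es \<Longrightarrow> (vs, es) = F (hd vs) (last vs)"
  shows "\<Theta> \<in> HT n"
  unfolding HT_def hypertree_def mem_Collect_eq
proof (intro conjI ballI)
  fix a b assume ab: "a \<in> {1..n}" "b \<in> {1..n}"
  show "\<exists>!(vs, es). walk n \<Theta> vs es \<and> hd vs = a \<and> last vs = b"
  proof (rule ex1I[of _ "F a b"])
    show "case F a b of (vs, es) \<Rightarrow> walk n \<Theta> vs es \<and> hd vs = a \<and> last vs = b"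
      using ex[OF ab] by (simp add: case_prod_beta)
  next
    fix q assume "case q of (vs, es) \<Rightarrow> walk n \<Theta> vs es \<and> hd vs = a \<and> last vs = b"
    then show "q = F a b" using uniq[of "fst q" "snd q"] by (simp add: case_prod_beta)
  qed
qed (use edges in auto)

definition H0 :: "nat set set" where "H0 = {{1, 2, 3, 4}}"
definition Pth :: "nat set set" where "Pth = {{1, 2}, {2, 3}, {3, 4}}"
definition Str :: "nat set set" where "Str = {{1, 2}, {2, 3}, {2, 4}}"

lemma walk4_cases:
  assumes w: "walk 4 \<Theta> vs es"
  obtains a where "vs = [a]" "es = []"
  | a b e where "vs = [a, b]" "es = [e]"
  | a b c e f where "vs = [a, b, c]" "es = [e, f]"
  | a b c d e f g where "vs = [a, b, c, d]" "es = [e, f, g]"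
proof -
  have l: "length vs \<le> 4" "length vs = Suc (length es)"
    using walk_length[OF w] w by (auto simp: walk_def)
  then consider "length vs = 1" | "length vs = 2" | "length vs = 3" | "length vs = 4" by linarith
  then show ?thesis
  proof cases
    case 1
    then show ?thesis using l that(1) by (auto simp: length_Suc_conv)
  next
    case 2
    then have "length es = Suc 0" using l by simp
    then show ?thesis using 2 that(2) by (auto simp: length_Suc_conv numeral_eq_Suc)
  next
    case 3
    then have "length es = Suc (Suc 0)" using l by simp
    then show ?thesis using 3 that(3) by (auto simp: length_Suc_conv numeral_eq_Suc)
  next
    case 4
    then have "length es = Suc (Suc (Suc 0))" using l by simp
    then show ?thesis using 4 that(4) by (auto simp: length_Suc_conv numeral_eq_Suc)
  qed
qed

lemmas walk_simps = walk_single walk_Cons2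

lemma H0_HT: "H0 \<in> HT 4"
proof (rule hypertreeI)
  let ?F = "\<lambda>a b :: nat. if a = b then ([a], []) else ([a, b], [{1,2,3,4}])"
  show "walk 4 H0 (fst (?F a b)) (snd (?F a b)) \<and> hd (fst (?F a b)) = a \<and> last (fst (?F a b)) = b"
    if "a \<in> {1..4}" "b \<in> {1..4}" for a b
    using that by (auto simp: walk_simps H0_def)
  show "(vs, es) = ?F (hd vs) (last vs)" if w: "walk 4 H0 vs es" for vs es
    using w by (cases rule: walk4_cases) (use w in \<open>auto simp: walk_simps H0_def\<close>)
qed (auto simp: H0_def)

lemma Str_HT: "Str \<in> HT 4"
proof (rule hypertreeI)
  let ?F = "\<lambda>a b :: nat. if a = b then ([a], []) else if a = 2 \<or> b = 2 then ([a, b], [{a, b}])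
      else ([a, 2, b], [{a, 2}, {2, b}])"
  show "walk 4 Str (fst (?F a b)) (snd (?F a b)) \<and> hd (fst (?F a b)) = a \<and> last (fst (?F a b)) = b"
    if "a \<in> {1..4}" "b \<in> {1..4}" for a b
    using that unfolding vertices4
    by (elim insertE emptyE) (simp_all add: walk_simps Str_def doubleton_eq_iff)
  show "(vs, es) = ?F (hd vs) (last vs)" if w: "walk 4 Str vs es" for vs es
    using w
  proof (cases rule: walk4_cases)
    case (3 a b c e f)
    then have e: "e \<in> Str" "f \<in> Str" "a \<in> e" "b \<in> e" "b \<in> f" "c \<in> f" "a \<noteq> b" "b \<noteq> c" "e \<noteq> f"
      using w by (auto simp: walk_simps)
    \<comment> \<open>Different hyperedges of the star meet only in its centre. With four vertices
      the same remark gives b = c = 2, a contradiction.\<close>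
    then have "b = 2" unfolding Str_def by auto
    then show ?thesis using e 3 unfolding Str_def by auto
  next
    case (4 a b c d e f g)
    then have e: "e \<in> Str" "f \<in> Str" "g \<in> Str" "a \<in> e" "b \<in> e" "b \<in> f" "c \<in> f" "c \<in> g" "b \<noteq> c" "e \<noteq> f" "f \<noteq> g"
      using w by (auto simp: walk_simps)
    then have "b = 2" unfolding Str_def by auto
    moreover have "c = 2" using e unfolding Str_def by auto
    ultimately show ?thesis using e by simp
  qed (use w in \<open>auto simp: walk_simps Str_def\<close>)
qed (auto simp: Str_def)

lemma Pth_edge: "E \<in> Pth \<Longrightarrow> x \<in> E \<Longrightarrow> y \<in> E \<Longrightarrow> x \<noteq> y \<Longrightarrow> E = {x, y} \<and> (y = Suc x \<or> x = Suc y)"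
  unfolding Pth_def by auto

text \<open>Hyperedges join consecutive integers, so a walk without repeated vertices is monotone;
  hence the ascending intervals and their reversals as witnesses.\<close>

lemma Pth_HT: "Pth \<in> HT 4"
proof (rule hypertreeI)
  let ?F = "\<lambda>a b. if a \<le> b then ([a..<Suc b], map (\<lambda>k. {k, Suc k}) [a..<b])
      else (rev [b..<Suc a], rev (map (\<lambda>k. {k, Suc k}) [b..<a]))"
  have upt: "[1..<2] = [1]" "[1..<3] = [1,2]" "[1..<4] = [1,2,3]" "[1..<5] = [1,2,3,4]"
    "[2..<3] = [2]" "[2..<4] = [2,3]" "[2..<5] = [2,3,4]" "[3..<4] = [3]" "[3..<5] = [3,4]" "[4..<5] = [4::nat]"
    by (simp_all add: upt_rec)
  have Suc: "Suc 1 = 2" "Suc 2 = 3" "Suc 3 = 4" "Suc 4 = 5" by simp_all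
  show "walk 4 Pth (fst (?F a b)) (snd (?F a b)) \<and> hd (fst (?F a b)) = a \<and> last (fst (?F a b)) = b"
    if "a \<in> {1..4}" "b \<in> {1..4}" for a b
    using that unfolding vertices4
    by (elim insertE emptyE; simp only: Suc upt) (simp_all add: walk_simps Pth_def doubleton_eq_iff)
  show "(vs, es) = ?F (hd vs) (last vs)" if w: "walk 4 Pth vs es" for vs es
    using w
  proof (cases rule: walk4_cases)
    case (2 a b e)
    then have "e \<in> Pth" "a \<in> e" "b \<in> e" "a \<noteq> b" using w by (auto simp: walk_simps)
    from Pth_edge[OF this] show ?thesis using 2 by (auto simp: insert_commute)
  next
    case (3 a b c e f)
    then have e: "e \<in> Pth" "a \<in> e" "b \<in> e" "a \<noteq> b" and f: "f \<in> Pth" "b \<in> f" "c \<in> f" "b \<noteq> c" and "a \<noteq> c"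
      using w by (auto simp: walk_simps)
    then show ?thesis using Pth_edge[OF e] Pth_edge[OF f] 3 by (auto simp: insert_commute)
  next
    case (4 a b c d e f g)
    then have e: "e \<in> Pth" "a \<in> e" "b \<in> e" "a \<noteq> b" and f: "f \<in> Pth" "b \<in> f" "c \<in> f" "b \<noteq> c"
      and g: "g \<in> Pth" "c \<in> g" "d \<in> g" "c \<noteq> d" and ne: "a \<noteq> c" "b \<noteq> d"
      using w by (auto simp: walk_simps)
    then show ?thesis using Pth_edge[OF e] Pth_edge[OF f] Pth_edge[OF g] 4 by (auto simp: insert_commute)
  qed auto
qed (auto simp: Pth_def)

section \<open>Carried automorphisms on four generators\<close>

text \<open>The obstruction to being carried: an automorphism carried by \<open>\<Theta>\<close> acts on each hyperedge as a single
  conjugation, so it respects every identification of two letters of that hyperedge.\<close>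

lemma Car_conj_on_edge:
  assumes c: "c \<in> Car n \<Theta>" and E: "E \<in> \<Theta>"
  shows "\<exists>w. \<forall>k\<in>E \<inter> {1..n}. c k = conj_word w [k]"
  using c unfolding Car_def
proof induction
  case prods_id
  then show ?case by (intro exI[of _ "[]"]) (simp add: id_aut_def conj_word_empty)
next
  case (prods_step f s)
  then obtain w where w: "\<forall>k\<in>E \<inter> {1..n}. f k = conj_word w [k]" by blast
  have f: "conj_end n f" by (rule conj_end_prods[OF conj_end_carried_pconjs prods_step.hyps(1)])
  obtain i D where s: "s = pconj i D" and i: "i \<in> {1..n}" "D \<subseteq> {1..n} - {i}"
    and c: "carries n \<Theta> i D" using prods_step(2) unfolding carried_pconjs_def by blast
  show ?case
  proof (cases "E \<inter> D = {}")
    case True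
    then have "comp_aut f s k = f k" if "k \<in> E" for k
      using that by (auto simp: comp_aut_apply s pconj_def wapp_single[OF f])
    then show ?thesis using w by auto
  next
    case False
    then have D: "k \<in> insert i D" if "k \<in> E \<inter> {1..n}" for k
      using c E that unfolding carries_iff[OF i] by blast
    have "comp_aut f s k = conj_word (f i @ w) [k]" if k: "k \<in> E \<inter> {1..n}" for k
    proof -
      have "s k = conj_word [i] [k]" using D[OF k] i by (auto simp: s pconj_def conj_word_def)
      then show ?thesis using w k
        by (simp add: comp_aut_apply wapp_conj_word[OF f] wapp_single[OF f] conj_word_conj_word)
    qed
    then show ?thesis by blast
  qed
qed

lemma Car_letter_identification:
  assumes c: "c \<in> Car n \<Theta>" and E: "E \<in> \<Theta>" "i \<in> E \<inter> {1..n}" "j \<in> E \<inter> {1..n}" and \<theta>: "\<theta> i = \<theta> j"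
  shows "red (map \<theta> (c i)) = red (map \<theta> (c j))"
proof -
  obtain w where "\<forall>k\<in>E \<inter> {1..n}. c k = conj_word w [k]" using Car_conj_on_edge[OF c E(1)] by blast
  then have "c i = conj_word w [i]" "c j = conj_word w [j]" using E by auto
  then show ?thesis using \<theta> by (simp add: conj_word_def red_map_red)
qed

lemma pconj_Car_edge:
  assumes c: "pconj k D \<in> Car n \<Theta>" and E: "E \<in> \<Theta>" "i \<in> E \<inter> {1..n}" "j \<in> E \<inter> {1..n}" and k: "i \<noteq> k" "j \<noteq> k"
  shows "i \<in> D \<longleftrightarrow> j \<in> D"
proof -
  have "j \<in> D" if "i \<in> D" "i \<in> E \<inter> {1..n}" "j \<in> E \<inter> {1..n}" "i \<noteq> k" "j \<noteq> k" for i j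
  proof (rule ccontr)
    assume "j \<notin> D"
    \<comment> \<open>Replacing j by i turns the images of i and j into the distinct reduced words
      [k, i, k] and [i].\<close>
    then show False
      using Car_letter_identification[OF c E(1) that(2,3), of "\<lambda>l. if l = j then i else l"] that
      by (auto simp: pconj_def split: if_splits)
  qed
  then show ?thesis using E k by blast
qed

section \<open>Normal forms of carried automorphisms, and stars of vertices\<close>

context mm_space
begin

lemma comp_inner_commute:
  assumes s: "conj_end n s" "comp_aut s s = id_aut" and w: "set w \<subseteq> {1..n}"
  shows "comp_aut (inner_aut n w) s = comp_aut s (inner_aut n (wapp s w))"
proof -
  have "wapp s (wapp s w) = red w" using wapp_comp[OF s(1), of s w] s(2) by (simp add: wapp_id)
  then show ?thesis using comp_inner_swap[OF s(1) set_wapp[OF s(1) w]] by (simp add: inner_red)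
qed

text \<open>Inner factors are moved to the right past each generator, so it suffices that every
  generator multiplies \<open>K\<close> into \<open>K\<close> times the inner automorphisms. With
  finite \<open>K\<close> this makes the set of outer classes carried by \<Theta> finite.\<close>

lemma Car_decomposition:
  assumes K: "id_aut \<in> K" "\<And>\<kappa>. \<kappa> \<in> K \<Longrightarrow> conj_end n \<kappa>"
    and step: "\<And>\<kappa> s. \<kappa> \<in> K \<Longrightarrow> s \<in> carried_pconjs n \<Theta> \<Longrightarrow>
        \<exists>\<kappa>'\<in>K. \<exists>u. set u \<subseteq> {1..n} \<and> comp_aut \<kappa> s = comp_aut \<kappa>' (inner_aut n u)"
    and c: "c \<in> Car n \<Theta>"
  shows "\<exists>\<kappa>\<in>K. \<exists>w. set w \<subseteq> {1..n} \<and> c = comp_aut \<kappa> (inner_aut n w)"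
  using c unfolding Car_def
proof induction
  case prods_id
  have "inner_aut n [] = id_aut" by (rule ext) (simp add: inner_aut_def id_aut_def conj_word_empty)
  then have "id_aut = comp_aut id_aut (inner_aut n [])" using comp_aut_id_left[OF conj_end_id] by simp
  then show ?case using K(1) by (intro bexI[of _ id_aut] exI[of _ "[]"]) auto
next
  case (prods_step f s)
  then obtain \<kappa> w where \<kappa>: "\<kappa> \<in> K" and w: "set w \<subseteq> {1..n}" and f: "f = comp_aut \<kappa> (inner_aut n w)" by blast
  obtain \<kappa>' u where \<kappa>': "\<kappa>' \<in> K" and u: "set u \<subseteq> {1..n}" and e: "comp_aut \<kappa> s = comp_aut \<kappa>' (inner_aut n u)"
    using step[OF \<kappa> prods_step(2)] by blast
  note s = conj_end_carried_pconjs[OF prods_step(2)] carried_pconjs_involution[OF prods_step(2)]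
  have sw: "set (wapp s w) \<subseteq> {1..n}" using set_wapp[OF s(1) w] .
  have "comp_aut f s = comp_aut \<kappa> (comp_aut s (inner_aut n (wapp s w)))"
    unfolding f comp_aut_assoc[OF K(2)[OF \<kappa>]] comp_inner_commute[OF s w] ..
  also have "\<dots> = comp_aut (comp_aut \<kappa> s) (inner_aut n (wapp s w))"
    using comp_aut_assoc[OF K(2)[OF \<kappa>]] by simp
  also have "\<dots> = comp_aut \<kappa>' (inner_aut n (u @ wapp s w))"
    unfolding e comp_aut_assoc[OF K(2)[OF \<kappa>']] comp_inner[OF u sw] ..
  finally show ?case using \<kappa>' u sw by (intro bexI[of _ \<kappa>'] exI[of _ "u @ wapp s w"]) auto
qed

lemma V_comp_inner: "\<kappa> \<in> Aut0 n \<Longrightarrow> \<Theta> \<in> HT n \<Longrightarrow> set w \<subseteq> {1..n} \<Longrightarrow> V (comp_aut \<kappa> (inner_aut n w)) \<Theta> = V \<kappa> \<Theta>"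
  using V_eq_iff[of \<kappa> \<Theta> "comp_aut \<kappa> (inner_aut n w)" \<Theta>] inner_Car[of w \<Theta>] Aut0_comp Car_Aut0 by metis

text \<open>Since \<Theta>0 arises by folding only from itself, every comparable vertex can be
  written with a hypertree below \<Theta>0, and its marking differs from the trivial one by an
  element of \<open>Car n \<Theta>0\<close>.\<close>

lemma comparable_below:
  assumes \<Theta>0: "\<Theta>0 \<in> HT n" and max: "\<And>\<Lambda>. \<Lambda> \<in> HT n \<Longrightarrow> ht_le \<Theta>0 \<Lambda> \<Longrightarrow> \<Lambda> = \<Theta>0"
    and w: "w \<in> Verts n" "mm_le n (V id_aut \<Theta>0) w \<or> mm_le n w (V id_aut \<Theta>0)"
  shows "\<exists>\<alpha>\<in>Car n \<Theta>0. \<exists>\<Theta>\<in>HT n. ht_le \<Theta> \<Theta>0 \<and> w = V \<alpha> \<Theta>"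
proof -
  obtain \<alpha> \<Theta> where V: "w = V \<alpha> \<Theta>" and a: "\<alpha> \<in> Aut0 n" "\<Theta> \<in> HT n" using VertsE[OF w(1)] by blast
  note i = Aut0_id[of n] \<Theta>0
  from w(2) show ?thesis
  proof
    assume "mm_le n (V id_aut \<Theta>0) w"
    then obtain c where "ht_le \<Theta>0 \<Theta>" "c \<in> Car n \<Theta>" "\<alpha> = comp_aut id_aut c"
      unfolding V mm_le_V[OF i a] by blast
    moreover then have "\<Theta> = \<Theta>0" using max a by blast
    ultimately have "\<alpha> \<in> Car n \<Theta>0" using comp_aut_id_left[OF Car_conj_end] by simp
    then show ?thesis using V \<open>\<Theta> = \<Theta>0\<close> \<Theta>0 ht_le_refl by blast
  next
    assume "mm_le n w (V id_aut \<Theta>0)"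
    then obtain c where c: "ht_le \<Theta> \<Theta>0" "c \<in> Car n \<Theta>0" "id_aut = comp_aut \<alpha> c"
      unfolding V mm_le_V[OF a i] by blast
    obtain c' where c': "c' \<in> Car n \<Theta>0" "comp_aut c c' = id_aut" using Car_inverse[OF c(2)] by blast
    have "c' = comp_aut (comp_aut \<alpha> c) c'" using c comp_aut_id_left[OF Car_conj_end[OF c'(1)]] by simp
    also have "\<dots> = \<alpha>"
      using comp_aut_assoc[OF Aut0_conj_end[OF a(1)]] c' comp_aut_id_right[OF Aut0_conj_end[OF a(1)]] by simp
    finally show ?thesis using V c c' a by blast
  qed
qed

lemma finite_simplices_of_finite_comparable:
  assumes "finite N" and "\<And>w. w \<in> Verts n \<Longrightarrow> mm_le n v w \<or> mm_le n w v \<Longrightarrow> w \<in> N"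
  shows "finite {\<tau> \<in> simplices n. v \<in> \<tau>}"
proof (rule finite_subset)
  show "{\<tau> \<in> simplices n. v \<in> \<tau>} \<subseteq> Pow N"
    using assms(2) unfolding simplices_def by blast
qed (simp add: assms)

lemma involutive_perm: "\<pi> permutes {1..n} \<Longrightarrow> \<pi> \<circ> \<pi> = id \<Longrightarrow> involutive (id_aut, \<pi>)"
  using comp_aut_id_left[OF conj_end_id] by (simp add: involutive_def Aut0_id conjperm_id)

lemma conjperm_id_perm: "conjperm id f = f"
  by (rule ext) (simp add: conjperm_apply)

lemma involutive_aut: "\<phi> \<in> Aut0 n \<Longrightarrow> comp_aut \<phi> \<phi> = id_aut \<Longrightarrow> involutive (\<phi>, id)"
  by (simp add: involutive_def conjperm_id_perm permutes_id)

lemma act_perm: "\<pi> permutes {1..n} \<Longrightarrow> \<alpha> \<in> Aut0 n \<Longrightarrow> \<Theta> \<in> HT n \<Longrightarrow>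
    act n (id_aut, \<pi>) (V \<alpha> \<Theta>) = V (conjperm \<pi> \<alpha>) ((`) \<pi> ` \<Theta>)"
  using act_V[OF Aut0_id] comp_aut_id_left[OF Aut0_conj_end[OF conjperm_Aut0]] by simp

lemma act_aut: "\<phi> \<in> Aut0 n \<Longrightarrow> \<alpha> \<in> Aut0 n \<Longrightarrow> \<Theta> \<in> HT n \<Longrightarrow> act n (\<phi>, id) (V \<alpha> \<Theta>) = V (comp_aut \<phi> \<alpha>) \<Theta>"
  using act_V[OF _ permutes_id, of \<phi> \<alpha> \<Theta>] by (simp add: conjperm_id_perm)

end

lemma pconj_square: "i \<notin> D \<Longrightarrow> comp_aut (pconj i D) (pconj i D) = id_aut"
  by (simp add: pconj_comp_pconj pconj_empty)

lemma pconj_Aut0: "i \<in> {1..n} \<Longrightarrow> D \<subseteq> {1..n} - {i} \<Longrightarrow> pconj i D \<in> Aut0 n"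
  by (rule Aut0_of_inverse[where g = "pconj i D"]) (auto intro!: conj_end_pconj pconj_square)

section \<open>The fold order below the path and the star\<close>

lemma ht_le_maximal:
  assumes "\<Lambda> \<in> HT n" "ht_le \<Theta> \<Lambda>" "\<And>E. E \<in> \<Theta> \<Longrightarrow> card E \<le> 2"
  shows "\<Lambda> = \<Theta>"
proof -
  \<comment> \<open>Invariant along folds: the union of two distinct sets of size at least two has
    size at least three, so any hypertree obtained by at least one fold has such a
    hyperedge.\<close>
  have "(\<forall>E\<in>\<Theta>. finite E \<and> 2 \<le> card E) \<and> (\<Theta> = \<Lambda> \<or> (\<exists>E\<in>\<Theta>. 3 \<le> card E))"
    using assms(2) unfolding ht_le_def
  proof (induction rule: rtrancl_induct)
    case base
    then show ?case using assms(1) unfolding HT_def hypertree_def by (auto intro: finite_subset)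
  next
    case (step \<Theta>' \<Theta>'')
    obtain E F where EF: "E \<in> \<Theta>'" "F \<in> \<Theta>'" "E \<noteq> F" "\<Theta>'' = (\<Theta>' - {E, F}) \<union> {E \<union> F}"
      using step(2) unfolding fold1_def by auto
    have fin: "finite E" "finite F" "2 \<le> card E" "2 \<le> card F" using step EF by auto
    have "\<not> card (E \<union> F) \<le> 2"
    proof
      assume "card (E \<union> F) \<le> 2"
      then have "E = E \<union> F" "F = E \<union> F"
        using fin card_seteq[of "E \<union> F" E] card_seteq[of "E \<union> F" F] by auto
      then show False using EF by simp
    qed
    then have c: "3 \<le> card (E \<union> F)" by simp
    have "\<forall>G\<in>\<Theta>''. finite G \<and> 2 \<le> card G"
    proof
      fix G assume "G \<in> \<Theta>''"
      then have "G \<in> \<Theta>' \<or> G = E \<union> F" using EF(4) by auto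
      then show "finite G \<and> 2 \<le> card G" using step.IH fin c by auto
    qed
    then show ?case using EF(4) c by blast
  qed
  then show ?thesis using assms(3) by fastforce
qed

lemma ht_le_coarser:
  assumes "ht_le \<Theta> \<Lambda>" "E \<in> \<Lambda>"
  shows "\<exists>F\<in>\<Theta>. E \<subseteq> F"
  using assms(1) unfolding ht_le_def
proof (induction rule: rtrancl_induct)
  case (step \<Theta>' \<Theta>'')
  obtain F where F: "F \<in> \<Theta>'" "E \<subseteq> F" using step by blast
  obtain G H where "\<Theta>'' = (\<Theta>' - {G, H}) \<union> {G \<union> H}" using step(2) unfolding fold1_def by auto
  then show ?case using F by (cases "F = G \<or> F = H") auto
qed (use assms(2) in blast)

text \<open>The first fold joins two adjacent edges of the path and so puts 1, 3 or 2, 4 into one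
  hyperedge; later folds only enlarge it. These are the pairs of letters whose identification is
  tested in \<open>xy_full_not_carried\<close>.\<close>

lemma ht_le_Pth:
  assumes "ht_le \<Theta> Pth" "\<Theta> \<noteq> Pth"
  shows "\<exists>E\<in>\<Theta>. {1, 3} \<subseteq> E \<or> {2, 4} \<subseteq> E"
proof -
  obtain \<Lambda> where \<Lambda>: "fold1 Pth \<Lambda>" "ht_le \<Theta> \<Lambda>"
    using assms unfolding ht_le_def by (auto elim: converse_rtranclE)
  have "\<exists>E\<in>\<Lambda>. {1, 3} \<subseteq> E \<or> {2, 4} \<subseteq> E"
  proof -
    obtain E F where EF: "E \<in> Pth" "F \<in> Pth" "E \<noteq> F" "E \<inter> F \<noteq> {}" "E \<union> F \<in> \<Lambda>"
      using \<Lambda>(1) unfolding fold1_def by blast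
    have "{1, 3} \<subseteq> E \<union> F \<or> {2, 4} \<subseteq> E \<union> F"
      using EF(1-4) unfolding Pth_def by (elim insertE emptyE) auto
    then show ?thesis using EF(5) by blast
  qed
  then show ?thesis using ht_le_coarser[OF \<Lambda>(2)] by (meson subset_trans)
qed

text \<open>The hypertree obtained from the star by merging the two hyperedges that avoid the leaf \<open>i\<close>.\<close>

definition Bst :: "nat \<Rightarrow> nat set set" where
  "Bst i = {{2, i}, {1, 2, 3, 4} - {i}}"

lemma fold1_Str: "fold1 Str \<Theta> \<Longrightarrow> \<Theta> = Bst 1 \<or> \<Theta> = Bst 3 \<or> \<Theta> = Bst 4"
proof -
  assume "fold1 Str \<Theta>"
  then obtain E F where EF: "E \<in> Str" "F \<in> Str" "E \<noteq> F" "\<Theta> = (Str - {E, F}) \<union> {E \<union> F}"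
    unfolding fold1_def by blast
  have "Str - {{1,2},{2,3}} = {{2,4}}" "Str - {{2,3},{1,2}} = {{2,4}}" "Str - {{1,2},{2,4}} = {{2,3}}"
    "Str - {{2,4},{1,2}} = {{2,3}}" "Str - {{2,3},{2,4}} = {{1,2}}" "Str - {{2,4},{2,3}} = {{1,2}}"
    unfolding Str_def by (auto simp: doubleton_eq_iff)
  moreover have "Bst 1 = {{1,2},{2,3,4}}" "Bst 3 = {{2,3},{1,2,4}}" "Bst 4 = {{2,4},{1,2,3}}"
    unfolding Bst_def by auto
  moreover have "{1,2} \<union> {2,3} = {1,2,3::nat}" "{2,3} \<union> {1,2} = {1,2,3::nat}" "{1,2} \<union> {2,4} = {1,2,4::nat}"
    "{2,4} \<union> {1,2} = {1,2,4::nat}" "{2,3} \<union> {2,4} = {2,3,4::nat}" "{2,4} \<union> {2,3} = {2,3,4::nat}" by auto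
  ultimately show ?thesis using EF unfolding Str_def
    by (elim insertE emptyE) (simp_all add: insert_commute)
qed

lemma fold1_Bst: "i \<in> {1,3,4} \<Longrightarrow> fold1 (Bst i) \<Theta> \<Longrightarrow> \<Theta> = H0"
proof -
  assume i: "i \<in> {1,3,4}" and "fold1 (Bst i) \<Theta>"
  then obtain E F where EF: "E \<in> Bst i" "F \<in> Bst i" "E \<noteq> F" "\<Theta> = (Bst i - {E, F}) \<union> {E \<union> F}"
    unfolding fold1_def by blast
  then have "{E, F} = Bst i" unfolding Bst_def by auto
  moreover have "E \<union> F = \<Union>{E, F}" by simp
  then have "E \<union> F = {1,2,3,4}" unfolding \<open>{E, F} = Bst i\<close> using i by (auto simp: Bst_def)
  ultimately show ?thesis using EF(4) by (simp add: H0_def)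
qed

lemma fold1_H0: "\<not> fold1 H0 \<Theta>"
  by (auto simp: fold1_def H0_def)

lemma ht_le_H0: "ht_le \<Theta> H0 \<Longrightarrow> \<Theta> = H0"
  unfolding ht_le_def by (auto elim: converse_rtranclE simp: fold1_H0)

lemma ht_le_Bst: "i \<in> {1,3,4} \<Longrightarrow> ht_le \<Theta> (Bst i) \<Longrightarrow> \<Theta> = Bst i \<or> \<Theta> = H0"
  unfolding ht_le_def
  by (erule converse_rtranclE) (auto simp: fold1_Bst dest!: ht_le_H0[unfolded ht_le_def] fold1_Bst[rotated])

lemma ht_le_Str: "ht_le \<Theta> Str \<Longrightarrow> \<Theta> = Str \<or> \<Theta> \<in> {Bst 1, Bst 3, Bst 4} \<or> \<Theta> = H0"
proof (unfold ht_le_def, erule converse_rtranclE)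
  fix \<Lambda> assume "(Str, \<Lambda>) \<in> {(A, B). fold1 A B}" and l: "(\<Lambda>, \<Theta>) \<in> {(A, B). fold1 A B}\<^sup>*"
  then obtain i where "i \<in> {1,3,4}" "\<Lambda> = Bst i" using fold1_Str by blast
  then show ?thesis using ht_le_Bst l unfolding ht_le_def by blast
qed simp

section \<open>Consequences of unique walks, and hypertrees invariant under a four-group\<close>

lemma hypertree_walk_unique:
  assumes h: "\<Theta> \<in> HT n" and w: "walk n \<Theta> vs es" "walk n \<Theta> vs' es'" and e: "hd vs = hd vs'" "last vs = last vs'"
  shows "vs = vs' \<and> es = es'"
proof -
  have "vs \<noteq> []" "set vs \<subseteq> {1..n}" using w(1) unfolding walk_def by auto
  then have n: "hd vs \<in> {1..n}" "last vs \<in> {1..n}" using hd_in_set last_in_set by blast+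
  define Q where "Q = (\<lambda>(us, fs). walk n \<Theta> us fs \<and> hd us = hd vs \<and> last us = last vs)"
  have "\<exists>!q. Q q" using h n unfolding HT_def hypertree_def Q_def by blast
  moreover have "Q (vs, es)" "Q (vs', es')" using w e by (auto simp: Q_def)
  ultimately have "(vs, es) = (vs', es')" by blast
  then show ?thesis by simp
qed

lemma hypertree_edges_meet:
  assumes h: "\<Theta> \<in> HT n" and "E \<in> \<Theta>" "F \<in> \<Theta>" and ab: "a \<in> E \<inter> F" "b \<in> E \<inter> F" "a \<noteq> b"
  shows "E = F"
proof -
  have "E \<subseteq> {1..n}" using h assms(2) unfolding HT_def hypertree_def by blast
  then have n: "a \<in> {1..n}" "b \<in> {1..n}" using ab by auto
  have "walk n \<Theta> [a, b] [E]" "walk n \<Theta> [a, b] [F]" using assms n by (auto simp: walk_simps)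
  then show ?thesis using hypertree_walk_unique[OF h] by fastforce
qed

lemma hypertree_crossing_edge:
  assumes h: "\<Theta> \<in> HT n" and a: "a \<in> {1..n}" "a \<in> U" and b: "b \<in> {1..n}" "b \<notin> U"
  shows "\<exists>E\<in>\<Theta>. E \<inter> U \<noteq> {} \<and> \<not> E \<subseteq> U"
proof (rule ccontr)
  assume no: "\<not> (\<exists>E\<in>\<Theta>. E \<inter> U \<noteq> {} \<and> \<not> E \<subseteq> U)"
  have "\<exists>!(vs, es). walk n \<Theta> vs es \<and> hd vs = a \<and> last vs = b"
    using h a b unfolding HT_def hypertree_def by blast
  then obtain vs es where w: "walk n \<Theta> vs es" "hd vs = a" "last vs = b" by auto
  have len: "length vs = Suc (length es)" and sub: "set es \<subseteq> \<Theta>"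
    and adj: "\<And>k. k < length es \<Longrightarrow> vs ! k \<in> es ! k \<and> vs ! Suc k \<in> es ! k"
    using w unfolding walk_def by auto
  have ne: "vs \<noteq> []" using len by auto
  have inU: "k < length vs \<Longrightarrow> vs ! k \<in> U" for k
  proof (induction k)
    case 0
    then show ?case using w a ne by (simp add: hd_conv_nth)
  next
    case (Suc k)
    then have k: "k < length es" using len by simp
    then have "es ! k \<in> \<Theta>" using sub by auto
    then show ?case using no adj[OF k] Suc k len by auto
  qed
  have "last vs \<in> U" using inU[of "length vs - 1"] ne by (simp add: last_conv_nth)
  then show False using w b by simp
qed

abbreviation t14 :: "nat \<Rightarrow> nat" where "t14 \<equiv> Transposition.transpose 1 4"
abbreviation t23 :: "nat \<Rightarrow> nat" where "t23 \<equiv> Transposition.transpose 2 3"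
abbreviation t34 :: "nat \<Rightarrow> nat" where "t34 \<equiv> Transposition.transpose 3 4"
abbreviation t13 :: "nat \<Rightarrow> nat" where "t13 \<equiv> Transposition.transpose 1 3"

text \<open>The two permutations generate the four-group of (1 4) and (2 3). Some hyperedge contains
  a letter of {1,4} and one of {2,3}. If it has no other letter, its translates form a 4-cycle,
  giving two walks from 1 to 4. Otherwise it contains one of the two pairs; the transposition of the
  other pair fixes these two letters, so the hyperedge shares two vertices with its image, equals
  it, and is everything.\<close>

lemma hypertree_invariant_H0:
  assumes h: "\<Theta> \<in> HT 4" and i1: "(`) t14 ` \<Theta> = \<Theta>" and i2: "(`) (t14 \<circ> t23) ` \<Theta> = \<Theta>"
  shows "\<Theta> = H0"
proof -
  have s1: "t14 ` E \<in> \<Theta>" if "E \<in> \<Theta>" for E using i1 that by blast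
  have s12: "(t14 \<circ> t23) ` E \<in> \<Theta>" if "E \<in> \<Theta>" for E using i2 that by blast
  have s2: "t23 ` E \<in> \<Theta>" if "E \<in> \<Theta>" for E
    using s1[OF s12[OF that]] by (simp add: image_comp comp_def)
  note meet = hypertree_edges_meet[OF h]
  obtain E where E: "E \<in> \<Theta>" "E \<inter> {1, 4} \<noteq> {}" "\<not> E \<subseteq> {1, 4}"
    using hypertree_crossing_edge[OF h, of 1 "{1,4}" 2] by auto
  have sub: "F \<subseteq> {1,2,3,4}" "2 \<le> card F" if "F \<in> \<Theta>" for F
    using h that unfolding HT_def hypertree_def vertices4 by auto
  have square: False if "{a, b} \<in> \<Theta>" "a \<in> {1, 4}" "b \<in> {2, 3}" for a b
  proof -
    have "{1,2} \<in> \<Theta> \<and> {4,2} \<in> \<Theta> \<and> {1,3} \<in> \<Theta> \<and> {4,3} \<in> \<Theta>"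
      using that s1[OF that(1)] s2[OF that(1)] s1[OF s2[OF that(1)]]
      by (elim insertE emptyE) (simp_all add: Transposition.transpose_def insert_commute)
    then have "walk 4 \<Theta> [1,2,4] [{1,2},{4,2}]" "walk 4 \<Theta> [1,3,4] [{1,3},{4,3}]"
      by (auto simp: walk_simps doubleton_eq_iff)
    then show False using hypertree_walk_unique[OF h] by fastforce
  qed
  have Esub: "E \<subseteq> {1,2,3,4}" using sub E by blast
  obtain a where a: "a \<in> E" "a \<in> {1, 4}" using E(2) by blast
  obtain b where b: "b \<in> E" "b \<in> {2, 3}" using E(3) Esub by blast
  have "E \<noteq> {a, b}" using square E(1) a(2) b(2) by blast
  then obtain c where c: "c \<in> E" "c \<noteq> a" "c \<noteq> b" using a b by blast
  have "{1,2,3,4} \<subseteq> E"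
  proof (cases "c \<in> {1, 4}")
    case True
    then have 14: "1 \<in> E" "4 \<in> E" using a c by auto
    have "1 \<in> t23 ` E" "4 \<in> t23 ` E"
      using imageI[OF 14(1), of t23] imageI[OF 14(2), of t23] by (simp_all add: Transposition.transpose_def)
    then have "E = t23 ` E" using meet[OF E(1) s2[OF E(1)], of 1 4] 14 by auto
    then have "t23 b \<in> E" using b by blast
    then show ?thesis using 14 b by (auto simp: Transposition.transpose_def)
  next
    case False
    then have 23: "2 \<in> E" "3 \<in> E" using b c Esub by auto
    have "2 \<in> t14 ` E" "3 \<in> t14 ` E"
      using imageI[OF 23(1), of t14] imageI[OF 23(2), of t14] by (simp_all add: Transposition.transpose_def)
    then have "E = t14 ` E" using meet[OF E(1) s1[OF E(1)], of 2 3] 23 by auto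
    then have "t14 a \<in> E" using a by blast
    then show ?thesis using 23 a by (auto simp: Transposition.transpose_def)
  qed
  then have full: "{1,2,3,4} \<in> \<Theta>" using E(1) Esub by (metis subset_antisym)
  have "F = {1,2,3,4}" if F: "F \<in> \<Theta>" for F
  proof -
    have "\<not> card F \<le> Suc 0" using sub(2)[OF F] by simp
    then obtain a b where "a \<in> F" "b \<in> F" "a \<noteq> b"
      using sub(1)[OF F] by (metis card_le_Suc0_iff_eq finite.emptyI finite.insertI finite_subset)
    then show ?thesis using meet[OF F full, of a b] sub(1)[OF F] by blast
  qed
  then show ?thesis using full unfolding H0_def by blast
qed

section \<open>The three vertices and the vertices comparable to them\<close>

interpretation mm4: mm_space 4
  by unfold_locales simp

definition hv where "hv = mm4.V id_aut H0"
definition pv where "pv = mm4.V id_aut Pth"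
definition sv where "sv = mm4.V id_aut Str"

lemma special_Verts: "hv \<in> Verts 4" "pv \<in> Verts 4" "sv \<in> Verts 4"
  unfolding hv_def pv_def sv_def using Aut0_id H0_HT Pth_HT Str_HT by auto

text \<open>\<open>H0\<close> admits no fold, so nothing lies strictly below \<open>hv\<close>. A
  vertex above it has a marking carried by its own hypertree, and that marking is absorbed in the
  class.\<close>

lemma comparable_hv:
  assumes w: "w \<in> Verts 4" "mm_le 4 hv w \<or> mm_le 4 w hv"
  shows "\<exists>\<Theta>\<in>HT 4. w = mm4.V id_aut \<Theta>"
proof -
  obtain \<alpha> \<Theta> where V: "w = mm4.V \<alpha> \<Theta>" and a: "\<alpha> \<in> Aut0 4" "\<Theta> \<in> HT 4" using mm4.VertsE[OF w(1)] by blast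
  note i = Aut0_id[of 4] H0_HT
  from w(2) show ?thesis
  proof
    assume "mm_le 4 hv w"
    then have "\<exists>c\<in>Car 4 \<Theta>. \<alpha> = comp_aut id_aut c" unfolding V hv_def mm4.mm_le_V[OF i a] by blast
    then have "mm4.V id_aut \<Theta> = w" unfolding V using mm4.V_eq_iff[OF Aut0_id a(2) a] by simp
    then show ?thesis using a by blast
  next
    assume "mm_le 4 w hv"
    then have "ht_le \<Theta> H0" and c: "\<exists>c\<in>Car 4 H0. id_aut = comp_aut \<alpha> c"
      unfolding V hv_def mm4.mm_le_V[OF a i] by auto
    then have [simp]: "\<Theta> = H0" using ht_le_H0 by blast
    have "w = mm4.V id_aut \<Theta>" unfolding V using mm4.V_eq_iff[OF a i] c by simp
    then show ?thesis using a by blast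
  qed
qed

lemma pconj2_Aut0: "D \<subseteq> {1,3,4} \<Longrightarrow> pconj 2 D \<in> Aut0 4"
  by (rule pconj_Aut0) auto

lemma pconj3_Aut0: "D \<subseteq> {1,2,4} \<Longrightarrow> pconj 3 D \<in> Aut0 4"
  by (rule pconj_Aut0) auto

lemma comp_full_pconj: "i \<in> {1..4} \<Longrightarrow> comp_aut \<kappa> (pconj i ({1..4} - {i})) = comp_aut \<kappa> (inner_aut 4 [i])"
  by (simp add: inner_single)

lemma carried_pconjs4:
  assumes "s \<in> carried_pconjs 4 \<Theta>"
  shows "\<exists>i D. s = pconj i D \<and> i \<in> {1,2,3,4} \<and> D \<subseteq> {1,2,3,4} \<and> i \<notin> D \<and> D \<noteq> {}
    \<and> (\<forall>E\<in>\<Theta>. \<forall>x\<in>E \<inter> D. \<forall>y\<in>E \<inter> {1,2,3,4} - {i}. y \<in> D)"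
proof -
  obtain i D where s: "s = pconj i D" and i: "i \<in> {1..4}" "D \<subseteq> {1..4} - {i}" and "D \<noteq> {}"
    and c: "carries 4 \<Theta> i D" using assms unfolding carried_pconjs_def by blast
  have "\<forall>E\<in>\<Theta>. \<forall>x\<in>E \<inter> D. \<forall>y\<in>E \<inter> {1,2,3,4} - {i}. y \<in> D"
    using c unfolding carries_iff[OF i] vertices4 by blast
  then show ?thesis using s i \<open>D \<noteq> {}\<close> unfolding vertices4 by blast
qed

lemma complement4: "{1..4} - {2} = {1, 3, 4 :: nat}" "{1..4} - {3} = {1, 2, 4 :: nat}"
  by auto

text \<open>A nonempty carried set based at a leaf contains the centre and, through it, every letter
  but the base, so its partial conjugation is inner. Based at the centre 2, every subset of the
  leaves occurs.\<close>

lemma Car_Str: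
  assumes "c \<in> Car 4 Str"
  shows "\<exists>D\<subseteq>{1,3,4}. \<exists>w. set w \<subseteq> {1..4} \<and> c = comp_aut (pconj 2 D) (inner_aut 4 w)"
proof -
  have "\<exists>\<kappa>\<in>{pconj 2 D |D. D \<subseteq> {1,3,4}}. \<exists>w. set w \<subseteq> {1..4} \<and> c = comp_aut \<kappa> (inner_aut 4 w)"
  proof (rule mm4.Car_decomposition[OF _ _ _ assms])
    show "id_aut \<in> {pconj 2 D |D. D \<subseteq> {1,3,4}}" using pconj_empty[of 2] by (auto intro!: exI[of _ "{}"])
    show "conj_end 4 \<kappa>" if "\<kappa> \<in> {pconj 2 D |D. D \<subseteq> {1,3,4}}" for \<kappa>
      using that pconj2_Aut0 Aut0_conj_end by blast
    fix \<kappa> s assume "\<kappa> \<in> {pconj 2 D |D. D \<subseteq> {1,3,4}}" and s: "s \<in> carried_pconjs 4 Str"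
    then obtain D where D: "\<kappa> = pconj 2 D" "D \<subseteq> {1,3,4}" by blast
    obtain i E where E: "s = pconj i E" "i \<in> {1,2,3,4}" "E \<subseteq> {1,2,3,4}" "i \<notin> E" "E \<noteq> {}"
      and c': "\<forall>F\<in>Str. \<forall>x\<in>F \<inter> E. \<forall>y\<in>F \<inter> {1,2,3,4} - {i}. y \<in> E"
      using carried_pconjs4[OF s] by (elim exE conjE) (rule that)
    have c: "y \<in> E" if "F \<in> Str" "x \<in> F" "x \<in> E" "y \<in> F" "y \<in> {1,2,3,4}" "y \<noteq> i" for F x y
      using c' that by blast
    show "\<exists>\<kappa>'\<in>{pconj 2 D |D. D \<subseteq> {1,3,4}}. \<exists>u. set u \<subseteq> {1..4} \<and> comp_aut \<kappa> s = comp_aut \<kappa>' (inner_aut 4 u)"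
    proof (cases "i = 2")
      case True
      have "comp_aut \<kappa> s = pconj 2 (sym_diff D E)"
        unfolding D E True using D E True by (intro pconj_comp_pconj) auto
      moreover have DE: "sym_diff D E \<subseteq> {1,3,4}" using D E True by auto
      moreover have "inner_aut 4 [] = id_aut" by (rule ext) (simp add: inner_aut_def id_aut_def conj_word_empty)
      ultimately have "comp_aut \<kappa> s = comp_aut (pconj 2 (sym_diff D E)) (inner_aut 4 [])"
        using comp_aut_id_right[OF Aut0_conj_end[OF pconj2_Aut0]] by simp
      then show ?thesis using DE by (intro bexI[of _ "pconj 2 (sym_diff D E)"] exI[of _ "[]"]) auto
    next
      case False
      have "{2, x} \<in> Str" if "x \<in> {1,3,4}" for x using that by (auto simp: Str_def)
      then have 2: "y \<in> E" if "2 \<in> E" "y \<in> {1,3,4}" "y \<noteq> i" for y using c[of "{2, y}" 2 y] that by auto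
      obtain x where "x \<in> E" using E by blast
      then have "2 \<in> E" using c[of "{2, x}" x 2] E False \<open>\<And>x. x \<in> {1,3,4} \<Longrightarrow> {2, x} \<in> Str\<close>[of x]
        by (cases "x = 2") auto
      then have "E = {1..4} - {i}" using 2 E unfolding vertices4 by auto
      moreover have "i \<in> {1..4}" using E(2) by auto
      ultimately have "comp_aut \<kappa> s = comp_aut \<kappa> (inner_aut 4 [i])" using E(1) comp_full_pconj by blast
      then show ?thesis using D E(2) by (intro bexI[of _ \<kappa>] exI[of _ "[i]"]) auto
    qed
  qed
  then show ?thesis by blast
qed

lemma comparable_sv:
  assumes w: "w \<in> Verts 4" "mm_le 4 sv w \<or> mm_le 4 w sv"
  shows "\<exists>D\<subseteq>{1,3,4}. \<exists>\<Theta>\<in>HT 4. ht_le \<Theta> Str \<and> w = mm4.V (pconj 2 D) \<Theta>"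
proof -
  have "\<Lambda> = Str" if "\<Lambda> \<in> HT 4" "ht_le Str \<Lambda>" for \<Lambda>
    by (rule ht_le_maximal[OF that]) (auto simp: Str_def)
  from mm4.comparable_below[OF Str_HT this w[unfolded sv_def]]
  obtain \<alpha> \<Theta> where a: "\<alpha> \<in> Car 4 Str" "\<Theta> \<in> HT 4" "ht_le \<Theta> Str" "w = mm4.V \<alpha> \<Theta>" by blast
  obtain D u where "D \<subseteq> {1,3,4}" "set u \<subseteq> {1..4}" "\<alpha> = comp_aut (pconj 2 D) (inner_aut 4 u)"
    using Car_Str[OF a(1)] by blast
  then show ?thesis using a mm4.V_comp_inner[OF pconj2_Aut0 a(2)] by metis
qed

lemma pconj_2_3_commute:
  "D \<subseteq> {1} \<Longrightarrow> D' \<subseteq> {4} \<Longrightarrow> comp_aut (pconj 2 D) (pconj 3 D') = comp_aut (pconj 3 D') (pconj 2 D)"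
  by (rule ext) (auto simp: comp_aut_def pconj_def wapp_def)

text \<open>For \<open>D\<close> inside {1} and \<open>D'\<close> inside {4} a Klein four-group: the
  two factors move different letters and fix the conjugating letters 2 and 3. It represents the
  outer classes carried by the path.\<close>

definition xy :: "nat set \<Rightarrow> nat set \<Rightarrow> aut" where
  "xy D D' = comp_aut (pconj 2 D) (pconj 3 D')"

lemma xy_Aut0: "D \<subseteq> {1} \<Longrightarrow> D' \<subseteq> {4} \<Longrightarrow> xy D D' \<in> Aut0 4"
  unfolding xy_def by (intro Aut0_comp pconj2_Aut0 pconj3_Aut0) auto

lemma xy_comp:
  assumes "D \<subseteq> {1}" "D' \<subseteq> {4}" "E \<subseteq> {1}" "E' \<subseteq> {4}"
  shows "comp_aut (xy D D') (xy E E') = xy (sym_diff D E) (sym_diff D' E')"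
proof -
  have ce: "conj_end 4 (pconj 2 F)" if "F \<subseteq> {1}" for F using that pconj2_Aut0[of F] Aut0_conj_end by auto
  have ce3: "conj_end 4 (pconj 3 F)" if "F \<subseteq> {4}" for F using that pconj3_Aut0[of F] Aut0_conj_end by auto
  have "comp_aut (xy D D') (xy E E')
      = comp_aut (pconj 2 D) (comp_aut (comp_aut (pconj 3 D') (pconj 2 E)) (pconj 3 E'))"
    unfolding xy_def comp_aut_assoc[OF ce[OF assms(1)]] comp_aut_assoc[OF ce3[OF assms(2)]] ..
  also have "\<dots> = comp_aut (comp_aut (pconj 2 D) (pconj 2 E)) (comp_aut (pconj 3 D') (pconj 3 E'))"
    unfolding pconj_2_3_commute[OF assms(3,2), symmetric]
      comp_aut_assoc[OF ce[OF assms(1)]] comp_aut_assoc[OF ce[OF assms(3)]] ..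
  also have "\<dots> = xy (sym_diff D E) (sym_diff D' E')"
    unfolding xy_def using assms by (subst (1 2) pconj_comp_pconj) auto
  finally show ?thesis .
qed

lemma xy_simps: "xy {} {} = id_aut" "D \<subseteq> {1} \<Longrightarrow> xy D {} = pconj 2 D" "D' \<subseteq> {4} \<Longrightarrow> xy {} D' = pconj 3 D'"
proof -
  show "xy {} {} = id_aut" unfolding xy_def pconj_empty by (rule comp_aut_id_left[OF conj_end_id])
  show "xy D {} = pconj 2 D" if "D \<subseteq> {1}"
    unfolding xy_def pconj_empty using comp_aut_id_right[OF Aut0_conj_end[OF pconj2_Aut0[of D]]] that by auto
  show "xy {} D' = pconj 3 D'" if "D' \<subseteq> {4}"
    unfolding xy_def pconj_empty using comp_aut_id_left[OF Aut0_conj_end[OF pconj3_Aut0[of D']]] that by auto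
qed

text \<open>A carried set based at 2 or 3 consists of one or both of the two sides into which that
  letter cuts the path; at an end there is only one side. Opposite sides differ by an inner
  automorphism, so \<open>pconj 2 {1}\<close> and \<open>pconj 3 {4}\<close> suffice.\<close>

lemma Car_Pth:
  assumes "c \<in> Car 4 Pth"
  shows "\<exists>D\<subseteq>{1}. \<exists>D'\<subseteq>{4}. \<exists>w. set w \<subseteq> {1..4} \<and> c = comp_aut (xy D D') (inner_aut 4 w)"
proof -
  let ?K = "{xy D D' |D D'. D \<subseteq> {1} \<and> D' \<subseteq> {4}}"
  have "\<exists>\<kappa>\<in>?K. \<exists>w. set w \<subseteq> {1..4} \<and> c = comp_aut \<kappa> (inner_aut 4 w)"
  proof (rule mm4.Car_decomposition[OF _ _ _ assms])
    show "id_aut \<in> ?K" using xy_simps(1) by (metis (mono_tags, lifting) empty_subsetI mem_Collect_eq)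
    show ce: "conj_end 4 \<kappa>" if "\<kappa> \<in> ?K" for \<kappa> using that xy_Aut0 Aut0_conj_end by blast
    fix \<kappa> s assume "\<kappa> \<in> ?K" and s: "s \<in> carried_pconjs 4 Pth"
    then obtain D D' where D: "\<kappa> = xy D D'" "D \<subseteq> {1}" "D' \<subseteq> {4}" by blast
    have ex: "\<exists>\<kappa>'\<in>?K. \<exists>u. set u \<subseteq> {1..4} \<and> comp_aut \<kappa> s = comp_aut \<kappa>' (inner_aut 4 u)"
      if "s = comp_aut (xy E E') (inner_aut 4 u)" "E \<subseteq> {1}" "E' \<subseteq> {4}" "set u \<subseteq> {1..4}" for E E' u
    proof -
      have "comp_aut \<kappa> s = comp_aut (xy (sym_diff D E) (sym_diff D' E')) (inner_aut 4 u)"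
        unfolding that(1) D(1) xy_comp[OF D(2,3) that(2,3), symmetric]
        using comp_aut_assoc[OF Aut0_conj_end[OF xy_Aut0[OF D(2,3)]]] by simp
      moreover have "xy (sym_diff D E) (sym_diff D' E') \<in> ?K"
        using D that by (intro CollectI exI[of _ "sym_diff D E"] exI[of _ "sym_diff D' E'"]) auto
      ultimately show ?thesis using that(4) by blast
    qed
    have in0: "inner_aut 4 [] = id_aut" by (rule ext) (simp add: inner_aut_def id_aut_def conj_word_empty)
    have full: "\<exists>\<kappa>'\<in>?K. \<exists>u. set u \<subseteq> {1..4} \<and> comp_aut \<kappa> s = comp_aut \<kappa>' (inner_aut 4 u)"
      if "s = pconj i ({1,2,3,4} - {i})" "i \<in> {1,2,3,4}" for i
    proof (rule ex[of "{}" "{}" "[i]"])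
      have "s = inner_aut 4 [i]" using that inner_single[of i 4, unfolded vertices4] by simp
      then show "s = comp_aut (xy {} {}) (inner_aut 4 [i])"
        using comp_aut_id_left[OF conj_end_inner[of "[i]" 4]] that(2) unfolding xy_simps vertices4 by simp
    qed (use that in auto)
    obtain i E where E: "s = pconj i E" "i \<in> {1,2,3,4}" "E \<subseteq> {1,2,3,4}" "i \<notin> E" "E \<noteq> {}"
      and c': "\<forall>F\<in>Pth. \<forall>x\<in>F \<inter> E. \<forall>y\<in>F \<inter> {1,2,3,4} - {i}. y \<in> E"
      using carried_pconjs4[OF s] by (elim exE conjE) (rule that)
    have c: "y \<in> E" if "F \<in> Pth" "x \<in> F" "x \<in> E" "y \<in> F" "y \<in> {1,2,3,4}" "y \<noteq> i" for F x y
      using c' that by blast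
    have e12: "1 \<in> E \<longleftrightarrow> 2 \<in> E" if "i \<noteq> 1" "i \<noteq> 2" using c[of "{1,2}" 1 2] c[of "{1,2}" 2 1] that by (auto simp: Pth_def)
    have e23: "2 \<in> E \<longleftrightarrow> 3 \<in> E" if "i \<noteq> 2" "i \<noteq> 3" using c[of "{2,3}" 2 3] c[of "{2,3}" 3 2] that by (auto simp: Pth_def)
    have e34: "3 \<in> E \<longleftrightarrow> 4 \<in> E" if "i \<noteq> 3" "i \<noteq> 4" using c[of "{3,4}" 3 4] c[of "{3,4}" 4 3] that by (auto simp: Pth_def)
    consider "E = {1,2,3,4} - {i}" | "i = 2" "E = {1}" | "i = 2" "E = {3,4}" | "i = 3" "E = {4}" | "i = 3" "E = {1,2}"
    proof -
      have "i = 1 \<or> i = 2 \<or> i = 3 \<or> i = 4" using E by blast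
      then show thesis
      proof (elim disjE)
        assume i: "i = 1"
        have "E \<subseteq> {2,3,4}" using E(3,4) i by blast
        moreover have "2 \<in> E \<longleftrightarrow> 3 \<in> E" "3 \<in> E \<longleftrightarrow> 4 \<in> E" using e23 e34 i by simp_all
        ultimately have "E = {2,3,4}" using E(5) by blast
        then show thesis using i by (intro that(1)) auto
      next
        assume i: "i = 4"
        have "E \<subseteq> {1,2,3}" using E(3,4) i by blast
        moreover have "1 \<in> E \<longleftrightarrow> 2 \<in> E" "2 \<in> E \<longleftrightarrow> 3 \<in> E" using e12 e23 i by simp_all
        ultimately have "E = {1,2,3}" using E(5) by blast
        then show thesis using i by (intro that(1)) auto
      next
        assume i: "i = 2"
        have "E \<subseteq> {1,3,4}" using E(3,4) i by blast
        moreover have "3 \<in> E \<longleftrightarrow> 4 \<in> E" using e34 i by simp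
        ultimately consider "E = {1}" | "E = {3,4}" | "E = {1,3,4}" using E(5) by blast
        then show thesis
        proof cases
          case 3
          then show thesis using i by (intro that(1)) auto
        qed (use that(2,3) i in blast)+
      next
        assume i: "i = 3"
        have "E \<subseteq> {1,2,4}" using E(3,4) i by blast
        moreover have "1 \<in> E \<longleftrightarrow> 2 \<in> E" using e12 i by simp
        ultimately consider "E = {4}" | "E = {1,2}" | "E = {1,2,4}" using E(5) by blast
        then show thesis
        proof cases
          case 3
          then show thesis using i by (intro that(1)) auto
        qed (use that(4,5) i in blast)+
      qed
    qed
    then show "\<exists>\<kappa>'\<in>?K. \<exists>u. set u \<subseteq> {1..4} \<and> comp_aut \<kappa> s = comp_aut \<kappa>' (inner_aut 4 u)"
    proof cases
      case 1
      then show ?thesis using full E(1,2) by blast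
    next
      case 2
      then have "s = comp_aut (xy {1} {}) (inner_aut 4 [])"
        unfolding in0 using E(1) comp_aut_id_right[OF Aut0_conj_end[OF pconj2_Aut0[of "{1}"]]] by (simp add: xy_simps)
      then show ?thesis by (rule ex) auto
    next
      case 3
      \<comment> \<open>The far side {3,4} is the symmetric difference of {1} and the full
        complement of 2, and the latter gives an inner automorphism.\<close>
      have "s = comp_aut (pconj 2 {1}) (pconj 2 {1,3,4})" using 3 E(1) by (subst pconj_comp_pconj) auto
      also have "pconj 2 {1,3,4} = inner_aut 4 [2]" using inner_single[of 2 4] complement4(1) by simp
      finally have "s = comp_aut (xy {1} {}) (inner_aut 4 [2])" by (simp add: xy_simps)
      then show ?thesis by (rule ex) auto
    next
      case 4
      then have "s = comp_aut (xy {} {4}) (inner_aut 4 [])"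
        unfolding in0 using E(1) comp_aut_id_right[OF Aut0_conj_end[OF pconj3_Aut0[of "{4}"]]] by (simp add: xy_simps)
      then show ?thesis by (rule ex) auto
    next
      case 5
      have sd: "sym_diff {4} {1,2,4} = {1,2::nat}" by auto
      have "comp_aut (pconj 3 {4}) (pconj 3 {1,2,4}) = pconj 3 (sym_diff {4} {1,2,4})"
        by (rule pconj_comp_pconj) auto
      then have "s = comp_aut (pconj 3 {4}) (pconj 3 {1,2,4})" unfolding sd using 5 E(1) by simp
      also have "pconj 3 {1,2,4} = inner_aut 4 [3]" using inner_single[of 3 4] complement4(2) by simp
      finally have "s = comp_aut (xy {} {4}) (inner_aut 4 [3])" by (simp add: xy_simps)
      then show ?thesis by (rule ex) auto
    qed
  qed
  then show ?thesis by blast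
qed

lemma comparable_pv:
  assumes w: "w \<in> Verts 4" "mm_le 4 pv w \<or> mm_le 4 w pv"
  shows "\<exists>D\<subseteq>{1}. \<exists>D'\<subseteq>{4}. \<exists>\<Theta>\<in>HT 4. ht_le \<Theta> Pth \<and> w = mm4.V (xy D D') \<Theta>"
proof -
  have "\<Lambda> = Pth" if "\<Lambda> \<in> HT 4" "ht_le Pth \<Lambda>" for \<Lambda>
    by (rule ht_le_maximal[OF that]) (auto simp: Pth_def)
  from mm4.comparable_below[OF Pth_HT this w[unfolded pv_def]]
  obtain \<alpha> \<Theta> where a: "\<alpha> \<in> Car 4 Pth" "\<Theta> \<in> HT 4" "ht_le \<Theta> Pth" "w = mm4.V \<alpha> \<Theta>" by blast
  obtain D D' u where D: "D \<subseteq> {1}" "D' \<subseteq> {4}" "set u \<subseteq> {1..4}" "\<alpha> = comp_aut (xy D D') (inner_aut 4 u)"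
    using Car_Pth[OF a(1)] by blast
  then have "w = mm4.V (xy D D') \<Theta>" using a mm4.V_comp_inner[OF xy_Aut0 a(2)] by simp
  then show ?thesis using a D by blast
qed

section \<open>Fixed points near the three vertices\<close>

lemma Bst1_eq: "Bst 1 = {{1,2}, {2,3,4}}"
  unfolding Bst_def by auto

lemma Bst_eqs: "Bst 3 = {{2,3}, {1,2,4}}" "Bst 4 = {{2,4}, {1,2,3}}"
  unfolding Bst_def by auto

lemma Bst1_HT: "Bst 1 \<in> HT 4"
proof (rule hypertreeI)
  let ?F = "\<lambda>a b :: nat. if a = b then ([a], []) else if a \<noteq> 1 \<and> b \<noteq> 1 then ([a, b], [{2,3,4}])
      else if a = 2 \<or> b = 2 then ([a, b], [{1,2}])
      else if a = 1 then ([1, 2, b], [{1,2}, {2,3,4}]) else ([a, 2, 1], [{2,3,4}, {1,2}])"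
  have ne: "{1,2} \<noteq> {2,3,4::nat}" "{2,3,4} \<noteq> {1,2::nat}" by auto
  show "walk 4 (Bst 1) (fst (?F a b)) (snd (?F a b)) \<and> hd (fst (?F a b)) = a \<and> last (fst (?F a b)) = b"
    if "a \<in> {1..4}" "b \<in> {1..4}" for a b
    using that unfolding vertices4 Bst1_eq
    by (elim insertE emptyE) (use ne in \<open>simp_all add: walk_simps\<close>)
  show "(vs, es) = ?F (hd vs) (last vs)" if w: "walk 4 (Bst 1) vs es" for vs es
    using w
  proof (cases rule: walk4_cases)
    case (3 a b c e f)
    then have e: "e \<in> Bst 1" "f \<in> Bst 1" "a \<in> e" "b \<in> e" "b \<in> f" "c \<in> f" "a \<noteq> b" "b \<noteq> c" "e \<noteq> f"
      using w by (auto simp: walk_simps)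
    then have "b = 2" unfolding Bst1_eq by auto
    then show ?thesis using e 3 unfolding Bst1_eq by auto
  next
    case (4 a b c d e f g)
    then have "e \<in> Bst 1" "f \<in> Bst 1" "g \<in> Bst 1" "e \<noteq> f" "f \<noteq> g" "e \<noteq> g"
      using w by (auto simp: walk_simps)
    then show ?thesis unfolding Bst1_eq by blast
  qed (use w in \<open>auto simp: walk_simps Bst1_eq[simplified]\<close>)
qed (auto simp: Bst1_eq[simplified])

lemma perms4: "t14 permutes {1..4}" "t14 \<circ> t23 permutes {1..4}" "t34 permutes {1..4}" "t13 permutes {1..4}"
  by (auto intro!: permutes_compose permutes_swap_id)

lemma involutive_perms:
  "mm4.involutive (id_aut, t14)" "mm4.involutive (id_aut, t14 \<circ> t23)"
  "mm4.involutive (id_aut, t34)" "mm4.involutive (id_aut, t13)"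
proof -
  have id: "t14 \<circ> t14 = id" "(t14 \<circ> t23) \<circ> (t14 \<circ> t23) = id" "t34 \<circ> t34 = id" "t13 \<circ> t13 = id"
    by (auto simp: fun_eq_iff Transposition.transpose_def)
  show "mm4.involutive (id_aut, t14)" "mm4.involutive (id_aut, t14 \<circ> t23)"
    "mm4.involutive (id_aut, t34)" "mm4.involutive (id_aut, t13)"
    by (fact mm4.involutive_perm[OF perms4(1) id(1)] mm4.involutive_perm[OF perms4(2) id(2)]
        mm4.involutive_perm[OF perms4(3) id(3)] mm4.involutive_perm[OF perms4(4) id(4)])+
qed

lemma involutive_pconj2: "D \<subseteq> {1,3,4} \<Longrightarrow> mm4.involutive (pconj 2 D, id)"
  by (rule mm4.involutive_aut[OF pconj2_Aut0 pconj_square]) auto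

lemma involutive_xy: "D \<subseteq> {1} \<Longrightarrow> D' \<subseteq> {4} \<Longrightarrow> mm4.involutive (xy D D', id)"
  by (rule mm4.involutive_aut[OF xy_Aut0]) (auto simp: xy_comp xy_simps)

lemma supp_comparable: "y \<in> Pts n \<Longrightarrow> v \<in> supp y \<Longrightarrow> w \<in> supp y \<Longrightarrow>
    w \<in> Verts n \<and> (mm_le n v w \<or> mm_le n w v)"
  unfolding Pts_def simplices_def by blast

lemma comparable_same_hypertree:
  "\<alpha> \<in> Aut0 4 \<Longrightarrow> \<beta> \<in> Aut0 4 \<Longrightarrow> \<Theta> \<in> HT 4 \<Longrightarrow>
    mm_le 4 (mm4.V \<alpha> \<Theta>) (mm4.V \<beta> \<Theta>) \<or> mm_le 4 (mm4.V \<beta> \<Theta>) (mm4.V \<alpha> \<Theta>) \<Longrightarrow> mm4.V \<alpha> \<Theta> = mm4.V \<beta> \<Theta>"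
  using mm4.mm_le_same_card by metis

text \<open>Near \<open>hv\<close> all markings are trivial, so a permutation acts through the
  hypertrees alone, and only \<open>H0\<close> is invariant under both.\<close>

lemma hv_isolated:
  assumes y: "y \<in> Pts 4" "hv \<in> supp y"
    and T: "mm4.T (id_aut, t14) y = y" "mm4.T (id_aut, t14 \<circ> t23) y = y"
  shows "y = mm4.pnt hv"
proof (rule mm4.supp_single_eq_pnt[OF y(1)], rule subsetI)
  fix w assume w: "w \<in> supp y"
  obtain \<Theta> where \<Theta>: "\<Theta> \<in> HT 4" "w = mm4.V id_aut \<Theta>"
    using comparable_hv supp_comparable[OF y(1,2) w] by blast
  have "mm4.V id_aut ((`) \<pi> ` \<Theta>) = mm4.V id_aut \<Theta>"
    if "\<pi> permutes {1..4}" "mm4.involutive (id_aut, \<pi>)" "mm4.T (id_aut, \<pi>) y = y" for \<pi>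
    using mm4.T_fixed_vertex[OF that(2) y(1) that(3) w] mm4.act_perm[OF that(1) Aut0_id \<Theta>(1)]
    by (simp add: \<Theta>(2) conjperm_id[OF that(1)])
  then have inv: "(`) \<pi> ` \<Theta> = \<Theta>"
    if "\<pi> permutes {1..4}" "mm4.involutive (id_aut, \<pi>)" "mm4.T (id_aut, \<pi>) y = y" for \<pi>
    using that mm4.V_eq_iff[OF Aut0_id HT_image[OF that(1) \<Theta>(1)] Aut0_id \<Theta>(1)] by simp
  have "\<Theta> = H0"
    using hypertree_invariant_H0[OF \<Theta>(1)] inv[OF perms4(1) involutive_perms(1) T(1)]
      inv[OF perms4(2) involutive_perms(2) T(2)] by simp
  then show "w \<in> {hv}" using \<Theta>(2) by (simp add: hv_def)
qed

text \<open>If 1 and 3 share a hyperedge, identifying 3 with 1 turns their images into [2,1,2] and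
  [1]; if 2 and 4 do, identifying 4 with 2 gives [2] and [3,2,3]. The product of both generators is
  taken because each of the two folds of the path is excluded by one factor.\<close>

lemma xy_full_not_carried:
  assumes "xy {1} {4} \<in> Car 4 \<Theta>" "ht_le \<Theta> Pth"
  shows "\<Theta> = Pth"
proof (rule ccontr)
  assume "\<Theta> \<noteq> Pth"
  then obtain E where E: "E \<in> \<Theta>" "{1, 3} \<subseteq> E \<or> {2, 4} \<subseteq> E" using ht_le_Pth assms(2) by blast
  have v: "xy {1} {4} 1 = [2,1,2]" "xy {1} {4} 3 = [3]" "xy {1} {4} 2 = [2]" "xy {1} {4} 4 = [3,4,3]"
    by (simp_all add: xy_def comp_aut_def pconj_def wapp_def)
  from E(2) show False
  proof
    assume "{1, 3} \<subseteq> E"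
    then have "red (map (\<lambda>l. if l = 3 then 1 else l) (xy {1} {4} 1)) = red (map (\<lambda>l. if l = 3 then 1 else l) (xy {1} {4} 3))"
      by (intro Car_letter_identification[OF assms(1) E(1)]) auto
    then show False unfolding v by simp
  next
    assume "{2, 4} \<subseteq> E"
    then have "red (map (\<lambda>l. if l = 4 then 2 else l) (xy {1} {4} 2)) = red (map (\<lambda>l. if l = 4 then 2 else l) (xy {1} {4} 4))"
      by (intro Car_letter_identification[OF assms(1) E(1)]) auto
    then show False unfolding v by simp
  qed
qed

lemma pv_isolated:
  assumes y: "y \<in> Pts 4" "pv \<in> supp y" and T: "mm4.T (xy {1} {4}, id) y = y"
  shows "y = mm4.pnt pv"
proof (rule mm4.supp_single_eq_pnt[OF y(1)], rule subsetI)
  fix w assume w: "w \<in> supp y"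
  obtain D D' \<Theta> where D: "D \<subseteq> {1}" "D' \<subseteq> {4}" and \<Theta>: "\<Theta> \<in> HT 4" "ht_le \<Theta> Pth" "w = mm4.V (xy D D') \<Theta>"
    using comparable_pv supp_comparable[OF y(1,2) w] by blast
  have A: "xy D D' \<in> Aut0 4" "xy {1} {4} \<in> Aut0 4" using xy_Aut0 D by auto
  have "mm4.V (xy D D') \<Theta> = mm4.V (comp_aut (xy {1} {4}) (xy D D')) \<Theta>"
    using mm4.T_fixed_vertex[OF involutive_xy y(1) T w] mm4.act_aut[OF A(2,1) \<Theta>(1)] by (simp add: \<Theta>(3))
  then obtain c where c: "c \<in> Car 4 \<Theta>" "comp_aut (xy {1} {4}) (xy D D') = comp_aut (xy D D') c"
    using mm4.V_eq_iff[OF A(1) \<Theta>(1) Aut0_comp[OF A(2,1)] \<Theta>(1)] by blast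
  \<comment> \<open>\<open>c\<close> is the conjugate of \<open>xy {1} {4}\<close> by
    \<open>xy D D'\<close>, hence equal to it, because the four-group is abelian.\<close>
  have "c = comp_aut (comp_aut (xy D D') (xy D D')) c"
    using comp_aut_id_left[OF Car_conj_end[OF c(1)]] by (simp add: xy_comp[OF D D] xy_simps)
  also have "\<dots> = comp_aut (xy D D') (comp_aut (xy {1} {4}) (xy D D'))"
    unfolding c(2) comp_aut_assoc[OF Aut0_conj_end[OF A(1)]] ..
  also have "\<dots> = xy (sym_diff D (sym_diff {1} D)) (sym_diff D' (sym_diff {4} D'))"
    using D by (subst xy_comp; (subst xy_comp)?) auto
  also have "\<dots> = xy {1} {4}" using D by (intro arg_cong2[where f = xy]) auto
  finally have "\<Theta> = Pth" using xy_full_not_carried c(1) \<Theta>(2) by simp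
  then have "w = pv"
    using comparable_same_hypertree[OF Aut0_id A(1) Pth_HT] supp_comparable[OF y w] unfolding \<Theta>(3) pv_def by auto
  then show "w \<in> {pv}" by simp
qed

text \<open>The link of \<open>sv\<close> is a subdivided complete graph on four vertices; \<open>a12\<close> and \<open>a34\<close> subdivide opposite edges.\<close>

definition a12 where "a12 = mm4.V id_aut (Bst 1)"
definition a34 where "a34 = mm4.V (pconj 2 {3}) (Bst 1)"

lemma pconj2_comp_same_class:
  assumes D: "D \<subseteq> {1,3,4}" "D' \<subseteq> {1,3,4}" and \<Theta>: "\<Theta> \<in> HT 4"
  shows "mm4.V (pconj 2 D) \<Theta> = mm4.V (pconj 2 D') \<Theta> \<longleftrightarrow> pconj 2 (sym_diff D D') \<in> Car 4 \<Theta>"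
proof
  note A = pconj2_Aut0[OF D(1)] pconj2_Aut0[OF D(2)]
  have n2: "2 \<notin> D" "2 \<notin> D'" using D by auto
  { assume "mm4.V (pconj 2 D) \<Theta> = mm4.V (pconj 2 D') \<Theta>"
    then obtain c where c: "c \<in> Car 4 \<Theta>" "pconj 2 D' = comp_aut (pconj 2 D) c"
      unfolding mm4.V_eq_iff[OF A(1) \<Theta> A(2) \<Theta>] by blast
    have "c = comp_aut (comp_aut (pconj 2 D) (pconj 2 D)) c"
      using comp_aut_id_left[OF Car_conj_end[OF c(1)]] pconj_square[OF n2(1)] by simp
    also have "\<dots> = comp_aut (pconj 2 D) (pconj 2 D')"
      unfolding c(2) comp_aut_assoc[OF Aut0_conj_end[OF A(1)]] ..
    also have "\<dots> = pconj 2 (sym_diff D D')" using n2 by (rule pconj_comp_pconj)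
    finally show "pconj 2 (sym_diff D D') \<in> Car 4 \<Theta>" using c(1) by simp }
  assume c: "pconj 2 (sym_diff D D') \<in> Car 4 \<Theta>"
  have "comp_aut (pconj 2 D) (pconj 2 (sym_diff D D')) = pconj 2 (sym_diff D (sym_diff D D'))"
    using n2 by (intro pconj_comp_pconj) auto
  also have "sym_diff D (sym_diff D D') = D'" by auto
  finally show "mm4.V (pconj 2 D) \<Theta> = mm4.V (pconj 2 D') \<Theta>"
    unfolding mm4.V_eq_iff[OF A(1) \<Theta> A(2) \<Theta>] using c by metis
qed

lemma pconj2_carried:
  assumes "D \<subseteq> {1,3,4}" "\<And>E. E \<in> \<Theta> \<Longrightarrow> E \<inter> D = {} \<or> E \<subseteq> insert 2 D"
  shows "pconj 2 D \<in> Car 4 \<Theta>"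
proof (cases "D = {}")
  case True
  then show ?thesis by (simp add: pconj_empty Car_id)
next
  case False
  have D: "2 \<in> {1..4::nat}" "D \<subseteq> {1..4} - {2}" using assms(1) by auto
  have "carries 4 \<Theta> 2 D" unfolding carries_iff[OF D] using assms(2) by blast
  then have "pconj 2 D \<in> carried_pconjs 4 \<Theta>" unfolding carried_pconjs_def using D False by blast
  then show ?thesis by (rule carried_pconjs_Car)
qed

lemma Bst_edges: "{1,2,4} \<in> Bst 3" "{1,2,3} \<in> Bst 4" "{2,3,4} \<in> Bst 1" "{1,2,3,4} \<in> H0"
  unfolding Bst_def H0_def by auto

text \<open>A vertex with marking \<open>pconj 2 D\<close> is fixed only if its hypertree carries
  \<open>pconj 2 {1}\<close>. This excludes every fold of the star in which 1 shares a hyperedge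
  with another leaf, leaving \<open>Str\<close> and \<open>Bst 1\<close>. The two resulting
  neighbours of \<open>sv\<close> have the same hypertree, so no simplex contains both.\<close>

lemma fixed_near_sv:
  assumes y: "y \<in> Pts 4" "sv \<in> supp y" and T: "mm4.T (pconj 2 {1}, id) y = y"
  shows "supp y \<subseteq> {sv, a12} \<or> supp y \<subseteq> {sv, a34}"
proof -
  have *: "w = sv \<or> w = a12 \<or> w = a34" if w: "w \<in> supp y" for w
  proof -
    obtain D \<Theta> where D: "D \<subseteq> {1,3,4}" and \<Theta>: "\<Theta> \<in> HT 4" "ht_le \<Theta> Str" "w = mm4.V (pconj 2 D) \<Theta>"
      using comparable_sv supp_comparable[OF y w] by blast
    have A: "pconj 2 D \<in> Aut0 4" "pconj 2 {1} \<in> Aut0 4" using pconj2_Aut0 D by auto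
    have n2: "2 \<notin> D" using D by auto
    have sd: "sym_diff {1} D \<subseteq> {1,3,4}" using D by auto
    have "mm4.V (pconj 2 D) \<Theta> = mm4.V (comp_aut (pconj 2 {1}) (pconj 2 D)) \<Theta>"
      using mm4.T_fixed_vertex[OF involutive_pconj2 y(1) T w] mm4.act_aut[OF A(2,1) \<Theta>(1)] by (simp add: \<Theta>(3))
    also have "comp_aut (pconj 2 {1}) (pconj 2 D) = pconj 2 (sym_diff {1} D)" using n2 by (intro pconj_comp_pconj) auto
    finally have "pconj 2 (sym_diff D (sym_diff {1} D)) \<in> Car 4 \<Theta>"
      unfolding pconj2_comp_same_class[OF D sd \<Theta>(1)] .
    moreover have "sym_diff D (sym_diff {1} D) = {1}" by auto
    ultimately have x: "pconj 2 {1} \<in> Car 4 \<Theta>" by simp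
    have ne: "\<Theta> \<noteq> Bst 3" "\<Theta> \<noteq> Bst 4" "\<Theta> \<noteq> H0"
      using pconj_Car_edge[OF x, of _ 1 4] pconj_Car_edge[OF x, of _ 1 3] Bst_edges by fastforce+
    then consider "\<Theta> = Str" | "\<Theta> = Bst 1" using ht_le_Str[OF \<Theta>(2)] by blast
    then show ?thesis
    proof cases
      case 1
      then have "w = sv"
        using comparable_same_hypertree[OF Aut0_id A(1) Str_HT] supp_comparable[OF y w] unfolding \<Theta>(3) sv_def by auto
      then show ?thesis by simp
    next
      case 2
      have id: "id_aut = pconj 2 {}" by (simp add: pconj_empty)
      \<comment> \<open>\<open>Bst 1\<close> carries \<open>pconj 2\<close> of those subsets of
        {1,3,4} that do not separate 3 from 4, so a class is determined by whether \<open>D\<close>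
        separates them.\<close>
      show ?thesis
      proof (cases "3 \<in> D \<longleftrightarrow> 4 \<in> D")
        case True
        have "pconj 2 (sym_diff D {}) \<in> Car 4 (Bst 1)"
          using D True by (intro pconj2_carried) (auto simp: Bst1_eq[simplified])
        then have "w = a12" unfolding \<Theta>(3) 2 a12_def id by (subst pconj2_comp_same_class) (use D Bst1_HT in auto)
        then show ?thesis by simp
      next
        case False
        have "pconj 2 (sym_diff D {3}) \<in> Car 4 (Bst 1)"
          using D False by (intro pconj2_carried) (auto simp: Bst1_eq[simplified])
        then have "w = a34" unfolding \<Theta>(3) 2 a34_def by (subst pconj2_comp_same_class) (use D Bst1_HT in auto)
        then show ?thesis by simp
      qed
    qed
  qed
  have "a12 = a34" if "a12 \<in> supp y" "a34 \<in> supp y"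
    using comparable_same_hypertree[OF Aut0_id pconj2_Aut0 Bst1_HT, of "{3}"] supp_comparable[OF y(1) that]
    unfolding a12_def a34_def by auto
  then show ?thesis using * by blast
qed

text \<open>Invariance under (3 4) excludes \<open>Bst 3\<close> and \<open>Bst 4\<close>. For a
  translate of \<open>hv\<close> with marking \<open>pconj 2 D\<close>, invariance says that
  \<open>D\<close> does not separate 3 from 4, while comparability with \<open>a34\<close> says that
  it does.\<close>

lemma a34_fixed_isolated:
  assumes y: "y \<in> Pts 4" "sv \<in> supp y" "a34 \<in> supp y" and T: "mm4.T (id_aut, t34) y = y"
  shows "supp y \<subseteq> {sv, a34}"
proof
  fix w assume w: "w \<in> supp y"
  obtain D \<Theta> where D: "D \<subseteq> {1,3,4}" and \<Theta>: "\<Theta> \<in> HT 4" "ht_le \<Theta> Str" "w = mm4.V (pconj 2 D) \<Theta>"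
    using comparable_sv supp_comparable[OF y(1,2) w] by blast
  have A: "pconj 2 D \<in> Aut0 4" "pconj 2 {3} \<in> Aut0 4" using pconj2_Aut0 D by auto
  have t34D: "t34 ` D \<subseteq> {1,3,4}" using D by (auto simp: Transposition.transpose_def)
  have "conjperm t34 (pconj 2 D) = pconj 2 (t34 ` D)"
    unfolding conjperm_pconj[OF perms4(3)] by (simp add: Transposition.transpose_def)
  then have e: "mm4.V (pconj 2 D) \<Theta> = mm4.V (pconj 2 (t34 ` D)) ((`) t34 ` \<Theta>)"
    using mm4.T_fixed_vertex[OF involutive_perms(3) y(1) T w] mm4.act_perm[OF perms4(3) A(1) \<Theta>(1)] by (simp add: \<Theta>(3))
  then have inv: "(`) t34 ` \<Theta> = \<Theta>"
    using mm4.V_eq_iff[OF A(1) \<Theta>(1) pconj2_Aut0[OF t34D] HT_image[OF perms4(3) \<Theta>(1)]] by simp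
  have cmp: "mm_le 4 w a34 \<or> mm_le 4 a34 w" using supp_comparable[OF y(1,3) w] by blast
  have "\<Theta> \<noteq> Bst 3" "\<Theta> \<noteq> Bst 4"
  proof -
    have "t34 ` {2,3} = {2,4}" "t34 ` {2,4} = {2,3}" by (auto simp: Transposition.transpose_def)
    then have "{2,3} \<in> \<Theta> \<Longrightarrow> {2,4} \<in> \<Theta>" "{2,4} \<in> \<Theta> \<Longrightarrow> {2,3} \<in> \<Theta>" using inv by (metis imageI)+
    moreover have "{2,4} \<noteq> {2,3::nat}" "{2,3} \<noteq> {2,4::nat}" "{2,4} \<noteq> {1,2,4::nat}" "{2,3} \<noteq> {1,2,3::nat}"
      by (rule notI, drule equalityD2, simp)+
    then have "{2,3} \<in> Bst 3" "{2,4} \<notin> Bst 3" "{2,4} \<in> Bst 4" "{2,3} \<notin> Bst 4"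
      unfolding Bst_eqs by blast+
    ultimately show "\<Theta> \<noteq> Bst 3" "\<Theta> \<noteq> Bst 4" by blast+
  qed
  then consider "\<Theta> = Str" | "\<Theta> = Bst 1" | "\<Theta> = H0" using ht_le_Str[OF \<Theta>(2)] by blast
  then show "w \<in> {sv, a34}"
  proof cases
    case 1
    then have "w = sv"
      using comparable_same_hypertree[OF Aut0_id A(1) Str_HT] supp_comparable[OF y(1,2) w] unfolding \<Theta>(3) sv_def by auto
    then show ?thesis by simp
  next
    case 2
    then have "w = a34"
      using comparable_same_hypertree[OF A Bst1_HT] cmp unfolding \<Theta>(3) a34_def by auto
    then show ?thesis by simp
  next
    case 3
    have "pconj 2 (sym_diff D (t34 ` D)) \<in> Car 4 H0"
      using e unfolding inv unfolding 3 pconj2_comp_same_class[OF D t34D H0_HT] .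
    from pconj_Car_edge[OF this Bst_edges(4), of 1 3]
    have a: "1 \<in> sym_diff D (t34 ` D) \<longleftrightarrow> 3 \<in> sym_diff D (t34 ` D)" by simp
    have im: "1 \<in> t34 ` D \<longleftrightarrow> 1 \<in> D" "3 \<in> t34 ` D \<longleftrightarrow> 4 \<in> D"
      unfolding in_transpose_image_iff by (simp_all add: Transposition.transpose_def)
    have D34: "3 \<in> D \<longleftrightarrow> 4 \<in> D" using a im by blast
    have "Bst 1 \<noteq> H0" by (auto simp: Bst1_eq[simplified] H0_def)
    then have "\<not> mm_le 4 a34 w"
      unfolding \<Theta>(3) a34_def 3 mm4.mm_le_V[OF A(2) Bst1_HT A(1) H0_HT] using ht_le_H0 by blast
    then obtain c where c: "c \<in> Car 4 (Bst 1)" "pconj 2 {3} = comp_aut (pconj 2 D) c"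
      using cmp unfolding \<Theta>(3) a34_def 3 mm4.mm_le_V[OF A(1) H0_HT A(2) Bst1_HT] by blast
    then have "mm4.V (pconj 2 D) (Bst 1) = mm4.V (pconj 2 {3}) (Bst 1)"
      using mm4.V_eq_iff[OF A(1) Bst1_HT A(2) Bst1_HT] by blast
    then have "pconj 2 (sym_diff D {3}) \<in> Car 4 (Bst 1)"
      using D Bst1_HT by (subst (asm) pconj2_comp_same_class) auto
    from pconj_Car_edge[OF this Bst_edges(3), of 3 4] show ?thesis using D34 by auto
  qed
qed

section \<open>Finiteness of the three stars, and the action on the vertices in use\<close>

lemma finite_simplices_hv: "finite {\<tau> \<in> simplices 4. hv \<in> \<tau>}"
proof (rule mm4.finite_simplices_of_finite_comparable)
  show "finite (mm4.V id_aut ` HT 4)" by (simp add: finite_HT)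
qed (use comparable_hv in blast)

lemma finite_simplices_pv: "finite {\<tau> \<in> simplices 4. pv \<in> \<tau>}"
proof (rule mm4.finite_simplices_of_finite_comparable)
  show "finite ((\<lambda>(D, D', \<Theta>). mm4.V (xy D D') \<Theta>) ` (Pow {1} \<times> Pow {4} \<times> HT 4))" by (simp add: finite_HT)
  fix w assume "w \<in> Verts 4" "mm_le 4 pv w \<or> mm_le 4 w pv"
  then obtain D D' \<Theta> where "D \<subseteq> {1}" "D' \<subseteq> {4}" "\<Theta> \<in> HT 4" "w = mm4.V (xy D D') \<Theta>" using comparable_pv by blast
  then show "w \<in> (\<lambda>(D, D', \<Theta>). mm4.V (xy D D') \<Theta>) ` (Pow {1} \<times> Pow {4} \<times> HT 4)"
    by (intro image_eqI[of _ _ "(D, D', \<Theta>)"]) auto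
qed

lemma finite_simplices_sv: "finite {\<tau> \<in> simplices 4. sv \<in> \<tau>}"
proof (rule mm4.finite_simplices_of_finite_comparable)
  show "finite ((\<lambda>(D, \<Theta>). mm4.V (pconj 2 D) \<Theta>) ` (Pow {1,3,4} \<times> HT 4))" by (simp add: finite_HT)
  fix w assume "w \<in> Verts 4" "mm_le 4 sv w \<or> mm_le 4 w sv"
  then obtain D \<Theta> where "D \<subseteq> {1,3,4}" "\<Theta> \<in> HT 4" "w = mm4.V (pconj 2 D) \<Theta>" using comparable_sv by blast
  then show "w \<in> (\<lambda>(D, \<Theta>). mm4.V (pconj 2 D) \<Theta>) ` (Pow {1,3,4} \<times> HT 4)"
    by (intro image_eqI[of _ _ "(D, \<Theta>)"]) auto
qed

lemma act_hv:
  assumes "\<pi> permutes {1..4}"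
  shows "act 4 (id_aut, \<pi>) hv = hv"
proof -
  have "\<pi> ` {1,2,3,4} = {1,2,3,4}" using permutes_image[OF assms] unfolding vertices4 .
  then have "(`) \<pi> ` H0 = H0" by (simp add: H0_def)
  then show ?thesis unfolding hv_def mm4.act_perm[OF assms Aut0_id H0_HT] conjperm_id[OF assms] by simp
qed

lemma act_perm_id:
  "\<pi> permutes {1..4} \<Longrightarrow> \<Theta> \<in> HT 4 \<Longrightarrow> act 4 (id_aut, \<pi>) (mm4.V id_aut \<Theta>) = mm4.V id_aut ((`) \<pi> ` \<Theta>)"
  using mm4.act_perm[OF _ Aut0_id] by (simp add: conjperm_id)

text \<open>The product of (1 4) and (2 3) reverses the path 1-2-3-4 and also its image 4-2-3-1
  under (1 4), so it fixes both vertices that (1 4) exchanges in the argument at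
  \<open>hv\<close>.\<close>

lemma rotation_Pth_image: "(`) (t14 \<circ> t23) ` Pth = Pth" "(`) (t14 \<circ> t23) ` (`) t14 ` Pth = (`) t14 ` Pth"
  by (simp_all add: Pth_def Transposition.transpose_def insert_commute)

lemma Str_image: "(`) t14 ` Str = Str" "(`) t34 ` Str = Str" "(`) t13 ` Str = Str"
  by (simp_all add: Str_def Transposition.transpose_def insert_commute)

lemma act_sv: "act 4 (id_aut, t14) sv = sv" "act 4 (id_aut, t34) sv = sv" "act 4 (id_aut, t13) sv = sv"
  unfolding sv_def act_perm_id[OF perms4(1) Str_HT] act_perm_id[OF perms4(3) Str_HT]
    act_perm_id[OF perms4(4) Str_HT] Str_image by (rule refl)+

lemma act_pv: "act 4 (id_aut, t14 \<circ> t23) pv = pv"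
  "act 4 (id_aut, t14 \<circ> t23) (act 4 (id_aut, t14) pv) = act 4 (id_aut, t14) pv"
  unfolding pv_def act_perm_id[OF perms4(1) Pth_HT] act_perm_id[OF perms4(2) Pth_HT]
    act_perm_id[OF perms4(2) HT_image[OF perms4(1) Pth_HT]] rotation_Pth_image by (rule refl)+

lemma act_Car_id: "c \<in> Car 4 \<Theta> \<Longrightarrow> \<Theta> \<in> HT 4 \<Longrightarrow> act 4 (c, id) (mm4.V id_aut \<Theta>) = mm4.V id_aut \<Theta>"
proof -
  assume c: "c \<in> Car 4 \<Theta>" and \<Theta>: "\<Theta> \<in> HT 4"
  have "mm4.V id_aut \<Theta> = mm4.V c \<Theta>"
    using mm4.V_eq_iff[OF Aut0_id \<Theta> Car_Aut0[OF c] \<Theta>] c comp_aut_id_left[OF Car_conj_end[OF c]] by metis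
  then show ?thesis
    using mm4.act_aut[OF Car_Aut0[OF c] Aut0_id \<Theta>] comp_aut_id_right[OF Car_conj_end[OF c]] by simp
qed

lemma xy_Car_Pth: "D \<subseteq> {1} \<Longrightarrow> D' \<subseteq> {4} \<Longrightarrow> xy D D' \<in> Car 4 Pth"
proof -
  assume D: "D \<subseteq> {1}" "D' \<subseteq> {4}"
  have 1: "pconj 2 D \<in> Car 4 Pth" by (rule pconj2_carried) (use D in \<open>auto simp: Pth_def\<close>)
  have "pconj 3 D' \<in> Car 4 Pth"
  proof (cases "D' = {}")
    case True
    then show ?thesis by (simp add: pconj_empty Car_id)
  next
    case False
    have i: "3 \<in> {1..4::nat}" "D' \<subseteq> {1..4} - {3}" using D by auto
    have "carries 4 Pth 3 D'" unfolding carries_iff[OF i] using D by (auto simp: Pth_def)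
    then have "pconj 3 D' \<in> carried_pconjs 4 Pth" unfolding carried_pconjs_def using i False by blast
    then show ?thesis by (rule carried_pconjs_Car)
  qed
  then show ?thesis unfolding xy_def using Car_comp 1 by blast
qed

lemma act_xy_pv: "D \<subseteq> {1} \<Longrightarrow> D' \<subseteq> {4} \<Longrightarrow> act 4 (xy D D', id) pv = pv"
  unfolding pv_def by (rule act_Car_id[OF xy_Car_Pth Pth_HT])

lemma act_pconj2_sv: "D \<subseteq> {1,3,4} \<Longrightarrow> act 4 (pconj 2 D, id) sv = sv"
  unfolding sv_def by (rule act_Car_id[OF pconj2_carried Str_HT]) (auto simp: Str_def)

text \<open>The four translates of \<open>hv\<close> adjacent to \<open>pv\<close>.\<close>

definition hxy where "hxy D D' = mm4.V (xy D D') H0"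

lemma act_xy_hxy:
  "D \<subseteq> {1} \<Longrightarrow> D' \<subseteq> {4} \<Longrightarrow> E \<subseteq> {1} \<Longrightarrow> E' \<subseteq> {4} \<Longrightarrow>
    act 4 (xy D D', id) (hxy E E') = hxy (sym_diff D E) (sym_diff D' E')"
  unfolding hxy_def by (simp add: mm4.act_aut[OF xy_Aut0 xy_Aut0 H0_HT] xy_comp)

lemma hxy_empty: "hxy {} {} = hv"
  by (simp add: hxy_def xy_simps hv_def)

text \<open>Reversal of the path exchanges \<open>pconj 2 {1}\<close> and
  \<open>pconj 3 {4}\<close>. On the square of translates it is the reflection through
  \<open>hxy {1} {4}\<close>.\<close>

lemma act_rotation_hxy: "act 4 (id_aut, t14 \<circ> t23) (hxy {} {4}) = hxy {1} {}"
  "act 4 (id_aut, t14 \<circ> t23) (hxy {1} {4}) = hxy {1} {4}"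
proof -
  have "(t14 \<circ> t23) ` {1,2,3,4} = {1,2,3,4}" using permutes_image[OF perms4(2)] unfolding vertices4 .
  then have H: "(`) (t14 \<circ> t23) ` H0 = H0" by (simp add: H0_def)
  have c: "conjperm (t14 \<circ> t23) (pconj 3 {4}) = pconj 2 {1}" "conjperm (t14 \<circ> t23) (pconj 2 {1}) = pconj 3 {4}"
    unfolding conjperm_pconj[OF perms4(2)] by (simp_all add: Transposition.transpose_def)
  then have cxy: "conjperm (t14 \<circ> t23) (xy {1} {4}) = xy {1} {4}"
    unfolding xy_def conjperm_comp[OF perms4(2)] by (simp add: pconj_2_3_commute)
  have A: "xy {1} {4} \<in> Aut0 4" by (rule xy_Aut0) auto
  show "act 4 (id_aut, t14 \<circ> t23) (hxy {1} {4}) = hxy {1} {4}"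
    unfolding hxy_def mm4.act_perm[OF perms4(2) A H0_HT] H cxy ..
  have "mm4.V (conjperm (t14 \<circ> t23) (xy {} {4})) ((`) (t14 \<circ> t23) ` H0) = mm4.V (xy {1} {}) H0"
    unfolding H xy_simps(2)[OF order_refl] xy_simps(3)[OF order_refl] c ..
  then show "act 4 (id_aut, t14 \<circ> t23) (hxy {} {4}) = hxy {1} {}"
    unfolding hxy_def using mm4.act_perm[OF perms4(2) xy_Aut0[of "{}" "{4}"] H0_HT] by simp
qed

text \<open>Relabelling by (1 3) turns \<open>pconj 2 {1}\<close> into \<open>pconj 2 {3}\<close>.
  At \<open>sv\<close> this equates the distances from the direction of \<open>hv\<close> to those
  of its two translates.\<close>

lemma act_t13_hx: "act 4 (id_aut, t13) (hxy {1} {}) = act 4 (pconj 2 {3}, id) hv"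
proof -
  have "t13 ` {1,2,3,4} = {1,2,3,4}" using permutes_image[OF perms4(4)] unfolding vertices4 .
  then have H: "(`) t13 ` H0 = H0" by (simp add: H0_def)
  have c: "conjperm t13 (pconj 2 {1}) = pconj 2 {3}"
    unfolding conjperm_pconj[OF perms4(4)] by (simp add: Transposition.transpose_def)
  have A: "pconj 2 {1} \<in> Aut0 4" "pconj 2 {3} \<in> Aut0 4" using pconj2_Aut0 by auto
  have e: "hxy {1} {} = mm4.V (pconj 2 {1}) H0" by (simp add: hxy_def xy_simps)
  have "act 4 (id_aut, t13) (hxy {1} {}) = mm4.V (pconj 2 {3}) H0"
    unfolding e mm4.act_perm[OF perms4(4) A(1) H0_HT] c H ..
  also have "\<dots> = act 4 (pconj 2 {3}, id) hv"
    unfolding hv_def mm4.act_aut[OF A(2) Aut0_id H0_HT] comp_aut_id_right[OF Aut0_conj_end[OF A(2)]] ..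
  finally show ?thesis .
qed

lemma act_a12: "act 4 (pconj 2 {3}, id) a12 = a34"
proof -
  have A: "pconj 2 {3} \<in> Aut0 4" using pconj2_Aut0 by auto
  show ?thesis
    unfolding a12_def a34_def mm4.act_aut[OF A Aut0_id Bst1_HT] comp_aut_id_right[OF Aut0_conj_end[OF A]] ..
qed

text \<open>The marking \<open>pconj 2 {3}\<close> becomes \<open>pconj 2 {4}\<close>; the two
  differ by \<open>pconj 2 {3,4}\<close>, which \<open>Bst 1\<close> carries.\<close>

lemma act_t34_a34: "act 4 (id_aut, t34) a34 = a34"
proof -
  have A: "pconj 2 {3} \<in> Aut0 4" using pconj2_Aut0 by auto
  have c: "conjperm t34 (pconj 2 {3}) = pconj 2 {4}"
    unfolding conjperm_pconj[OF perms4(3)] by (simp add: Transposition.transpose_def)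
  have B: "(`) t34 ` Bst 1 = Bst 1"
    unfolding Bst1_eq by (simp add: Transposition.transpose_def insert_commute)
  have "pconj 2 (sym_diff {4} {3}) \<in> Car 4 (Bst 1)"
    by (rule pconj2_carried) (auto simp: Bst1_eq[simplified])
  then have "mm4.V (pconj 2 {4}) (Bst 1) = mm4.V (pconj 2 {3}) (Bst 1)"
    using pconj2_comp_same_class[OF _ _ Bst1_HT, of "{4}" "{3}"] by simp
  then show ?thesis unfolding a34_def mm4.act_perm[OF perms4(3) A Bst1_HT] c B .
qed

text \<open>Separates the direction of \<open>hv\<close> at \<open>sv\<close>, which (1 3) fixes,
  from the edge to \<open>a34\<close>.\<close>

lemma act_t13_a34: "act 4 (id_aut, t13) a34 \<noteq> a34"
proof
  have A: "pconj 2 {3} \<in> Aut0 4" using pconj2_Aut0 by auto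
  assume "act 4 (id_aut, t13) a34 = a34"
  then have "(`) t13 ` Bst 1 = Bst 1"
    unfolding a34_def mm4.act_perm[OF perms4(4) A Bst1_HT]
      mm4.V_eq_iff[OF conjperm_Aut0[OF perms4(4) A] HT_image[OF perms4(4) Bst1_HT] A Bst1_HT] by simp
  moreover have "t13 ` {1,2} = {3,2}" by (simp add: Transposition.transpose_def insert_commute)
  ultimately have "{3,2} \<in> Bst 1" unfolding Bst1_eq by (metis imageI insertI1)
  moreover have "{3,2} \<noteq> {1,2::nat}" "{3,2} \<noteq> {2,3,4::nat}" by (rule notI, drule equalityD2, simp)+
  ultimately show False unfolding Bst1_eq by blast
qed

lemma H0_ne: "H0 \<noteq> Pth" "H0 \<noteq> Str" "Pth \<noteq> Str"
proof -
  have "card H0 = 1" by (simp add: H0_def)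
  moreover have "card Pth = 3" "card Str = 3" by (auto simp: Pth_def Str_def doubleton_eq_iff)
  ultimately show "H0 \<noteq> Pth" "H0 \<noteq> Str" by auto
  have "{3,4} \<in> Pth" "{3,4} \<notin> Str" by (auto simp: Pth_def Str_def doubleton_eq_iff)
  then show "Pth \<noteq> Str" by blast
qed

lemma special_distinct: "hv \<noteq> pv" "hv \<noteq> sv" "pv \<noteq> sv"
  unfolding hv_def pv_def sv_def
  using mm4.V_eq_iff[OF Aut0_id H0_HT Aut0_id Pth_HT] mm4.V_eq_iff[OF Aut0_id H0_HT Aut0_id Str_HT]
    mm4.V_eq_iff[OF Aut0_id Pth_HT Aut0_id Str_HT] H0_ne by auto

lemma (in mm_space) T_fixedI:
  assumes g: "involutive g" and v: "\<And>v. v \<in> supp y \<Longrightarrow> act n g v = v"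
  shows "T g y = y"
proof (rule ext)
  fix u
  show "T g y u = y u"
  proof (cases "u \<in> supp y")
    case True
    then show ?thesis using v by (simp add: T_def)
  next
    case False
    have "act n g u \<notin> supp y"
    proof
      assume "act n g u \<in> supp y"
      then have "act n g (act n g u) = act n g u" by (rule v)
      then show False using False act_act[OF g] \<open>act n g u \<in> supp y\<close> by metis
    qed
    then show ?thesis using False by (simp add: T_def supp_def)
  qed
qed

lemma (in mm_space) pnt_inject: "pnt u = pnt v \<longleftrightarrow> u = v"
  using supp_pnt by (metis singleton_inject)

section \<open>The three angle bounds\<close>

locale equivariant_cn = simplexwise 4 ds + cn_space "Pts 4" "len_dist 4 ds" for ds +
  assumes eq: "equivariant 4 ds"
begin

abbreviation d :: "pt \<Rightarrow> pt \<Rightarrow> real" where "d \<equiv> len_dist 4 ds"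
abbreviation H :: pt where "H \<equiv> mm4.pnt hv"
abbreviation P :: pt where "P \<equiv> mm4.pnt pv"
abbreviation S :: pt where "S \<equiv> mm4.pnt sv"

lemma isom_T: "mm4.involutive g \<Longrightarrow> isom (mm4.T g)"
  unfolding isom_def using mm4.T_Pts mm4.T_dist[OF eq] by blast

lemma special_Pts: "H \<in> Pts 4" "P \<in> Pts 4" "S \<in> Pts 4"
  using special_Verts mm4.pnt_Pts by auto

lemma T_toward:
  assumes g: "mm4.involutive g" and uv: "u \<in> Verts 4" "v \<in> Verts 4" and t: "0 \<le> t" "t \<le> d (mm4.pnt u) (mm4.pnt v)"
  shows "mm4.T g (toward (mm4.pnt u) (mm4.pnt v) t) = toward (mm4.pnt (act 4 g u)) (mm4.pnt (act 4 g v)) t"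
  using isom_toward[OF isom_T[OF g] mm4.pnt_Pts[OF uv(1)] mm4.pnt_Pts[OF uv(2)] t] by (simp add: mm4.T_pnt[OF g])

lemma dist_act:
  assumes g: "mm4.involutive g" and uv: "u \<in> Verts 4" "v \<in> Verts 4"
  shows "d (mm4.pnt (act 4 g u)) (mm4.pnt (act 4 g v)) = d (mm4.pnt u) (mm4.pnt v)"
  using isom_dist[OF isom_T[OF g] mm4.pnt_Pts[OF uv(1)] mm4.pnt_Pts[OF uv(2)]] by (simp add: mm4.T_pnt[OF g])

lemma star_radius:
  assumes "v \<in> Verts 4" "finite {\<tau> \<in> simplices 4. v \<in> \<tau>}"
  shows "\<exists>e>0. \<forall>y\<in>Pts 4. d (mm4.pnt v) y < e \<longrightarrow> v \<in> supp y"
  using open_star_nbhd[OF geod mm4.pnt_Pts[OF assms(1)]] assms(2) by simp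

text \<open>The transposition (1 4) swaps the directions of \<open>pv\<close> and of its image and
  fixes that of \<open>sv\<close>; the path reversal fixes both of the former. As \<open>hv\<close>
  is isolated in the common fixed set, the swapped points are antipodal, and the third point is
  equally far from both. The median inequality 6 t^2 \<le> 2 t^2 + 2 c^2 gives c^2 \<ge> 2 t^2 for
  that common distance c.\<close>

lemma angle_at_h:
  assumes t: "0 < t" "t \<le> d H P" "t \<le> d H S" and e: "t < e" "\<forall>y\<in>Pts 4. d H y < e \<longrightarrow> hv \<in> supp y"
  shows "2 * t\<^sup>2 \<le> (d (toward H P t) (toward H S t))\<^sup>2"
proof -
  define pv' where "pv' = act 4 (id_aut, t14) pv"
  let ?P' = "mm4.pnt pv'"
  let ?p = "toward H P t" and ?p' = "toward H ?P' t" and ?s = "toward H S t"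
  note g = involutive_perms(1,2)
  have V: "pv' \<in> Verts 4" unfolding pv'_def using mm4.act_in_Verts[OF g(1) special_Verts(2)] .
  have dP': "d H ?P' = d H P"
    using dist_act[OF g(1) special_Verts(1,2)] by (simp only: act_hv[OF perms4(1)] pv'_def[symmetric])
  have bk: "act 4 (id_aut, t14) pv' = pv" unfolding pv'_def by (rule mm4.act_act[OF g(1)])
  have t': "t \<le> d H ?P'" using t dP' by simp
  note X = special_Pts mm4.pnt_Pts[OF V]
  have 1: "mm4.T (id_aut, t14) ?p = ?p'" "mm4.T (id_aut, t14) ?p' = ?p" "mm4.T (id_aut, t14) ?s = ?s"
    using T_toward[OF g(1) special_Verts(1) special_Verts(2), of t] T_toward[OF g(1) special_Verts(1) V, of t]
      T_toward[OF g(1) special_Verts(1) special_Verts(3), of t] t t'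
    by (simp_all only: act_hv[OF perms4(1)] pv'_def[symmetric] bk act_sv)
  have 2: "mm4.T (id_aut, t14 \<circ> t23) ?p = ?p" "mm4.T (id_aut, t14 \<circ> t23) ?p' = ?p'"
    using T_toward[OF g(2) special_Verts(1) special_Verts(2), of t] T_toward[OF g(2) special_Verts(1) V, of t] t t'
    by (simp_all only: act_hv[OF perms4(2)] act_pv pv'_def)
  have inP: "?p \<in> Pts 4" "?p' \<in> Pts 4" "?s \<in> Pts 4" using X t t' by auto
  have r: "d H ?p = t" "d H ?p' = t" "d H ?s = t" using X t t' by auto
  have "d ?p ?p' = 2 * t"
  proof (rule opposite_of_isolated[where G = "{mm4.T (id_aut, t14), mm4.T (id_aut, t14 \<circ> t23)}"])
    fix m assume m: "m \<in> Pts 4" "d H m \<le> t" "\<forall>F\<in>{mm4.T (id_aut, t14), mm4.T (id_aut, t14 \<circ> t23)}. F m = m"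
    then have "hv \<in> supp m" using e by auto
    then show "m = H" using hv_isolated m by auto
  qed (use inP X r 1 2 isom_T[OF g(1)] isom_T[OF g(2)] in auto)
  moreover have "d ?s ?p' = d ?s ?p" using isom_dist[OF isom_T[OF g(1)] inP(3,1)] 1 by simp
  ultimately have "4 * t\<^sup>2 + 2 * (d ?s H)\<^sup>2 \<le> 2 * t\<^sup>2 + (d ?s ?p)\<^sup>2 + (d ?s ?p)\<^sup>2"
    using median[OF inP(1,2,3) X(1), of t] r dist_sym[OF X(1) inP(1)] dist_sym[OF X(1) inP(2)] t by simp
  then show ?thesis using dist_sym[OF X(1) inP(3)] dist_sym[OF inP(1,3)] r by simp
qed

lemma hxy_Verts: "D \<subseteq> {1} \<Longrightarrow> D' \<subseteq> {4} \<Longrightarrow> hxy D D' \<in> Verts 4"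
  unfolding hxy_def by (simp add: xy_Aut0 H0_HT)

text \<open>The four-group \<open>xy\<close> moves the direction of \<open>hv\<close> around a
  square of four directions at \<open>pv\<close>, with opposite corners antipodal by isolation of
  \<open>pv\<close>. The sides at one corner are equal, so the median inequality gives squared sides
  of at least 2 t^2. The direction of \<open>sv\<close> is fixed by the element that swaps two
  adjacent corners, so its chord is at least half a side.\<close>

lemma angle_at_p:
  assumes t: "0 < t" "t \<le> d P H" "t \<le> d P S" and e: "t < e" "\<forall>y\<in>Pts 4. d P y < e \<longrightarrow> pv \<in> supp y"
  shows "1/2 * t\<^sup>2 \<le> (d (toward P H t) (toward P S t))\<^sup>2"
proof -
  define h where "h D D' = toward P (mm4.pnt (hxy D D')) t" for D D'
  let ?q = "toward P S t"
  have dh: "d P (mm4.pnt (hxy D D')) = d P H" if "D \<subseteq> {1}" "D' \<subseteq> {4}" for D D'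
    using dist_act[OF involutive_xy[OF that] special_Verts(2,1)] act_xy_hxy[OF that, of "{}" "{}"]
    by (simp add: act_xy_pv[OF that] hxy_empty)
  have hP: "h D D' \<in> Pts 4" "d P (h D D') = t" if "D \<subseteq> {1}" "D' \<subseteq> {4}" for D D'
    unfolding h_def using dh[OF that] t mm4.pnt_Pts[OF hxy_Verts[OF that]] special_Pts(2) by auto
  have T: "mm4.T (xy D D', id) (h E E') = h (sym_diff D E) (sym_diff D' E')"
    if "D \<subseteq> {1}" "D' \<subseteq> {4}" "E \<subseteq> {1}" "E' \<subseteq> {4}" for D D' E E'
    unfolding h_def using T_toward[OF involutive_xy[OF that(1,2)] special_Verts(2) hxy_Verts[OF that(3,4)], of t] t
    by (simp add: dh[OF that(3,4)] act_xy_pv[OF that(1,2)] act_xy_hxy[OF that])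
  have rot: "mm4.T (id_aut, t14 \<circ> t23) (h {} {4}) = h {1} {}" "mm4.T (id_aut, t14 \<circ> t23) (h {1} {4}) = h {1} {4}"
    unfolding h_def using t dh[of "{}" "{4}"] dh[of "{1}" "{4}"]
      T_toward[OF involutive_perms(2) special_Verts(2) hxy_Verts[of "{}" "{4}"], of t]
      T_toward[OF involutive_perms(2) special_Verts(2) hxy_Verts[of "{1}" "{4}"], of t]
    by (simp_all only: act_pv(1) act_rotation_hxy order_refl empty_subsetI less_imp_le)
  have h0: "h {} {} = toward P H t" by (simp add: h_def hxy_empty)
  let ?h1 = "h {} {}" and ?h2 = "h {1} {}" and ?h3 = "h {1} {4}" and ?h4 = "h {} {4}"
  have inP: "?h1 \<in> Pts 4" "?h2 \<in> Pts 4" "?h3 \<in> Pts 4" "?h4 \<in> Pts 4" using hP by auto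
  have q: "?q \<in> Pts 4" using special_Pts t by auto
  have x: "xy {1} {} = pconj 2 {1}" by (simp add: xy_simps)
  have Tq: "mm4.T (xy {1} {}, id) ?q = ?q"
  proof -
    have pvx: "act 4 (xy {1} {}, id) pv = pv" by (rule act_xy_pv) auto
    have svx: "act 4 (xy {1} {}, id) sv = sv" unfolding x by (rule act_pconj2_sv) auto
    show ?thesis
      using T_toward[OF involutive_xy[of "{1}" "{}"] special_Verts(2,3), of t] t unfolding pvx svx by simp
  qed
  have T12: "mm4.T (xy {1} {}, id) ?h1 = ?h2" using T[of "{1}" "{}" "{}" "{}"] by simp
  have sd: "sym_diff {4} {4} = ({} :: nat set)" "sym_diff {1} {1} = ({} :: nat set)" by auto
  have "d ?h1 ?h3 = 2 * t"
  proof (rule opposite_of_isolated[where G = "{mm4.T (xy {1} {4}, id)}"])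
    fix m assume m: "m \<in> Pts 4" "d P m \<le> t" "\<forall>F\<in>{mm4.T (xy {1} {4}, id)}. F m = m"
    then have "pv \<in> supp m" using e by auto
    then show "m = P" using pv_isolated m by auto
  next
    have "mm4.T (xy {1} {4}, id) ?h1 = ?h3" "mm4.T (xy {1} {4}, id) ?h3 = ?h1"
      using T[of "{1}" "{4}" "{}" "{}"] T[of "{1}" "{4}" "{1}" "{4}"] sd by auto
    then show "isom F \<and> (F ?h1 = ?h1 \<and> F ?h3 = ?h3 \<or> F ?h1 = ?h3 \<and> F ?h3 = ?h1)"
      if "F \<in> {mm4.T (xy {1} {4}, id)}" for F
      using that isom_T[OF involutive_xy[of "{1}" "{4}"]] by simp
  qed (use inP special_Pts hP in auto)
  \<comment> \<open>\<open>xy {} {4}\<close> carries the side from 1 to 2 to the side from 4 to 3;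
    the path reversal then moves corner 4 to corner 2 and fixes corner 3.\<close>
  moreover have "d ?h2 ?h3 = d ?h1 ?h2"
  proof -
    have "mm4.T (xy {} {4}, id) ?h1 = ?h4" "mm4.T (xy {} {4}, id) ?h2 = ?h3"
      using T[of "{}" "{4}" "{}" "{}"] T[of "{}" "{4}" "{1}" "{}"] by auto
    then have "d ?h4 ?h3 = d ?h1 ?h2"
      using isom_dist[OF isom_T[OF involutive_xy[of "{}" "{4}"]] inP(1,2)] by simp
    moreover have "d ?h2 ?h3 = d ?h4 ?h3"
      using isom_dist[OF isom_T[OF involutive_perms(2)] inP(4,3)] unfolding rot .
    ultimately show ?thesis by simp
  qed
  moreover have "d ?h2 P = t" "d ?h2 ?h1 = d ?h1 ?h2" "d P ?h1 = t" "d P ?h3 = t"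
    using hP dist_sym[OF special_Pts(2) inP(2)] dist_sym[OF inP(1,2)] by auto
  ultimately have D: "2 * t\<^sup>2 \<le> (d ?h1 ?h2)\<^sup>2"
    using median[OF inP(1,3,2) special_Pts(2), of t] t by simp
  have "d ?q ?h2 = d ?q ?h1"
    using isom_dist[OF isom_T[OF involutive_xy[of "{1}" "{}"]] q inP(1)] Tq T12 by simp
  \<comment> \<open>Here a chord, not an angle, is halved: the bound t^2 / 2 is weaker than the
    chord of 45 degrees.\<close>
  then have "d ?h1 ?h2 \<le> 2 * d ?h1 ?q" using tri[OF inP(1) q inP(2)] dist_sym[OF inP(1) q] by simp
  then have "(d ?h1 ?h2)\<^sup>2 \<le> (2 * d ?h1 ?q)\<^sup>2" using dist_nonneg[OF inP(1,2)] by (intro power_mono) auto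
  then show ?thesis using D by (simp add: h0 power_mult_distrib)
qed

text \<open>In the fixed set of the transposition (3 4), near \<open>sv\<close> the edge to \<open>a34\<close> is a component of the
  complement of \<open>sv\<close>, so a geodesic leaving it must pass through \<open>sv\<close>.\<close>

lemma through_sv:
  assumes q: "q \<in> Pts 4" "supp q = {sv, a34}" "d S q = t" and t: "0 < t" "t \<le> d S H"
    and e: "t < e" "\<forall>y\<in>Pts 4. d S y < e \<longrightarrow> sv \<in> supp y"
  shows "d q (toward S H t) = 2 * t"
proof -
  let ?h = "toward S H t"
  let ?g = "(id_aut, t34)"
  note g = involutive_perms(3)
  have h: "?h \<in> Pts 4" "d S ?h = t" using special_Pts t by auto
  define L where "L = d q ?h"
  have L: "0 \<le> L" using dist_nonneg[OF q(1) h(1)] by (simp add: L_def)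
  define c where "c = toward q ?h"
  have Tq: "mm4.T ?g q = q"
    using q(2) act_sv(2) act_t34_a34 by (intro mm4.T_fixedI[OF g]) auto
  have Th: "mm4.T ?g ?h = ?h"
    using T_toward[OF g special_Verts(3,1), of t] t unfolding act_sv act_hv[OF perms4(3)] by simp
  have cX: "c \<tau> \<in> Pts 4" if "0 \<le> \<tau>" "\<tau> \<le> L" for \<tau>
    using that q h by (simp add: c_def L_def)
  have Tc: "mm4.T ?g (c \<tau>) = c \<tau>" if "0 \<le> \<tau>" "\<tau> \<le> L" for \<tau>
    unfolding c_def using isom_toward[OF isom_T[OF g] q(1) h(1)] that Tq Th by (simp add: L_def)
  have sc: "sv \<in> supp (c \<tau>)" if "0 \<le> \<tau>" "\<tau> \<le> L" for \<tau>
  proof -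
    have "d S (c \<tau>) \<le> t"
      unfolding c_def by (rule toward_close[OF q(1) h(1) special_Pts(3)]) (use that q(3) h(2) in \<open>auto simp: L_def\<close>)
    then show ?thesis using e cX[OF that] by auto
  qed
  have ends: "c 0 = q" "c L = ?h"
    unfolding c_def L_def using q h dist_nonneg[OF q(1) h(1)] by (auto intro!: toward_eqI simp: on_seg_def)
  have "\<exists>\<tau>\<in>{0..L}. c \<tau> = S"
  proof (rule ccontr)
    assume no: "\<not> (\<exists>\<tau>\<in>{0..L}. c \<tau> = S)"
    \<comment> \<open>Nearby points of the geodesic have larger or equal support, so the label could
      change only by gaining \<open>a34\<close>. The larger support would then lie in {sv, a34},
      which leaves only {sv} for the smaller one, and that point would be \<open>S\<close>.\<close>
    define lab where "lab \<tau> = (a34 \<in> supp (c \<tau>))" for \<tau>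
    have "lab constant_on {0..L}"
    proof (rule locally_constant_imp_constant)
      show "connected {0..L}" by simp
      fix \<tau> assume \<tau>: "\<tau> \<in> {0..L}"
      have "finite {\<sigma> \<in> simplices 4. supp (c \<tau>) \<subseteq> \<sigma>}"
        using sc[of \<tau>] \<tau> by (intro finite_subset[OF _ finite_simplices_sv]) auto
      then obtain r where r: "r > 0" "\<And>y. y \<in> Pts 4 \<Longrightarrow> d (c \<tau>) y < r \<Longrightarrow> supp (c \<tau>) \<subseteq> supp y"
        using open_star_nbhd[OF geod cX[of \<tau>]] \<tau> by auto
      have eqlab: "lab \<tau>' = lab \<tau>" if \<tau>': "\<tau>' \<in> {0..L}" "dist \<tau>' \<tau> < r" for \<tau>'
      proof -
        have "d (c \<tau>) (c \<tau>') = \<bar>\<tau> - \<tau>'\<bar>"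
          unfolding c_def using dist_toward_toward[OF q(1) h(1)] \<tau> \<tau>' by (simp add: L_def)
        then have sub: "supp (c \<tau>) \<subseteq> supp (c \<tau>')"
          using r(2)[OF cX[of \<tau>']] \<tau>' by (auto simp: dist_real_def)
        have False if l: "\<not> lab \<tau>" "lab \<tau>'"
        proof -
          have "\<not> supp (c \<tau>) \<subseteq> {sv}"
            using mm4.supp_single_eq_pnt[OF cX[of \<tau>], of sv] no \<tau> by auto
          then obtain w where w: "w \<in> supp (c \<tau>)" "w \<noteq> sv" by blast
          then have "w \<noteq> a34" using l by (auto simp: lab_def)
          moreover have "supp (c \<tau>') \<subseteq> {sv, a34}"
            using a34_fixed_isolated[OF cX sc _ Tc, of \<tau>'] \<tau>' l by (auto simp: lab_def)
          ultimately show False using w sub by blast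
        qed
        then show ?thesis using sub by (auto simp: lab_def)
      qed
      have "\<forall>\<tau>'\<in>{0..L} \<inter> ball \<tau> r. lab \<tau>' = lab \<tau>"
        using eqlab by (simp add: dist_commute)
      moreover have "openin (top_of_set {0..L}) ({0..L} \<inter> ball \<tau> r)" by (intro openin_open_Int open_ball)
      moreover have "\<tau> \<in> {0..L} \<inter> ball \<tau> r" using r(1) \<tau> by simp
      ultimately show "\<exists>T. openin (top_of_set {0..L}) T \<and> \<tau> \<in> T \<and> (\<forall>x\<in>T. lab x = lab \<tau>)" by blast
    qed
    then have "lab 0 = lab L" using L unfolding constant_on_def by auto
    moreover have "lab 0" using q(2) by (simp add: lab_def ends)
    ultimately have "a34 \<in> supp ?h" by (simp add: lab_def ends)
    \<comment> \<open>The end of the geodesic is fixed by (1 3), hence so is its support, whereas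
      \<open>a34\<close> is moved.\<close>
    moreover have "mm4.T (id_aut, t13) ?h = ?h"
      using T_toward[OF involutive_perms(4) special_Verts(3,1), of t] t unfolding act_sv act_hv[OF perms4(4)] by simp
    ultimately show False
      using mm4.T_fixed_vertex[OF involutive_perms(4) h(1)] act_t13_a34 by blast
  qed
  then obtain \<tau> where \<tau>: "\<tau> \<in> {0..L}" "c \<tau> = S" by blast
  then have "on_seg q ?h \<tau> S"
    using on_seg_toward[OF q(1) h(1), of \<tau>] by (simp add: c_def L_def)
  then have "d q S = \<tau>" "d S ?h = d q ?h - \<tau>" by (simp_all add: on_seg_def)
  then show ?thesis using q(3) h(2) dist_sym[OF special_Pts(3) q(1)] by linarith
qed

text \<open>The geodesic toward \<open>pv\<close> starts along the edge to \<open>a12\<close> or to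
  \<open>a34\<close>. In the second case its point q is antipodal to the point h toward
  \<open>hv\<close>. In the first, \<open>u = pconj 2 {3}\<close> moves q to the edge of
  \<open>a34\<close>, so q is antipodal to the image of h under \<open>u\<close>. By (1 3) that
  image is as far from h as the image under \<open>pconj 2 {1}\<close>, which fixes q; this is at
  most twice the chord c from h to q. The median inequality becomes 4 t^2 \<le> c^2 + 4 c^2.\<close>

lemma angle_at_s:
  assumes t: "0 < t" "t \<le> d S H" "t \<le> d S P" and e: "t < e" "\<forall>y\<in>Pts 4. d S y < e \<longrightarrow> sv \<in> supp y"
  shows "4/5 * t\<^sup>2 \<le> (d (toward S H t) (toward S P t))\<^sup>2"
proof -
  let ?q = "toward S P t" and ?h = "toward S H t"
  let ?x = "(pconj 2 {1}, id :: nat \<Rightarrow> nat)" and ?u = "(pconj 2 {3}, id :: nat \<Rightarrow> nat)"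
  have gx: "mm4.involutive ?x" and gu: "mm4.involutive ?u" by (rule involutive_pconj2, simp)+
  have xy: "pconj 2 {1} = xy {1} {}" by (simp add: xy_simps)
  have sv: "act 4 ?x sv = sv" "act 4 ?u sv = sv" by (rule act_pconj2_sv, simp)+
  have q: "?q \<in> Pts 4" "d S ?q = t" and h: "?h \<in> Pts 4" "d S ?h = t" using special_Pts t by auto
  have Tq: "mm4.T ?x ?q = ?q"
  proof -
    have pvx: "act 4 ?x pv = pv" unfolding xy by (rule act_xy_pv) auto
    show ?thesis using T_toward[OF gx special_Verts(3,2), of t] t unfolding pvx sv by simp
  qed
  have "sv \<in> supp ?q" using e q by auto
  from fixed_near_sv[OF q(1) this Tq] \<open>sv \<in> supp ?q\<close>
  have "supp ?q = {sv, a12} \<or> supp ?q = {sv, a34}"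
  proof -
    have "?q \<noteq> S" using q(2) t special_Pts(3) by auto
    then have "\<not> supp ?q \<subseteq> {sv}" using mm4.supp_single_eq_pnt[OF q(1)] by blast
    then show ?thesis using fixed_near_sv[OF q(1) \<open>sv \<in> supp ?q\<close> Tq] \<open>sv \<in> supp ?q\<close> by blast
  qed
  then show ?thesis
  proof
    assume "supp ?q = {sv, a34}"
    then have "d ?q ?h = 2 * t" using through_sv q t e by blast
    then show ?thesis using dist_sym[OF h(1) q(1)] by (simp add: power_mult_distrib)
  next
    assume sq: "supp ?q = {sv, a12}"
    let ?hx = "mm4.T ?x ?h" and ?hu = "mm4.T ?u ?h"
    have inP: "?hx \<in> Pts 4" "?hu \<in> Pts 4" "mm4.T ?u ?q \<in> Pts 4"
      using mm4.T_Pts[OF gx h(1)] mm4.T_Pts[OF gu h(1)] mm4.T_Pts[OF gu q(1)] by auto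
    have TuS: "mm4.T ?u S = S" unfolding mm4.T_pnt[OF gu] sv ..
    have "supp (mm4.T ?u ?q) = {sv, a34}"
      unfolding mm4.supp_T[OF gu] sq by (simp add: sv act_a12)
    moreover have "d S (mm4.T ?u ?q) = t"
      using isom_dist[OF isom_T[OF gu] special_Pts(3) q(1)] q(2) by (simp add: TuS)
    ultimately have "d (mm4.T ?u ?q) ?h = 2 * t" using through_sv inP(3) t e by blast
    then have qu: "d ?q ?hu = 2 * t"
      using isom_dist[OF isom_T[OF gu] inP(3) h(1)] by (simp add: mm4.T_T[OF gu])
    have hu: "?hu = toward S (mm4.pnt (act 4 ?u hv)) t"
      using T_toward[OF gu special_Verts(3,1), of t] t unfolding sv by simp
    have hx: "?hx = toward S (mm4.pnt (act 4 ?x hv)) t"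
      using T_toward[OF gx special_Verts(3,1), of t] t unfolding sv by simp
    have dx: "d S (mm4.pnt (act 4 ?x hv)) = d S H"
      using dist_act[OF gx special_Verts(3,1)] unfolding sv .
    have ax: "act 4 ?x hv = hxy {1} {}"
      using act_xy_hxy[of "{1}" "{}" "{}" "{}"] unfolding xy hxy_empty by simp
    \<comment> \<open>(1 3) fixes \<open>sv\<close> and takes one translate of \<open>hv\<close> to
      the other, so it takes the corresponding points at distance t to each other.\<close>
    have "mm4.T (id_aut, t13) ?hx = ?hu"
      unfolding hx hu using T_toward[OF involutive_perms(4) special_Verts(3) mm4.act_in_Verts[OF gx special_Verts(1)], of t] t dx
      unfolding act_sv ax act_t13_hx by simp
    moreover have "mm4.T (id_aut, t13) ?h = ?h"
      using T_toward[OF involutive_perms(4) special_Verts(3,1), of t] t unfolding act_sv act_hv[OF perms4(4)] by simp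
    ultimately have hxu: "d ?h ?hu = d ?h ?hx"
      using isom_dist[OF isom_T[OF involutive_perms(4)] h(1) inP(1)] by simp
    have "d ?q ?hx = d ?q ?h" using isom_dist[OF isom_T[OF gx] q(1) h(1)] Tq by simp
    then have "d ?h ?hx \<le> 2 * d ?h ?q" using tri[OF h(1) q(1) inP(1)] dist_sym[OF h(1) q(1)] by simp
    then have "(d ?h ?hx)\<^sup>2 \<le> (2 * d ?h ?q)\<^sup>2" using dist_nonneg[OF h(1) inP(1)] by (intro power_mono) auto
    moreover have "d S ?hu = t"
      using isom_dist[OF isom_T[OF gu] special_Pts(3) h(1)] h(2) by (simp add: TuS)
    then have "4 * t\<^sup>2 + 2 * (d ?h S)\<^sup>2 \<le> 2 * t\<^sup>2 + (d ?h ?q)\<^sup>2 + (d ?h ?hu)\<^sup>2"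
      using median[OF q(1) inP(2) h(1) special_Pts(3), of t] q(2) qu t by simp
    ultimately show ?thesis
      using hxu h(2) dist_sym[OF special_Pts(3) h(1)] by (simp add: power_mult_distrib)
  qed
qed

lemma contradiction: False
proof -
  have ne: "H \<noteq> P" "H \<noteq> S" "P \<noteq> S" using special_distinct by (auto simp: mm4.pnt_inject)
  obtain eh where eh: "eh > 0" "\<forall>y\<in>Pts 4. d H y < eh \<longrightarrow> hv \<in> supp y"
    using star_radius[OF special_Verts(1) finite_simplices_hv] by blast
  obtain ep where ep: "ep > 0" "\<forall>y\<in>Pts 4. d P y < ep \<longrightarrow> pv \<in> supp y"
    using star_radius[OF special_Verts(2) finite_simplices_pv] by blast
  obtain es where es: "es > 0" "\<forall>y\<in>Pts 4. d S y < es \<longrightarrow> sv \<in> supp y"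
    using star_radius[OF special_Verts(3) finite_simplices_sv] by blast
  have pos: "0 < d H P" "0 < d H S" "0 < d P S" using dist_pos special_Pts ne by auto
  have sym: "d P H = d H P" "d S H = d H S" "d S P = d P S" using dist_sym special_Pts by auto
  \<comment> \<open>One scale for all three corners: inside every star radius (halved for
    strictness) and no longer than any side.\<close>
  define t where "t = Min {eh / 2, ep / 2, es / 2, d H P, d H S, d P S}"
  have t: "0 < t" "t < eh" "t < ep" "t < es" "t \<le> d H P" "t \<le> d H S" "t \<le> d P S"
    using eh(1) ep(1) es(1) pos unfolding t_def by auto
  \<comment> \<open>The squared-chord constants 2, 1/2 and 4/5 become the coefficients 0, 3/2 and
    6/5 by k \<mapsto> 2 - k.\<close>
  show False
  proof (rule triangle_contradiction[OF special_Pts(1,2,3) ne(3)])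
    show "(d H P)\<^sup>2 + (d H S)\<^sup>2 - (d P S)\<^sup>2 \<le> 0"
      using comparison[OF special_Pts(1,2,3) t(1,5,6) angle_at_h[OF t(1,5,6,2) eh(2)]] by simp
    show "(d P H)\<^sup>2 + (d P S)\<^sup>2 - (d H S)\<^sup>2 \<le> 3/2 * d P H * d P S"
      using comparison[OF special_Pts(2,1,3) t(1) _ t(7) angle_at_p[OF t(1) _ t(7,3) ep(2)]] t(5) sym by simp
    show "(d S H)\<^sup>2 + (d S P)\<^sup>2 - (d H P)\<^sup>2 \<le> 6/5 * d S H * d S P"
      using comparison[OF special_Pts(3,1,2) t(1) _ _ angle_at_s[OF t(1) _ _ t(4) es(2)]] t(6,7) sym by simp
  qed
qed

end

section \<open>Nonexistence in the Euclidean and the hyperbolic case\<close>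

lemma no_equivariant_cn:
  assumes "simplexwise_metric 4 ds" "equivariant 4 ds" "cn_space (Pts 4) (len_dist 4 ds)"
  shows False
proof -
  interpret c: cn_space "Pts 4" "len_dist 4 ds" by fact
  interpret equivariant_cn ds using assms by unfold_locales
  show False by (rule contradiction)
qed

theorem theorem6p6:
  shows "\<not> (\<exists>ds. pe_metric 4 ds \<and> equivariant 4 ds \<and> CAT0 (Pts 4) (len_dist 4 ds))
       \<and> \<not> (\<exists>ds. ph_metric 4 ds \<and> equivariant 4 ds \<and> CAT_minus1 (Pts 4) (len_dist 4 ds))"
proof (intro conjI notI; elim exE conjE)
  fix ds assume ds: "pe_metric 4 ds" "equivariant 4 ds" "CAT0 (Pts 4) (len_dist 4 ds)"
  interpret simplexwise 4 ds by unfold_locales (rule simplexwise_metric_of_pe[OF ds(1)])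
  have "geodesic_metric (Pts 4) (len_dist 4 ds)"
    using ds(3) by (intro geodesic_metric_len_dist) (simp add: CAT0_def)
  then show False using no_equivariant_cn[OF sm ds(2)] geodesic_metric.cn_space_of_CAT0 ds(3) by blast
next
  fix ds assume ds: "ph_metric 4 ds" "equivariant 4 ds" "CAT_minus1 (Pts 4) (len_dist 4 ds)"
  interpret simplexwise 4 ds by unfold_locales (rule simplexwise_metric_of_ph[OF ds(1)])
  have "geodesic_metric (Pts 4) (len_dist 4 ds)"
    using ds(3) by (intro geodesic_metric_len_dist) (simp add: CAT_minus1_def)
  then show False using no_equivariant_cn[OF sm ds(2)] geodesic_metric.cn_space_of_CAT_minus1 ds(3) by blast
qed

end
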